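(* Let $k$ be a perfect field and let $A_\bullet=\bigoplus_{i\in\mathbb{Z}}A_i$ be a graded-semistable (finite-dimensional, $\mathbb{Z}$-graded) associative $k$-algebra with non-trivial grading. Let $J(A_\bullet)$ and $Z(A_\bullet)$ denote the Jacobson radical and the center of $A_\bullet$ respectively, and set $$A_\bullet^-=\bigoplus_{i<0}A_i,\qquad A_\bullet^+=\bigoplus_{i>0}A_i.$$ Then: (i) $A_\bullet^-\subseteq J(A_\bullet)\cap Z(A_\bullet)$; (ii) $A_\bullet^+\subseteq J(A_\bullet)$; (iii) $\mathrm{Ann}(A_\bullet)_n=0$ for $n<0$. In particular, this holds for $A_\bullet:=\mathrm{Gr}(F(A)^{\mathrm{Can}}_\bullet)$, where $A$ is an unstable finite-dimensional associative $k$-algebra.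
   Context: Associative algebras are finite-dimensional and not necessarily unital. $\mathrm{Ann}(A)=\{a\in A\mid ab=ba=0\text{ for all }b\in A\}$; for graded $A_\bullet$ it is a homogeneous ideal with $n$-th homogeneous component $\mathrm{Ann}(A_\bullet)_n$. The Jacobson radical of a possibly non-unital ring is $J(R)=\{x\in R\mid\text{every element } z \text{ of } Rx \text{ is left quasi-regular, i.e. } y+z-yz=0\text{ for some }y\in R\}$. A grading is trivial if it is concentrated in degree $0$. A filtration $F_\bullet$ of $A$ is a family of $k$-subspaces $F_m\subseteq A$, $m\in\mathbb{Z}$, such that $F_i\supseteq F_j$ when $i\le j$; $F_iF_j\subseteq F_{i+j}$ for all $i,j$; $F_i=A$ for $i\ll0$ and $F_i=0$ for $i\gg0$. The trivial filtration has $F_n=A$ for $n\le 0$ and $F_n=0$ for $n>0$. The weights of $F_\bullet$ are the integers $m$ with $F_m\ne F_{m+1}$. Set $$\mathrm{wt}(A,F_\bullet)=\sum_m m\dim(F_m/F_{m+1}),\quad \|F_\bullet\|=\Big(\sum_m m^2\dim(F_m/F_{m+1})\Big)^{1/2},\quad \nu(A,F_\bullet)=\frac{-\mathrm{wt}(A,F_\bullet)}{\|F_\bullet\|}$$ ($\nu$ for non-trivial $F_\bullet$). $A$ is semistable if $-\mathrm{wt}(A,F_\bullet)\ge0$ for all filtrations, and unstable otherwise. The canonical filtration $F(A)^{\mathrm{Can}}_\bullet$ is the trivial filtration if $A$ is semistable, and if $A$ is unstable it is the filtration minimizing $\nu(A,-)$, which exists and is unique up to positive rescaling of the weights by a theorem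 of Kempf. Equalities describing canonical filtrations are understood up to positive rescaling of the weights. The associated graded algebra of $F_\bullet$ is $\mathrm{Gr}(F_\bullet)=\bigoplus_m F_m/F_{m+1}$ with the multiplication induced from $A$. The split filtration of a graded algebra $A_\bullet$ has $m$-th piece $\bigoplus_{d\ge m}A_d$. A graded algebra is graded-semistable if its split filtration is its canonical filtration. *)

theory Defs
  imports "HOL-Algebra.QuotRing" "Jordan_Normal_Form.VS_Connect"
begin

text \<open>
  The ground field is a type \<open>'k::field\<close>, viewed as the \<open>HOL-Algebra\<close> ring \<open>class_ring\<close>.
  An algebra is a \<open>module\<close> record over it. Algebras need not be unital: the field \<open>one\<close> of the
  record is never referred to.
\<close>

definition perfect_field :: "'k::field itself \<Rightarrow> bool" where
  "perfect_field _ \<longleftrightarrow> CHAR('k) = 0 \<or> surj (\<lambda>x::'k. x ^ CHAR('k))"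

locale fin_dim_algebra = vectorspace "class_ring :: 'k::field ring" A
  for A :: "('k::field, 'a) module" +
  assumes fin_dim: "fin_dim"
    and mult_closed: "\<lbrakk>x \<in> carrier A; y \<in> carrier A\<rbrakk> \<Longrightarrow> x \<otimes>\<^bsub>A\<^esub> y \<in> carrier A"
    and mult_assoc: "\<lbrakk>x \<in> carrier A; y \<in> carrier A; z \<in> carrier A\<rbrakk> \<Longrightarrow>
      (x \<otimes>\<^bsub>A\<^esub> y) \<otimes>\<^bsub>A\<^esub> z = x \<otimes>\<^bsub>A\<^esub> (y \<otimes>\<^bsub>A\<^esub> z)"
    and mult_add_left: "\<lbrakk>x \<in> carrier A; y \<in> carrier A; z \<in> carrier A\<rbrakk> \<Longrightarrow>
      (x \<oplus>\<^bsub>A\<^esub> y) \<otimes>\<^bsub>A\<^esub> z = x \<otimes>\<^bsub>A\<^esub> z \<oplus>\<^bsub>A\<^esub> y \<otimes>\<^bsub>A\<^esub> z"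
    and mult_add_right: "\<lbrakk>x \<in> carrier A; y \<in> carrier A; z \<in> carrier A\<rbrakk> \<Longrightarrow>
      x \<otimes>\<^bsub>A\<^esub> (y \<oplus>\<^bsub>A\<^esub> z) = x \<otimes>\<^bsub>A\<^esub> y \<oplus>\<^bsub>A\<^esub> x \<otimes>\<^bsub>A\<^esub> z"
    and smult_mult_left: "\<lbrakk>x \<in> carrier A; y \<in> carrier A\<rbrakk> \<Longrightarrow>
      (c \<odot>\<^bsub>A\<^esub> x) \<otimes>\<^bsub>A\<^esub> y = c \<odot>\<^bsub>A\<^esub> (x \<otimes>\<^bsub>A\<^esub> y)"
    and smult_mult_right: "\<lbrakk>x \<in> carrier A; y \<in> carrier A\<rbrakk> \<Longrightarrow>
      x \<otimes>\<^bsub>A\<^esub> (c \<odot>\<^bsub>A\<^esub> y) = c \<odot>\<^bsub>A\<^esub> (x \<otimes>\<^bsub>A\<^esub> y)"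

definition annihilator :: "('k, 'a) module \<Rightarrow> 'a set" where
  "annihilator A =
    {a \<in> carrier A. \<forall>b \<in> carrier A. a \<otimes>\<^bsub>A\<^esub> b = \<zero>\<^bsub>A\<^esub> \<and> b \<otimes>\<^bsub>A\<^esub> a = \<zero>\<^bsub>A\<^esub>}"

definition center :: "('k, 'a) module \<Rightarrow> 'a set" where
  "center A = {z \<in> carrier A. \<forall>a \<in> carrier A. z \<otimes>\<^bsub>A\<^esub> a = a \<otimes>\<^bsub>A\<^esub> z}"

definition left_quasi_regular :: "('k, 'a) module \<Rightarrow> 'a \<Rightarrow> bool" where
  "left_quasi_regular R z \<longleftrightarrow>
    (\<exists>y \<in> carrier R. (y \<oplus>\<^bsub>R\<^esub> z) \<ominus>\<^bsub>R\<^esub> (y \<otimes>\<^bsub>R\<^esub> z) = \<zero>\<^bsub>R\<^esub>)"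

definition jacobson_radical :: "('k, 'a) module \<Rightarrow> 'a set" where
  "jacobson_radical R =
    {x \<in> carrier R. \<forall>r \<in> carrier R. left_quasi_regular R (r \<otimes>\<^bsub>R\<^esub> x)}"


subsection \<open>Gradings\<close>

definition graded_sum :: "('k, 'a) module \<Rightarrow> (int \<Rightarrow> 'a set) \<Rightarrow> int set \<Rightarrow> 'a set" where
  "graded_sum A G S =
    {\<Oplus>\<^bsub>A\<^esub> i\<in>I. x i | x I. finite I \<and> I \<subseteq> S \<and> (\<forall>i\<in>I. x i \<in> G i)}"

locale graded_algebra = fin_dim_algebra A for A :: "('k::field, 'a) module" +
  fixes G :: "int \<Rightarrow> 'a set"
  assumes component_subspace: "subspace class_ring (G i) A"
    and component_mult: "\<lbrakk>x \<in> G i; y \<in> G j\<rbrakk> \<Longrightarrow> x \<otimes>\<^bsub>A\<^esub> y \<in> G (i + j)"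
    and component_sum: "graded_sum A G UNIV = carrier A"
    and component_independent:
      "\<lbrakk>finite I; \<And>i. i \<in> I \<Longrightarrow> f i \<in> G i; (\<Oplus>\<^bsub>A\<^esub> i\<in>I. f i) = \<zero>\<^bsub>A\<^esub>; j \<in> I\<rbrakk> \<Longrightarrow> f j = \<zero>\<^bsub>A\<^esub>"

definition trivial_grading :: "('k, 'a) module \<Rightarrow> (int \<Rightarrow> 'a set) \<Rightarrow> bool" where
  "trivial_grading A G \<longleftrightarrow> (\<forall>i. i \<noteq> 0 \<longrightarrow> G i = {\<zero>\<^bsub>A\<^esub>})"


subsection \<open>Filtrations and their associated graded algebras\<close>

definition filtration :: "('k::field, 'a) module \<Rightarrow> (int \<Rightarrow> 'a set) \<Rightarrow> bool" where
  "filtration A F \<longleftrightarrow>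
    (\<forall>i. subspace class_ring (F i) A) \<and>
    (\<forall>i j. i \<le> j \<longrightarrow> F j \<subseteq> F i) \<and>
    (\<forall>i j. \<forall>x \<in> F i. \<forall>y \<in> F j. x \<otimes>\<^bsub>A\<^esub> y \<in> F (i + j)) \<and>
    (\<exists>n. \<forall>i \<le> n. F i = carrier A) \<and>
    (\<exists>n. \<forall>i \<ge> n. F i = {\<zero>\<^bsub>A\<^esub>})"

definition trivial_filtration :: "('k, 'a) module \<Rightarrow> int \<Rightarrow> 'a set" where
  "trivial_filtration A n = (if n \<le> 0 then carrier A else {\<zero>\<^bsub>A\<^esub>})"

definition split_filtration :: "('k, 'a) module \<Rightarrow> (int \<Rightarrow> 'a set) \<Rightarrow> int \<Rightarrow> 'a set" where
  "split_filtration A G m = graded_sum A G {m..}"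

text \<open>
  The quotient \<open>U / W\<close> for subspaces \<open>W \<subseteq> U\<close> of \<open>A\<close>; its elements are the cosets in \<open>A\<close>.
  As a vector space it does not use the record fields \<open>mult\<close> and \<open>one\<close>.
\<close>

definition quotient_space :: "('k, 'a) module \<Rightarrow> 'a set \<Rightarrow> 'a set \<Rightarrow> ('k, 'a set) module" where
  "quotient_space A U W =
    \<lparr>carrier = (\<lambda>x. W +>\<^bsub>A\<^esub> x) ` U, mult = undefined, one = undefined,
     zero = W, add = set_add A, smult = (\<lambda>c X. \<Union>x\<in>X. W +>\<^bsub>A\<^esub> (c \<odot>\<^bsub>A\<^esub> x))\<rparr>"

definition gr_piece :: "('k, 'a) module \<Rightarrow> (int \<Rightarrow> 'a set) \<Rightarrow> int \<Rightarrow> ('k, 'a set) module" where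
  "gr_piece A F m = quotient_space A (F m) (F (m + 1))"

text \<open>
  An element of \<open>Gr(F)\<close> is a finitely supported family \<open>f\<close> with \<open>f m \<in> F m / F (m + 1)\<close>.
  The library's \<open>rcoset_mult A W X Y\<close> is the union of the \<open>W\<close>-cosets of the products \<open>x y\<close> with
  \<open>x \<in> X\<close>, \<open>y \<in> Y\<close>; for \<open>W = F (i + j + 1)\<close> it is the product
  \<open>F i / F (i + 1) \<times> F j / F (j + 1) \<rightarrow> F (i + j) / F (i + j + 1)\<close> induced from \<open>A\<close>.
\<close>

definition Gr :: "('k, 'a) module \<Rightarrow> (int \<Rightarrow> 'a set) \<Rightarrow> ('k, int \<Rightarrow> 'a set) module" where
  "Gr A F =
    \<lparr>carrier = {f. (\<forall>m. f m \<in> carrier (gr_piece A F m)) \<and>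
                    finite {m. f m \<noteq> \<zero>\<^bsub>gr_piece A F m\<^esub>}},
     mult = (\<lambda>f g n. \<Oplus>\<^bsub>gr_piece A F n\<^esub> i \<in> {i. f i \<noteq> \<zero>\<^bsub>gr_piece A F i\<^esub>}.
                rcoset_mult A (F (n + 1)) (f i) (g (n - i))),
     one = undefined,
     zero = (\<lambda>m. \<zero>\<^bsub>gr_piece A F m\<^esub>),
     add = (\<lambda>f g m. f m \<oplus>\<^bsub>gr_piece A F m\<^esub> g m),
     smult = (\<lambda>c f m. c \<odot>\<^bsub>gr_piece A F m\<^esub> f m)\<rparr>"

definition Gr_component ::
  "('k, 'a) module \<Rightarrow> (int \<Rightarrow> 'a set) \<Rightarrow> int \<Rightarrow> (int \<Rightarrow> 'a set) set" where
  "Gr_component A F m = {f \<in> carrier (Gr A F). \<forall>i. i \<noteq> m \<longrightarrow> f i = \<zero>\<^bsub>gr_piece A F i\<^esub>}"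


subsection \<open>Semistability and canonical filtrations\<close>

definition weights :: "(int \<Rightarrow> 'a set) \<Rightarrow> int set" where
  "weights F = {m. F m \<noteq> F (m + 1)}"

definition gr_dim :: "('k::field, 'a) module \<Rightarrow> (int \<Rightarrow> 'a set) \<Rightarrow> int \<Rightarrow> nat" where
  "gr_dim A F m = vectorspace.dim class_ring (gr_piece A F m)"

text \<open>
  The sums over all \<open>m\<close> are restricted to \<open>weights F\<close>, which is finite for a filtration; the
  other pieces are zero.
\<close>

definition wt :: "('k::field, 'a) module \<Rightarrow> (int \<Rightarrow> 'a set) \<Rightarrow> int" where
  "wt A F = (\<Sum>m \<in> weights F. m * int (gr_dim A F m))"

definition filtration_norm :: "('k::field, 'a) module \<Rightarrow> (int \<Rightarrow> 'a set) \<Rightarrow> real" where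
  "filtration_norm A F = sqrt (\<Sum>m \<in> weights F. (real_of_int m)\<^sup>2 * real (gr_dim A F m))"

definition nu :: "('k::field, 'a) module \<Rightarrow> (int \<Rightarrow> 'a set) \<Rightarrow> real" where
  "nu A F = - real_of_int (wt A F) / filtration_norm A F"

definition semistable :: "('k::field, 'a) module \<Rightarrow> bool" where
  "semistable A \<longleftrightarrow> (\<forall>F. filtration A F \<longrightarrow> - wt A F \<ge> 0)"

abbreviation unstable :: "('k::field, 'a) module \<Rightarrow> bool" where
  "unstable A \<equiv> \<not> semistable A"

text \<open>
  \<open>F\<close> is the canonical filtration up to positive rescaling of the weights. As \<open>nu\<close> is invariant
  under rescaling, a rescaling of a minimizer is again a minimizer, and by Kempf's theorem there
  are no others.
\<close>

definition canonical_filtration :: "('k::field, 'a) module \<Rightarrow> (int \<Rightarrow> 'a set) \<Rightarrow> bool" where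
  "canonical_filtration A F \<longleftrightarrow>
    (if semistable A then F = trivial_filtration A
     else filtration A F \<and> F \<noteq> trivial_filtration A \<and>
          (\<forall>F'. filtration A F' \<and> F' \<noteq> trivial_filtration A \<longrightarrow> nu A F \<le> nu A F'))"

definition graded_semistable :: "('k::field, 'a) module \<Rightarrow> (int \<Rightarrow> 'a set) \<Rightarrow> bool" where
  "graded_semistable A G \<longleftrightarrow> canonical_filtration A (split_filtration A G)"

end

theory Submission
  imports Defs "HOL-Library.Function_Algebras"
begin

text \<open>
  Let \<open>F\<close> be a filtration of \<open>A\<close> that minimises \<open>nu\<close>, with weight \<open>W > 0\<close> and squared norm \<open>Q\<close>, and
  let \<open>B\<close> be its associated graded algebra; if \<open>F\<close> is the split filtration of a grading, \<open>B\<close> is \<open>A\<close>.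

  A homogeneous filtration \<open>H\<close> of \<open>B\<close> perturbs \<open>F\<close>: for large \<open>N\<close>, giving weight \<open>N d + m\<close> to the
  elements whose leading form has degree \<open>d\<close> and \<open>H\<close>-weight \<open>m\<close> defines a filtration of \<open>A\<close>. As its
  slope is not better than that of \<open>F\<close>, letting \<open>N\<close> tend to infinity gives, with
  \<open>h d m = dim (H m)\<^sub>d - dim (H (m + 1))\<^sub>d\<close>,
  \<open>(\<Sum>d m. (Q - W d) m (h d m)) \<le> 0\<close>.
  This is \<open>optimal_of_minimal\<close>. The locale \<open>optimal_alg\<close> records the inequality for \<open>B\<close>, and
  everything else is deduced from it by choosing \<open>H\<close>. Since \<open>W > 0\<close>, the factor \<open>Q - W d\<close> is
  positive for \<open>d < 0\<close>.

  \<^item> Annihilator (\<open>annihilator_negative\<close>). Let \<open>n < 0\<close>. Giving weight 1 to \<open>Ann(B)\<^sub>n\<close> and weight 0 to the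
    rest yields \<open>(Q - W n) dim Ann(B)\<^sub>n \<le> 0\<close>.

  \<^item> Radical (\<open>opposite_degrees_nilpotent\<close>, \<open>comp_subset_radical\<close>). For an idempotent \<open>e\<close> of degree 0,
    the Peirce decomposition with weight 1 on \<open>e B (1 - e)\<close>, weight -1 on \<open>(1 - e) B e\<close> and weight 0 on
    the rest shows that \<open>\<Sum>d. (Q - W d) (dim (e B)\<^sub>d - dim (B e)\<^sub>d)\<close> is at most 0; exchanging the two
    sides, it is 0. Now let \<open>u\<close> and \<open>v\<close> have degrees \<open>d\<close> and \<open>-d\<close> with \<open>d \<noteq> 0\<close>. If \<open>u v\<close> were not
    nilpotent, it would produce nonzero idempotents \<open>e = u' v'\<close> and \<open>f = v' u'\<close>; then \<open>e B\<close> is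
    \<open>f B\<close> shifted by \<open>d\<close>, while \<open>B e\<close> is \<open>B f\<close> shifted by \<open>-d\<close>, so the sums for \<open>e\<close> and \<open>f\<close> cannot
    both vanish. Hence for \<open>x\<close> of degree \<open>d \<noteq> 0\<close> the degree 0 elements of the left ideal \<open>B x\<close> are
    nilpotent, and a graded Nakayama lemma makes all elements of \<open>B x\<close> quasi-regular.

  \<^item> Centre (\<open>automorphism_preserves_lead_filt\<close>, \<open>negative_central\<close>). An element \<open>x\<close> of degree \<open>n < 0\<close> is
    nilpotent, so that conjugation by \<open>1 + x\<close> is an automorphism of \<open>B\<close>. The leading forms of the image of
    the split filtration form a homogeneous filtration with the same weight and norm, and the inequality
    becomes the case of equality of the Cauchy-Schwarz inequality. So the automorphism preserves the split
    filtration, which is Kempf's uniqueness argument. But it maps \<open>a\<close> of degree \<open>m\<close> to \<open>a\<close> plus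
    \<open>x a - a x\<close>, of degree \<open>m + n < m\<close>, plus terms of still lower degree; so \<open>x a = a x\<close>.

  All this takes place inside a vector space given by a type: coordinates identify \<open>A\<close> with a
  finite-dimensional space \<open>V\<close> of functions, and projections of \<open>V\<close> that are adapted to \<open>F\<close> turn \<open>V\<close>
  into a copy of \<open>B\<close> as well. The results are then transferred to the record \<open>A\<close> or \<open>Gr A F\<close>
  by \<open>radical_center_annihilator\<close>.
\<close>

section \<open>Finite-dimensional subspaces\<close>

text \<open>
  A locale of its own keeps the names below apart from their instances for real vector spaces, which would
  hide them in \<open>vector_space\<close>.
\<close>

locale vspace = vector_space scale for scale :: "'k::field \<Rightarrow> 'v::ab_group_add \<Rightarrow> 'v" (infixr "*s" 75)
begin

definition findim :: "'v set \<Rightarrow> bool" where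
  "findim S \<longleftrightarrow> (\<exists>B. finite B \<and> S \<subseteq> span B)"

lemma findim_subset: "findim T \<Longrightarrow> S \<subseteq> T \<Longrightarrow> findim S"
  unfolding findim_def by blast

lemma findim_basis_extend:
  assumes T: "findim T" "subspace T" and S: "S \<subseteq> T" "independent S" and C: "S \<subseteq> C" "C \<subseteq> T" "T \<subseteq> span C"
  obtains B where "finite B" "independent B" "S \<subseteq> B" "B \<subseteq> C" "span B = T" "card B = dim T"
proof -
  obtain B where B: "S \<subseteq> B" "B \<subseteq> C" "independent B" "C \<subseteq> span B"
    using maximal_independent_subset_extend[OF C(1) S(2)] by metis
  have sp: "span B = T"
  proof
    show "span B \<subseteq> T" using B(2) C(2) T(2) span_minimal by blast
    have "span C \<subseteq> span B" using B(4) by (metis span_mono span_span)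
    then show "T \<subseteq> span B" using C(3) by blast
  qed
  obtain G where G: "finite G" "T \<subseteq> span G" using T(1) unfolding findim_def by blast
  have "B \<subseteq> span G" using B(2) C(2) G(2) by blast
  then have fin: "finite B" using independent_span_bound[OF G(1) B(3)] by blast
  have "card B = dim T" using sp B(3) dim_span_eq_card_independent by metis
  then show thesis using that fin B sp by blast
qed

lemma findim_basis:
  assumes "findim T" "subspace T"
  obtains B where "finite B" "independent B" "B \<subseteq> T" "span B = T" "card B = dim T"
proof -
  have e: "{} \<subseteq> T" by simp
  show thesis
    by (rule findim_basis_extend[OF assms e independent_empty e order_refl span_superset]) (rule that)
qed

lemma dim_mono_findim:
  assumes "findim T" "subspace T" "subspace S" "S \<subseteq> T"
  shows "dim S \<le> dim T"
proof -
  obtain B where B: "finite B" "independent B" "B \<subseteq> T" "span B = T" "card B = dim T"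
    by (rule findim_basis[OF assms(1,2)])
  show ?thesis using dim_le_card[of S B] B assms(4) by simp
qed

lemma dim_eq_imp_eq:
  assumes "findim T" "subspace T" "subspace S" "S \<subseteq> T" "dim T \<le> dim S"
  shows "S = T"
proof -
  have fS: "findim S" by (rule findim_subset[OF assms(1,4)])
  obtain B where B: "finite B" "independent B" "B \<subseteq> S" "span B = S" "card B = dim S"
    by (rule findim_basis[OF fS assms(3)])
  have BT: "B \<subseteq> T" using B(3) assms(4) by blast
  obtain C where C: "finite C" "independent C" "B \<subseteq> C" "C \<subseteq> T" "span C = T" "card C = dim T"
    by (rule findim_basis_extend[OF assms(1,2) BT B(2) BT order_refl span_superset])
  have "B = C" using card_seteq[OF C(1,3)] B(5) C(6) assms(5) by simp
  then show ?thesis using B C by simp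
qed

lemma dim_zero_subspace [simp]: "dim {0} = 0"
  using dim_span_eq_card_independent[OF independent_empty] by simp

lemma dim_0_imp_trivial:
  assumes "findim S" "subspace S" "dim S = 0"
  shows "S = {0}"
  using dim_eq_imp_eq[of S "{0}"] assms subspace_0 subspace_single_0 by auto

text \<open>
  The ambient space may be infinite-dimensional, so this is stated for a subspace \<open>S\<close>: a basis of the kernel
  is extended to a basis of \<open>S\<close>, and the map is injective on the span of the new vectors.
\<close>

lemma rank_nullity:
  assumes f: "Vector_Spaces.linear scale scale f" and S: "subspace S" "findim S"
  shows "dim S = dim {x \<in> S. f x = 0} + dim (f ` S)"
proof -
  interpret f: Vector_Spaces.linear scale scale f by (rule f)
  let ?K = "{x \<in> S. f x = 0}"
  have K: "subspace ?K" using S(1) unfolding subspace_def by (auto simp: f.add f.scale f.zero)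
  obtain B where B: "finite B" "independent B" "B \<subseteq> ?K" "span B = ?K" "card B = dim ?K"
    by (rule findim_basis[OF findim_subset[OF S(2)] K]) auto
  have BS: "B \<subseteq> S" using B(3) by blast
  obtain C where C: "finite C" "independent C" "B \<subseteq> C" "C \<subseteq> S" "span C = S" "card C = dim S"
    by (rule findim_basis_extend[OF S(2,1) BS B(2) BS order_refl span_superset])
  let ?D = "C - B"
  have inj0: "x = 0" if "x \<in> span ?D" "f x = 0" for x
  proof -
    have xS: "x \<in> span B"
    proof -
      have "x \<in> span C" using that(1) span_mono[of ?D C] by blast
      then show ?thesis using B(4) C(5) that(2) by blast
    qed
    have "independent (B \<union> ?D)" using C(2,3) by (simp add: Un_absorb1)
    have "span B \<inter> span ?D = {0}"
    proof -
      { fix y assume y: "y \<in> span B" "y \<in> span ?D"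
        have rB: "representation C y = representation B y" using representation_extend[OF C(2) y(1)] C(3) by simp
        have rD: "representation C y = representation ?D y" using representation_extend[OF C(2) y(2)] by simp
        have r0: "representation C y b = 0" for b
        proof (rule ccontr)
          assume "representation C y b \<noteq> 0"
          then have "b \<in> B" "b \<in> ?D" using rB rD representation_ne_zero by metis+
          then show False by blast
        qed
        have "y \<in> span C" using y(1) span_mono[OF C(3)] by blast
        then have "y = 0" using sum_nonzero_representation_eq[OF C(2), of y] r0 by simp }
      then show ?thesis using span_zero by blast
    qed
    then show ?thesis using xS that(1) by blast
  qed
  have inj: "inj_on f (span ?D)"
  proof (rule inj_onI)
    fix x y assume "x \<in> span ?D" "y \<in> span ?D" "f x = f y"
    then have "x - y \<in> span ?D" "f (x - y) = 0" by (simp_all add: span_diff f.diff)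
    then have "x - y = 0" by (rule inj0)
    then show "x = y" by simp
  qed
  have ind: "independent (f ` ?D)" 
    using f.independent_injective_image[OF independent_mono[OF C(2)] inj] by simp
  have sp: "span (f ` ?D) = f ` S"
  proof -
    have "f ` S = span (f ` C)" using C(5) f.span_image[of C] by simp
    also have "\<dots> = span (f ` ?D)"
    proof
      have "f b \<in> span (f ` ?D)" if "b \<in> C" for b
      proof (cases "b \<in> B")
        case True
        then have "f b = 0" using B(3) by blast
        then show ?thesis using span_zero by simp
      next
        case False
        then show ?thesis using that by (intro span_base) simp
      qed
      then show "span (f ` C) \<subseteq> span (f ` ?D)" by (intro span_minimal image_subsetI subspace_span)
      show "span (f ` ?D) \<subseteq> span (f ` C)" by (intro span_mono) auto
    qed
    finally show ?thesis by simp
  qed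
  have "dim (f ` S) = card (f ` ?D)" using ind sp dim_span_eq_card_independent[of "f ` ?D"] by simp
  also have "\<dots> = card ?D" by (rule card_image[OF inj_on_subset[OF inj span_superset]])
  also have "\<dots> = card C - card B" using B(1) C(3) by (simp add: card_Diff_subset)
  finally show ?thesis using B(5) C(6) C(1,3) card_mono[of C B] by linarith
qed

lemma findim_linear_image:
  assumes f: "Vector_Spaces.linear scale scale f" and S: "findim S"
  shows "findim (f ` S)"
proof -
  interpret f: Vector_Spaces.linear scale scale f by (rule f)
  obtain B where "finite B" "S \<subseteq> span B" using S unfolding findim_def by blast
  then show ?thesis unfolding findim_def using f.span_image by (metis finite_imageI image_mono)
qed

lemma subspace_linear_image:
  assumes f: "Vector_Spaces.linear scale scale f" and S: "subspace S"
  shows "subspace (f ` S)"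
proof -
  interpret f: Vector_Spaces.linear scale scale f by (rule f)
  show ?thesis using f.subspace_image[OF S] .
qed

lemma dim_inj_image:
  assumes f: "Vector_Spaces.linear scale scale f" and S: "subspace S" "findim S" and i: "\<And>x. x \<in> S \<Longrightarrow> f x = 0 \<Longrightarrow> x = 0"
  shows "dim (f ` S) = dim S"
proof -
  interpret f: Vector_Spaces.linear scale scale f by (rule f)
  have "{x \<in> S. f x = 0} = {0}" using i subspace_0[OF S(1)] f.zero by auto
  then show ?thesis using rank_nullity[OF f S] by simp
qed

lemma inj_imp_surj_on:
  assumes f: "Vector_Spaces.linear scale scale f" and S: "subspace S" "findim S" and i: "\<And>x. x \<in> S \<Longrightarrow> f x = 0 \<Longrightarrow> x = 0"
    and m: "f ` S \<subseteq> S"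
  shows "f ` S = S"
  using dim_eq_imp_eq[OF S(2,1) subspace_linear_image[OF f S(1)] m] dim_inj_image[OF f S i] by simp

end

section \<open>Graded algebras inside a vector space\<close>

text \<open>
  The algebra is \<open>V\<close>, but multiplication and projections are total functions on the type that satisfy the
  laws everywhere. This removes membership conditions from almost all computations.
\<close>

locale graded_alg = vspace scale for scale :: "'k::field \<Rightarrow> 'v::ab_group_add \<Rightarrow> 'v" (infixr "*s" 75) +
  fixes V :: "'v set" and mul :: "'v \<Rightarrow> 'v \<Rightarrow> 'v" (infixl "\<star>" 70)
    and pr :: "int \<Rightarrow> 'v \<Rightarrow> 'v" and lo hi :: int
  assumes V_subspace: "subspace V" and V_findim: "findim V"
    and mul_closed [simp]: "x \<star> y \<in> V"
    and mul_assoc: "(x \<star> y) \<star> z = x \<star> (y \<star> z)"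
    and mul_add_left: "(x + y) \<star> z = x \<star> z + y \<star> z"
    and mul_add_right: "x \<star> (y + z) = x \<star> y + x \<star> z"
    and mul_scale_left: "(c *s x) \<star> y = c *s (x \<star> y)"
    and mul_scale_right: "x \<star> (c *s y) = c *s (x \<star> y)"
    and pr_linear: "Vector_Spaces.linear scale scale (pr d)"
    and pr_closed [simp]: "pr d x \<in> V"
    and pr_pr: "pr d (pr e x) = (if d = e then pr d x else 0)"
    and pr_out: "d < lo \<or> hi < d \<Longrightarrow> pr d x = 0"
    and pr_sum: "x \<in> V \<Longrightarrow> (\<Sum>d=lo..hi. pr d x) = x"
    and pr_mul: "pr (d + e) (pr d x \<star> pr e y) = pr d x \<star> pr e y"
begin

definition comp :: "int \<Rightarrow> 'v set" where
  "comp d = {x. pr d x = x}"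

lemma pr_add [simp]: "pr d (x + y) = pr d x + pr d y"
  and pr_diff [simp]: "pr d (x - y) = pr d x - pr d y"
  and pr_minus [simp]: "pr d (- x) = - pr d x"
  and pr_scale [simp]: "pr d (c *s x) = c *s pr d x"
  and pr_0 [simp]: "pr d 0 = 0"
proof -
  interpret f: Vector_Spaces.linear scale scale "pr d" by (rule pr_linear)
  show "pr d (x + y) = pr d x + pr d y" "pr d (x - y) = pr d x - pr d y" "pr d (- x) = - pr d x"
    "pr d (c *s x) = c *s pr d x" "pr d 0 = 0"
    by (simp_all add: f.add f.diff f.neg f.scale)
qed

lemma pr_sum_distrib: "pr d (\<Sum>i\<in>I. f i) = (\<Sum>i\<in>I. pr d (f i))"
  by (induction I rule: infinite_finite_induct) auto

lemma mul_0_left [simp]: "0 \<star> x = 0" using mul_add_left[of 0 0 x] by simp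
lemma mul_0_right [simp]: "x \<star> 0 = 0" using mul_add_right[of x 0 0] by simp
lemma mul_minus_left [simp]: "(- x) \<star> y = - (x \<star> y)" using mul_add_left[of x "- x" y] by (simp add: eq_neg_iff_add_eq_0 add.commute)
lemma mul_minus_right [simp]: "x \<star> (- y) = - (x \<star> y)" using mul_add_right[of x y "- y"] by (simp add: eq_neg_iff_add_eq_0 add.commute)
lemma mul_diff_left: "(x - y) \<star> z = x \<star> z - y \<star> z" using mul_add_left[of x "- y" z] by simp
lemma mul_diff_right: "x \<star> (y - z) = x \<star> y - x \<star> z" using mul_add_right[of x y "- z"] by simp
lemma mul_sum_left: "(\<Sum>i\<in>I. f i) \<star> x = (\<Sum>i\<in>I. f i \<star> x)"
  by (induction I rule: infinite_finite_induct) (auto simp: mul_add_left)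
lemma mul_sum_right: "x \<star> (\<Sum>i\<in>I. f i) = (\<Sum>i\<in>I. x \<star> f i)"
  by (induction I rule: infinite_finite_induct) (auto simp: mul_add_right)

lemma linear_mul_left: "Vector_Spaces.linear scale scale (\<lambda>x. a \<star> x)"
  by unfold_locales (auto simp: mul_add_right mul_scale_right)
lemma linear_mul_right: "Vector_Spaces.linear scale scale (\<lambda>x. x \<star> a)"
  by unfold_locales (auto simp: mul_add_left mul_scale_left)

lemma V_closed [simp]: "0 \<in> V" "x \<in> V \<Longrightarrow> y \<in> V \<Longrightarrow> x + y \<in> V" "x \<in> V \<Longrightarrow> y \<in> V \<Longrightarrow> x - y \<in> V"
  "x \<in> V \<Longrightarrow> - x \<in> V" "x \<in> V \<Longrightarrow> c *s x \<in> V"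
  using V_subspace by (simp_all add: subspace_0 subspace_add subspace_diff subspace_neg subspace_scale)

lemma findim_V_subset: "S \<subseteq> V \<Longrightarrow> findim S"
  by (rule findim_subset[OF V_findim])

lemma comp_V: "x \<in> comp d \<Longrightarrow> x \<in> V"
  using pr_closed[of d x] unfolding comp_def by simp

lemma comp_subset_V: "comp d \<subseteq> V"
  using comp_V by blast

lemma pr_comp [simp]: "pr d x \<in> comp d"
  unfolding comp_def by (simp add: pr_pr)

lemma pr_of_comp: "x \<in> comp d \<Longrightarrow> pr e x = (if e = d then x else 0)"
  using pr_pr[of e d x] unfolding comp_def by (auto split: if_splits)

lemma comp_eq: "x \<in> comp d \<Longrightarrow> pr d x = x"
  unfolding comp_def by simp

lemma comp_subspace: "subspace (comp d)"
  unfolding subspace_def comp_def by simp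

lemma comp_closed: "0 \<in> comp d" "x \<in> comp d \<Longrightarrow> y \<in> comp d \<Longrightarrow> x + y \<in> comp d"
   "x \<in> comp d \<Longrightarrow> y \<in> comp d \<Longrightarrow> x - y \<in> comp d" "x \<in> comp d \<Longrightarrow> - x \<in> comp d" "x \<in> comp d \<Longrightarrow> c *s x \<in> comp d"
  unfolding comp_def by simp_all

lemma comp_out: "d < lo \<or> hi < d \<Longrightarrow> comp d = {0}"
  unfolding comp_def using pr_out by fastforce

lemma comp_mul: "x \<in> comp d \<Longrightarrow> y \<in> comp e \<Longrightarrow> x \<star> y \<in> comp (d + e)"
  using pr_mul[of d e x y] unfolding comp_def by simp

lemma comp_mul': "x \<in> comp d \<Longrightarrow> y \<in> comp e \<Longrightarrow> d + e = f \<Longrightarrow> x \<star> y \<in> comp f"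
  using comp_mul by blast

lemma pr_mul_comp_left: "a \<in> comp d \<Longrightarrow> x \<in> V \<Longrightarrow> pr f (a \<star> x) = a \<star> pr (f - d) x"
proof -
  assume a: "a \<in> comp d" and x: "x \<in> V"
  have "pr f (a \<star> x) = pr f (a \<star> (\<Sum>e=lo..hi. pr e x))" using pr_sum[OF x] by simp
  also have "\<dots> = (\<Sum>e=lo..hi. pr f (a \<star> pr e x))" by (simp add: mul_sum_right pr_sum_distrib)
  also have "\<dots> = (\<Sum>e=lo..hi. if e = f - d then a \<star> pr e x else 0)"
    by (intro sum.cong) (auto simp: pr_of_comp[OF comp_mul[OF a pr_comp]])
  also have "\<dots> = a \<star> pr (f - d) x" using pr_out[of "f - d" x] by (auto simp: sum.delta)
  finally show ?thesis .
qed

lemma pr_mul_comp_right: "a \<in> comp d \<Longrightarrow> x \<in> V \<Longrightarrow> pr f (x \<star> a) = pr (f - d) x \<star> a"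
proof -
  assume a: "a \<in> comp d" and x: "x \<in> V"
  have "pr f (x \<star> a) = pr f ((\<Sum>e=lo..hi. pr e x) \<star> a)" using pr_sum[OF x] by simp
  also have "\<dots> = (\<Sum>e=lo..hi. pr f (pr e x \<star> a))" by (simp add: mul_sum_left pr_sum_distrib)
  also have "\<dots> = (\<Sum>e=lo..hi. if e = f - d then pr e x \<star> a else 0)"
    by (intro sum.cong) (auto simp: pr_of_comp[OF comp_mul[OF pr_comp a]])
  also have "\<dots> = pr (f - d) x \<star> a" using pr_out[of "f - d" x] by (auto simp: sum.delta)
  finally show ?thesis .
qed

lemma pr_mul_sum: "x \<in> V \<Longrightarrow> y \<in> V \<Longrightarrow> pr f (x \<star> y) = (\<Sum>e=lo..hi. pr e x \<star> pr (f - e) y)"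
proof -
  assume x: "x \<in> V" and y: "y \<in> V"
  have "pr f (x \<star> y) = pr f ((\<Sum>e=lo..hi. pr e x) \<star> y)" using pr_sum[OF x] by simp
  also have "\<dots> = (\<Sum>e=lo..hi. pr f (pr e x \<star> y))" by (simp add: mul_sum_left pr_sum_distrib)
  also have "\<dots> = (\<Sum>e=lo..hi. pr e x \<star> pr (f - e) y)"
    by (intro sum.cong) (auto simp: pr_mul_comp_left[OF pr_comp y])
  finally show ?thesis .
qed

lemma eq_by_components:
  assumes "x \<in> V" "y \<in> V" and eq: "\<And>d. pr d x = pr d y"
  shows "x = y"
proof -
  have "(\<Sum>d=lo..hi. pr d x) = (\<Sum>d=lo..hi. pr d y)" by (rule sum.cong[OF refl eq])
  then show ?thesis using pr_sum[OF assms(1)] pr_sum[OF assms(2)] by argo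
qed

primrec pw :: "'v \<Rightarrow> nat \<Rightarrow> 'v" where
  "pw z 0 = z"
| "pw z (Suc k) = z \<star> pw z k"

lemma pw_add: "pw z j \<star> pw z k = pw z (Suc (j + k))"
  by (induction j) (simp_all add: mul_assoc)

lemma pw_comp: "z \<in> comp d \<Longrightarrow> pw z k \<in> comp (int (Suc k) * d)"
  by (induction k) (auto intro!: comp_mul' simp: algebra_simps)

lemma homogeneous_nilpotent:
  assumes z: "z \<in> comp d" and d: "d \<noteq> 0"
  shows "\<exists>k. pw z k = 0"
proof -
  define k where "k = nat (\<bar>lo\<bar> + \<bar>hi\<bar>)"
  define K where "K = int (Suc k)"
  have K: "K > \<bar>lo\<bar> + \<bar>hi\<bar>" unfolding K_def k_def by simp
  have "K * d < lo \<or> hi < K * d"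
  proof (cases "d > 0")
    case True
    then have "K * d \<ge> K * 1" using K by (intro mult_left_mono) auto
    then show ?thesis using K by linarith
  next
    case False
    then have "K * d \<le> K * (-1)" using d K by (intro mult_left_mono) auto
    then show ?thesis using K by linarith
  qed
  then show ?thesis using pw_comp[OF z, of k] comp_out[of "K * d"] unfolding K_def by (intro exI[of _ k]) simp
qed

text \<open>
  \<open>q\<close> is the geometric series \<open>z + z\<^sup>2 + \<dots>\<close>, so that \<open>1 + q\<close> is inverse to \<open>1 - z\<close>. The powers of \<open>z\<close> start with
  the first one, as there is no unit; \<open>S\<close> keeps track of a subspace that contains them, for instance a
  homogeneous component.
\<close>

lemma nilpotent_quasi_inverse:
  assumes z: "pw z n = 0" and S: "subspace S" and pS: "\<And>k. pw z k \<in> S"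
  obtains q where "q \<in> S" "q = z + z \<star> q" "q = z + q \<star> z"
proof -
  define s where "s m = (\<Sum>k<m. pw z k)" for m
  have l: "z \<star> s m = s (Suc m) - z" for m
    unfolding s_def sum.lessThan_Suc_shift by (simp add: mul_sum_right)
  have pwr: "pw z k \<star> z = pw z (Suc k)" for k using pw_add[of z k 0] by simp
  have r: "s m \<star> z = s (Suc m) - z" for m
    unfolding s_def sum.lessThan_Suc_shift by (simp add: mul_sum_left pwr del: pw.simps(2))
  have "s (Suc n) = s n" unfolding s_def using z by simp
  then have "s n = z + z \<star> s n" "s n = z + s n \<star> z" using l[of n] r[of n] by simp_all
  moreover have "s n \<in> S" unfolding s_def by (rule subspace_sum[OF S pS])
  ultimately show thesis using that by simp
qed

text \<open>
  The spaces spanned by the powers with large exponent stabilise to a space \<open>P\<close>, and \<open>P = z\<^sup>n P\<close> for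
  large \<open>n\<close>. Hence \<open>z\<^sup>n = z\<^sup>n q\<close> with \<open>q \<in> P\<close>, and \<open>q\<close> is a right unit of \<open>P\<close>.
\<close>

lemma idempotent_of_non_nilpotent:
  assumes z: "\<And>k. pw z k \<noteq> 0" and S: "subspace S" and pS: "\<And>k. pw z k \<in> S"
  obtains e r where "e \<in> S" "e \<noteq> 0" "e \<star> e = e" "r \<in> S" "e = z \<star> r"
proof -
  define P where "P n = span (pw z ` {n..})" for n
  have Psub: "subspace (P n)" for n unfolding P_def by simp
  have zV: "pw z k \<in> V" if "k > 0" for k using that by (cases k) auto
  have PV: "P n \<subseteq> V" if "n > 0" for n
    unfolding P_def using that zV V_subspace by (intro span_minimal) auto
  have Pmono: "P m \<subseteq> P n" if "n \<le> m" for m n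
    unfolding P_def using that by (intro span_mono) auto
  obtain n where n: "n > 0" "\<And>m. m > 0 \<Longrightarrow> dim (P n) \<le> dim (P m)"
    using ex_has_least_nat[of "\<lambda>m. m > 0" 1 "\<lambda>m. dim (P m)"] by auto
  have stab: "P m = P n" if "m \<ge> n" for m
    using dim_eq_imp_eq[OF findim_V_subset[OF PV[OF n(1)]] Psub Psub Pmono[OF that] n(2)] that n(1) by simp
  have "pw z n \<in> P (n + n + 1)" using stab[of "n + n + 1"] unfolding P_def by (simp add: span_base)
  moreover have "P (n + n + 1) \<subseteq> (\<lambda>x. pw z n \<star> x) ` P n"
  proof -
    interpret f: Vector_Spaces.linear scale scale "\<lambda>x. pw z n \<star> x" by (rule linear_mul_left)
    have "pw z ` {n + n + 1..} \<subseteq> (\<lambda>x. pw z n \<star> x) ` (pw z ` {n..})"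
    proof
      fix x assume "x \<in> pw z ` {n + n + 1..}"
      then obtain m where m: "m \<ge> n + n + 1" "x = pw z m" by auto
      then have "x = pw z n \<star> pw z (m - n - 1)" by (simp add: pw_add)
      moreover have "m - n - 1 \<ge> n" using m(1) by linarith
      ultimately show "x \<in> (\<lambda>x. pw z n \<star> x) ` (pw z ` {n..})" by blast
    qed
    then have "span (pw z ` {n + n + 1..}) \<subseteq> span ((\<lambda>x. pw z n \<star> x) ` (pw z ` {n..}))" by (rule span_mono)
    then show ?thesis unfolding P_def by (simp add: f.span_image)
  qed
  ultimately obtain q where q: "q \<in> P n" "pw z n = pw z n \<star> q" by (auto simp: image_def)
  have unit: "x \<star> q = x" if "x \<in> P n" for x
  proof -
    have "pw z ` {n..} \<subseteq> {x. x \<star> q = x}"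
    proof
      fix x assume "x \<in> pw z ` {n..}"
      then obtain m where m: "m \<ge> n" "x = pw z m" by auto
      then show "x \<in> {x. x \<star> q = x}"
      proof (cases "m = n")
        case False
        then have "x = pw z (m - n - 1) \<star> pw z n" using m by (simp add: pw_add)
        then show ?thesis using q(2) mul_assoc by simp
      qed (use q in simp)
    qed
    moreover have "subspace {x. x \<star> q = x}" unfolding subspace_def by (auto simp: mul_add_left mul_scale_left)
    ultimately show ?thesis using that span_minimal[of "pw z ` {n..}" "{x. x \<star> q = x}"] unfolding P_def by auto
  qed
  have PS: "P m \<subseteq> S" for m unfolding P_def using pS S by (intro span_minimal) auto
  have "q \<in> (\<lambda>x. z \<star> x) ` P (n - 1)"
  proof -
    interpret f: Vector_Spaces.linear scale scale "\<lambda>x. z \<star> x" by (rule linear_mul_left)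
    have "pw z ` {n..} \<subseteq> (\<lambda>x. z \<star> x) ` (pw z ` {n-1..})"
    proof
      fix x assume "x \<in> pw z ` {n..}"
      then obtain m where m: "m \<ge> n" "x = pw z m" by auto
      then have "x = z \<star> pw z (m - 1)" using n(1) by (cases m) auto
      then show "x \<in> (\<lambda>x. z \<star> x) ` (pw z ` {n-1..})" using m by auto
    qed
    then have "span (pw z ` {n..}) \<subseteq> span ((\<lambda>x. z \<star> x) ` (pw z ` {n-1..}))" by (rule span_mono)
    then show ?thesis using q(1) unfolding P_def by (auto simp: f.span_image)
  qed
  then obtain r where r: "r \<in> P (n - 1)" "q = z \<star> r" by auto
  have "q \<noteq> 0" using q(2) z[of n] by auto
  then show thesis using that[of q r] unit[OF q(1)] subsetD[OF PS q(1)] subsetD[OF PS r(1)] r(2) by simp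
qed

end

section \<open>Optimal gradings\<close>

lemma sum_shift_int:
  fixes g :: "int \<Rightarrow> int"
  assumes "\<And>i. i < lo \<or> hi < i \<Longrightarrow> g i = 0" and "\<And>j. j < lo \<or> hi < j \<Longrightarrow> g (j + d) = 0"
  shows "(\<Sum>i=lo..hi. g i) = (\<Sum>j=lo..hi. g (j + d))"
proof (rule sum.reindex_bij_witness_not_neutral[where S' = "{i. g i = 0} \<inter> {lo..hi}" and T' = "{j. g (j + d) = 0} \<inter> {lo..hi}" and i = "\<lambda>j. j + d" and j = "\<lambda>i. i - d"])
  fix i assume i: "i \<in> {lo..hi} - {i. g i = 0} \<inter> {lo..hi}"
  then have "g ((i - d) + d) \<noteq> 0" by auto
  then show "i - d \<in> {lo..hi} - {j. g (j + d) = 0} \<inter> {lo..hi}" using assms(2)[of "i - d"] by force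
next
  fix j assume j: "j \<in> {lo..hi} - {j. g (j + d) = 0} \<inter> {lo..hi}"
  then show "j + d \<in> {lo..hi} - {i. g i = 0} \<inter> {lo..hi}" using assms(1)[of "j + d"] by force
qed auto

context graded_alg
begin

text \<open>
  Homogeneous filtrations of the graded algebra. The bounds \<open>a\<close> and \<open>b\<close> delimit the possible weights; they
  are arguments since they also delimit the sums over the weights.
\<close>

definition hfilt :: "(int \<Rightarrow> 'v set) \<Rightarrow> int \<Rightarrow> int \<Rightarrow> bool" where
  "hfilt H a b \<longleftrightarrow> (\<forall>m. subspace (H m) \<and> H m \<subseteq> V \<and> H (m + 1) \<subseteq> H m) \<and>
     (\<forall>m l. \<forall>x \<in> H m. \<forall>y \<in> H l. x \<star> y \<in> H (m + l)) \<and>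
     (\<forall>m d. \<forall>x \<in> H m. pr d x \<in> H m) \<and>
     (\<forall>m\<le>a. H m = V) \<and> (\<forall>m>b. H m = {0})"

definition hdim :: "(int \<Rightarrow> 'v set) \<Rightarrow> int \<Rightarrow> int \<Rightarrow> int" where
  "hdim H d m = int (dim (H m \<inter> comp d)) - int (dim (H (m + 1) \<inter> comp d))"

definition total_weight :: int where
  "total_weight = (\<Sum>d=lo..hi. d * int (dim (comp d)))"

definition square_norm :: int where
  "square_norm = (\<Sum>d=lo..hi. d * d * int (dim (comp d)))"

lemma square_norm_nonneg: "0 \<le> square_norm"
  unfolding square_norm_def by (intro sum_nonneg) simp

end

text \<open>
  The inequality says that the slope does not improve to first order when the grading is moved in the
  direction of \<open>H\<close>: it compares \<open>wt H * \<parallel>G\<parallel>\<^sup>2\<close> with \<open>wt G * \<langle>G, H\<rangle>\<close> for the grading \<open>G\<close>.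
\<close>

locale optimal_alg = graded_alg scale V mul pr lo hi
  for scale :: "'k::field \<Rightarrow> 'v::ab_group_add \<Rightarrow> 'v" (infixr "*s" 75)
    and V :: "'v set" and mul :: "'v \<Rightarrow> 'v \<Rightarrow> 'v" (infixl "\<star>" 70)
    and pr :: "int \<Rightarrow> 'v \<Rightarrow> 'v" and lo hi :: int +
  assumes total_weight_pos: "0 < total_weight"
    and optimal: "hfilt H a b \<Longrightarrow>
      square_norm * (\<Sum>d=lo..hi. \<Sum>m=a..b. m * hdim H d m)
        \<le> total_weight * (\<Sum>d=lo..hi. \<Sum>m=a..b. d * m * hdim H d m)"
begin

definition slope_defect :: "int \<Rightarrow> int" where
  "slope_defect d = square_norm - total_weight * d"

lemma slope_defect_inequality:
  assumes "hfilt H a b"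
  shows "(\<Sum>d=lo..hi. slope_defect d * (\<Sum>m=a..b. m * hdim H d m)) \<le> 0"
proof -
  have "slope_defect d * (\<Sum>m=a..b. m * hdim H d m)
      = square_norm * (\<Sum>m=a..b. m * hdim H d m) - total_weight * (\<Sum>m=a..b. d * m * hdim H d m)" for d
  proof -
    have "(\<Sum>m=a..b. d * m * hdim H d m) = d * (\<Sum>m=a..b. m * hdim H d m)"
      by (simp add: sum_distrib_left mult.assoc)
    then show ?thesis by (simp add: slope_defect_def algebra_simps)
  qed
  then have "(\<Sum>d=lo..hi. slope_defect d * (\<Sum>m=a..b. m * hdim H d m))
     = square_norm * (\<Sum>d=lo..hi. \<Sum>m=a..b. m * hdim H d m) - total_weight * (\<Sum>d=lo..hi. \<Sum>m=a..b. d * m * hdim H d m)"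
    by (simp add: sum_subtractf sum_distrib_left[of _ _ "{lo..hi}"])
  then show ?thesis using optimal[OF assms] by simp
qed

text \<open>
  Nothing in the assumptions distinguishes left from right; this halves the work on Peirce decompositions.
\<close>

lemma opposite: "optimal_alg scale V (\<lambda>x y. y \<star> x) pr lo hi"
proof -
  interpret opp: graded_alg scale V "\<lambda>x y. y \<star> x" pr lo hi
  proof unfold_locales
    show "pr (d + e) (pr e y \<star> pr d x) = pr e y \<star> pr d x" for d e x y
      using pr_mul[of e d y x] by (simp add: add.commute)
  qed (simp_all add: V_subspace V_findim mul_assoc mul_add_left mul_add_right mul_scale_left mul_scale_right
      pr_pr pr_out pr_sum)
  have "opp.hfilt H a b \<Longrightarrow> hfilt H a b" for H a b
    unfolding hfilt_def opp.hfilt_def by (metis add.commute)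
  then show ?thesis using optimal total_weight_pos by unfold_locales auto
qed

text \<open>
  The annihilator in degree \<open>n\<close> gets weight 1 and everything else weight 0. This is multiplicative since products
  with the annihilator vanish.
\<close>

lemma annihilator_negative:
  assumes n: "n < 0"
  shows "{a \<in> comp n. \<forall>b\<in>V. a \<star> b = 0 \<and> b \<star> a = 0} = {0}" (is "?N = _")
proof -
  have N: "subspace ?N" unfolding subspace_def
    by (auto simp: comp_closed mul_add_left mul_add_right mul_scale_left mul_scale_right)
  have NV: "?N \<subseteq> V" using comp_V by blast
  define H where "H m = (if m \<le> 0 then V else if m = 1 then ?N else {0})" for m :: int
  have prN: "pr d x \<in> ?N" if "x \<in> ?N" for x d
    using that N subspace_0[OF N] by (auto simp: pr_of_comp)
  have "hfilt H 0 1" unfolding hfilt_def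
  proof (intro conjI allI ballI impI)
    fix m show "subspace (H m)" "H m \<subseteq> V" "H (m + 1) \<subseteq> H m"
      using V_subspace N NV subspace_0[OF N] unfolding H_def by auto
  next
    fix m l x y assume xy: "x \<in> H m" "y \<in> H l"
    have xV: "x \<in> V" "y \<in> V" using xy NV unfolding H_def by (auto split: if_splits)
    show "x \<star> y \<in> H (m + l)"
    proof (cases "m \<le> 0 \<and> l \<le> 0")
      case False
      then have "x \<star> y = 0" using xy xV unfolding H_def by (auto split: if_splits)
      then show ?thesis using subspace_0[OF N] unfolding H_def by auto
    qed (simp add: H_def)
  next
    fix m d x assume "x \<in> H m"
    then show "pr d x \<in> H m" using prN[of x d] unfolding H_def by (auto split: if_splits)
  qed (auto simp: H_def)
  then have le: "(\<Sum>d=lo..hi. slope_defect d * (\<Sum>m=0..1. m * hdim H d m)) \<le> 0" by (rule slope_defect_inequality)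
  show ?thesis
  proof (cases "lo \<le> n \<and> n \<le> hi")
    case True
    have e: "slope_defect d * (\<Sum>m=0..1. m * hdim H d m) = (if d = n then slope_defect n * int (dim ?N) else 0)" for d
    proof -
      have "?N \<inter> comp d = (if d = n then ?N else {0})"
      proof (cases "d = n")
        case False
        have "x = 0" if "x \<in> comp n" "x \<in> comp d" for x
          using pr_of_comp[OF that(1), of d] comp_eq[OF that(2)] False by simp
        then show ?thesis using False subspace_0[OF N] comp_closed(1)[of d] by auto
      qed auto
      then have "hdim H d 1 = (if d = n then int (dim ?N) else 0)"
        using comp_closed(1)[of d] unfolding hdim_def H_def by simp
      moreover have "{0..1::int} = {0,1}" by auto
      ultimately show ?thesis by simp
    qed
    have "slope_defect n * int (dim ?N) \<le> 0" using le True unfolding e by simp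
    moreover have "slope_defect n > 0"
      using mult_pos_neg[OF total_weight_pos n] square_norm_nonneg unfolding slope_defect_def by linarith
    ultimately have "dim ?N = 0" by (simp add: mult_le_0_iff)
    then show ?thesis using dim_0_imp_trivial[OF findim_V_subset[OF NV] N] by simp
  next
    case False
    then have "comp n = {0}" by (intro comp_out) auto
    then have "?N \<subseteq> {0}" by blast
    then show ?thesis using subspace_0[OF N] by blast
  qed
qed

section \<open>Peirce decompositions and idempotents of different degrees\<close>

lemma homogeneous_map:
  assumes "Vector_Spaces.linear scale scale P" and hom: "\<And>x d. x \<in> comp d \<Longrightarrow> P x \<in> comp d" and x: "x \<in> V"
  shows "pr d (P x) = P (pr d x)" and "P x \<in> V"
proof -
  interpret P: Vector_Spaces.linear scale scale P by fact
  have Px: "P x = (\<Sum>e=lo..hi. P (pr e x))" using P.sum[of "\<lambda>e. pr e x" "{lo..hi}"] pr_sum[OF x] by simp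
  then have "pr d (P x) = (\<Sum>e=lo..hi. pr d (P (pr e x)))" by (simp add: pr_sum_distrib)
  also have "\<dots> = (\<Sum>e=lo..hi. if e = d then P (pr e x) else 0)"
    by (intro sum.cong) (auto simp: pr_of_comp[OF hom[OF pr_comp]])
  finally show "pr d (P x) = P (pr d x)" using pr_out[of d x] by (auto simp: P.zero)
  show "P x \<in> V" unfolding Px by (rule subspace_sum[OF V_subspace comp_V[OF hom[OF pr_comp]]])
qed

text \<open>
  \<open>P\<close> and \<open>Q\<close> stand for multiplication by an idempotent from the left and from the right, in this order or the
  other. Then \<open>H\<close> has weight 1 on \<open>im P \<inter> ker Q\<close>, weight -1 on \<open>ker P \<inter> im Q\<close> and weight 0 on the other two
  Peirce components, and the difference of the dimensions of the first two is \<open>dim im P - dim im Q\<close> because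
  \<open>im P\<close> and \<open>im Q\<close> share the component \<open>im (P Q)\<close>.
\<close>

lemma commuting_projections:
  fixes H :: "int \<Rightarrow> 'v set"
  assumes lin: "Vector_Spaces.linear scale scale P" "Vector_Spaces.linear scale scale Q"
    and idem: "\<And>x. P (P x) = P x" "\<And>x. Q (Q x) = Q x" and comm: "\<And>x. P (Q x) = Q (P x)"
    and hom: "\<And>x d. x \<in> comp d \<Longrightarrow> P x \<in> comp d" "\<And>x d. x \<in> comp d \<Longrightarrow> Q x \<in> comp d"
    and H: "\<And>m. H m = (if m < 0 then V else if m = 0 then {x \<in> V. P (Q x) = Q x}
                else if m = 1 then {x \<in> V. P x = x \<and> Q x = 0} else {0})"
    and mult: "\<And>m l x y. x \<in> H m \<Longrightarrow> y \<in> H l \<Longrightarrow> x \<star> y \<in> H (m + l)"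
  shows "(\<Sum>d=lo..hi. slope_defect d * (int (dim (P ` comp d)) - int (dim (Q ` comp d)))) \<le> 0"
proof -
  interpret P: Vector_Spaces.linear scale scale P by (rule lin)
  interpret Q: Vector_Spaces.linear scale scale Q by (rule lin)
  note homP = homogeneous_map[OF lin(1) hom(1)] and homQ = homogeneous_map[OF lin(2) hom(2)]
  have "hfilt H (-1) 1" unfolding hfilt_def
  proof (intro conjI allI ballI impI)
    fix m show "subspace (H m)" "H m \<subseteq> V" 
      using V_subspace unfolding H subspace_def by (auto simp: P.add Q.add P.scale Q.scale P.zero Q.zero)
    show "H (m + 1) \<subseteq> H m" unfolding H by (auto simp: P.zero Q.zero)
  next
    fix m d x assume "x \<in> H m"
    then show "pr d x \<in> H m" unfolding H by (auto split: if_splits simp: homP(1)[symmetric] homP(2) homQ(1)[symmetric] homQ(2))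
  qed (auto simp: mult, auto simp: H)
  then have le: "(\<Sum>d=lo..hi. slope_defect d * (\<Sum>m=-1..1. m * hdim H d m)) \<le> 0" by (rule slope_defect_inequality)
  have "(\<Sum>m=-1..1. m * hdim H d m) = int (dim (P ` comp d)) - int (dim (Q ` comp d))" for d
  proof -
    let ?f = "\<lambda>x. Q x - P (Q x)"
    have f: "Vector_Spaces.linear scale scale ?f"
      by unfold_locales (simp_all add: P.add Q.add P.scale Q.scale scale_right_diff_distrib)
    have fd: "findim (comp d)" by (rule findim_V_subset[OF comp_subset_V])
    have imP: "P ` comp d = {x \<in> comp d. P x = x}" using hom(1) idem(1) by (auto intro: rev_image_eqI)
    have imQ: "Q ` comp d = {x \<in> comp d. Q x = x}" using hom(2) idem(2) by (auto intro: rev_image_eqI)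
    have 1: "dim (comp d) = dim (H 0 \<inter> comp d) + dim (?f ` comp d)"
    proof -
      have "{x \<in> comp d. ?f x = 0} = H 0 \<inter> comp d" unfolding H using comp_V by auto
      then show ?thesis using rank_nullity[OF f comp_subspace fd] by simp
    qed
    have 2: "dim (P ` comp d) = dim (H 1 \<inter> comp d) + dim (Q ` P ` comp d)"
    proof -
      have "{x \<in> P ` comp d. Q x = 0} = H 1 \<inter> comp d" unfolding H imP using comp_V by auto
      then show ?thesis
        using rank_nullity[OF lin(2) subspace_linear_image[OF lin(1) comp_subspace] findim_linear_image[OF lin(1) fd]] by simp
    qed
    have 3: "dim (Q ` comp d) = dim (?f ` comp d) + dim (P ` Q ` comp d)"
    proof -
      have "{x \<in> Q ` comp d. P x = 0} = ?f ` comp d"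
      proof
        show "{x \<in> Q ` comp d. P x = 0} \<subseteq> ?f ` comp d"
        proof
          fix x assume "x \<in> {x \<in> Q ` comp d. P x = 0}"
          then have "x \<in> comp d" "x = ?f x" unfolding imQ by auto
          then show "x \<in> ?f ` comp d" by blast
        qed
        show "?f ` comp d \<subseteq> {x \<in> Q ` comp d. P x = 0}"
          unfolding imQ using hom by (auto simp: P.diff Q.diff idem comm comp_closed)
      qed
      then show ?thesis
        using rank_nullity[OF lin(1) subspace_linear_image[OF lin(2) comp_subspace] findim_linear_image[OF lin(2) fd]] by simp
    qed
    have 4: "P ` Q ` comp d = Q ` P ` comp d" by (simp add: image_image comm)
    have "{-1..1::int} = {-1,0,1}" by auto
    moreover have "H (-1) \<inter> comp d = comp d" "H 2 \<inter> comp d = {0}" unfolding H using comp_subset_V comp_closed by auto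
    ultimately show ?thesis using 1 2 3 4 unfolding hdim_def by simp
  qed
  then show ?thesis using le by simp
qed

text \<open>
  The filtration is multiplicative because Peirce components multiply like matrix units: in the notation
  of \<open>commuting_projections\<close>, \<open>H 0\<close> consists of the \<open>x\<close> with \<open>(1 - e) x e = 0\<close>, and \<open>H 1\<close> is \<open>e B (1 - e)\<close>.
\<close>

lemma peirce_left:
  assumes e: "e \<in> comp 0" "e \<star> e = e"
  shows "(\<Sum>d=lo..hi. slope_defect d * (int (dim ((\<lambda>x. e \<star> x) ` comp d)) - int (dim ((\<lambda>x. x \<star> e) ` comp d)))) \<le> 0"
proof (rule commuting_projections[OF linear_mul_left linear_mul_right _ _ _ _ _ refl])
  let ?H = "\<lambda>m::int. if m < 0 then V else if m = 0 then {x \<in> V. e \<star> (x \<star> e) = x \<star> e}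
                else if m = 1 then {x \<in> V. e \<star> x = x \<and> x \<star> e = 0} else {0}"
  fix m l x y assume xy: "x \<in> ?H m" "y \<in> ?H l"
  have a: "e \<star> (x \<star> y \<star> e) = x \<star> y \<star> e" if x: "e \<star> (x \<star> e) = x \<star> e" and y: "e \<star> (y \<star> e) = y \<star> e"
  proof -
    have "e \<star> (x \<star> y \<star> e) = e \<star> (x \<star> (e \<star> (y \<star> e)))" by (simp add: mul_assoc y)
    also have "\<dots> = e \<star> (x \<star> e) \<star> (y \<star> e)" by (simp only: mul_assoc)
    also have "\<dots> = x \<star> (e \<star> (y \<star> e))" unfolding x by (simp only: mul_assoc)
    finally show ?thesis by (simp only: y mul_assoc)
  qed
  have b: "e \<star> (x \<star> y) = x \<star> y" if x: "e \<star> (x \<star> e) = x \<star> e" and y: "e \<star> y = y"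
  proof -
    have "e \<star> (x \<star> y) = e \<star> (x \<star> (e \<star> y))" by (simp only: y)
    also have "\<dots> = e \<star> (x \<star> e) \<star> y" by (simp only: mul_assoc)
    also have "\<dots> = x \<star> (e \<star> y)" unfolding x by (simp only: mul_assoc)
    finally show ?thesis by (simp only: y)
  qed
  have c: "x \<star> y \<star> e = 0" if x: "x \<star> e = 0" and y: "e \<star> (y \<star> e) = y \<star> e"
  proof -
    have "x \<star> y \<star> e = x \<star> (e \<star> (y \<star> e))" by (simp only: mul_assoc y)
    also have "\<dots> = x \<star> e \<star> (y \<star> e)" by (simp only: mul_assoc)
    finally show ?thesis by (simp add: x)
  qed
  have d: "x \<star> y = 0" if x: "x \<star> e = 0" and y: "e \<star> y = y"
    using mul_assoc[of x e y] by (simp add: x y)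
  have f: "e \<star> (x \<star> y \<star> e) = x \<star> y \<star> e" if "y \<star> e = 0" using that by (simp add: mul_assoc)
  have g: "e \<star> (x \<star> y \<star> e) = x \<star> y \<star> e" if "e \<star> x = x" using that by (simp add: mul_assoc[symmetric])
  have h: "e \<star> (x \<star> y) = x \<star> y" if "e \<star> x = x" using that by (simp add: mul_assoc[symmetric])
  have i: "x \<star> y \<star> e = 0" if "y \<star> e = 0" using that by (simp add: mul_assoc)
  have ml: "m < 0 \<or> m = 0 \<or> m = 1 \<or> m > 1" "l < 0 \<or> l = 0 \<or> l = 1 \<or> l > 1" by linarith+
  consider "m < 0" "l < 0" | "m < 0" "l = 0" | "m < 0" "l = 1" | "m = 0" "l < 0" | "m = 0" "l = 0"
    | "m = 0" "l = 1" | "m = 1" "l < 0" | "m = 1" "l = 0" | "m = 1" "l = 1" | "m > 1" | "l > 1"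
    using ml by blast
  then show "x \<star> y \<in> ?H (m + l)"
  proof cases
    case 3 then show ?thesis using xy f by (auto split: if_splits)
  next
    case 5 then show ?thesis using xy a by auto
  next
    case 6 then show ?thesis using xy b i by auto
  next
    case 7 then show ?thesis using xy g by (auto split: if_splits)
  next
    case 8 then show ?thesis using xy h c by auto
  next
    case 9 then show ?thesis using xy d by auto
  qed (use xy in auto)
qed (use e comp_mul[of _ 0] comp_mul[of _ _ _ 0] in \<open>auto simp: mul_assoc e(2) mul_assoc[of e e, symmetric]\<close>)

lemma peirce_right:
  assumes e: "e \<in> comp 0" "e \<star> e = e"
  shows "(\<Sum>d=lo..hi. slope_defect d * (int (dim ((\<lambda>x. x \<star> e) ` comp d)) - int (dim ((\<lambda>x. e \<star> x) ` comp d)))) \<le> 0"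
proof -
  interpret opp: optimal_alg scale V "\<lambda>x y. y \<star> x" pr lo hi by (rule opposite)
  show ?thesis by (rule opp.peirce_left[OF e])
qed

lemma left_image:
  assumes "e \<in> comp 0" "e \<star> e = e"
  shows "(\<lambda>x. e \<star> x) ` comp d = {x \<in> comp d. e \<star> x = x}"
proof
  show "(\<lambda>x. e \<star> x) ` comp d \<subseteq> {x \<in> comp d. e \<star> x = x}"
    using comp_mul[OF assms(1)] by (auto simp: mul_assoc[symmetric] assms(2))
  show "{x \<in> comp d. e \<star> x = x} \<subseteq> (\<lambda>x. e \<star> x) ` comp d" by (auto intro: rev_image_eqI)
qed

text \<open>
  Multiplication by \<open>u\<close> is an isomorphism from \<open>f B\<close> to \<open>e B\<close> with inverse given by \<open>v\<close>; it raises degrees by \<open>d\<close>.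
\<close>

lemma dim_left_image_shift:
  assumes u: "u \<in> comp d" and v: "v \<in> comp (- d)"
    and uv: "u \<star> v = e" and vu: "v \<star> u = f" and e: "e \<star> e = e" and f: "f \<star> f = f"
  shows "dim ((\<lambda>x. e \<star> x) ` comp i) = dim ((\<lambda>x. f \<star> x) ` comp (i - d))"
proof -
  have fc: "f \<in> comp 0" using comp_mul[OF v u] vu by simp
  let ?S = "(\<lambda>x. f \<star> x) ` comp (i - d)"
  have "(\<lambda>y. u \<star> y) ` ?S = (\<lambda>x. e \<star> x) ` comp i"
  proof
    show "(\<lambda>y. u \<star> y) ` ?S \<subseteq> (\<lambda>x. e \<star> x) ` comp i"
    proof
      fix z assume "z \<in> (\<lambda>y. u \<star> y) ` ?S"
      then obtain y where y: "y \<in> comp (i - d)" "z = u \<star> (f \<star> y)" by auto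
      have "z = e \<star> (u \<star> y)" by (simp only: y(2) uv[symmetric] vu[symmetric] mul_assoc)
      moreover have "u \<star> y \<in> comp i" using comp_mul[OF u y(1)] by simp
      ultimately show "z \<in> (\<lambda>x. e \<star> x) ` comp i" by blast
    qed
    show "(\<lambda>x. e \<star> x) ` comp i \<subseteq> (\<lambda>y. u \<star> y) ` ?S"
    proof
      fix z assume "z \<in> (\<lambda>x. e \<star> x) ` comp i"
      then obtain x where x: "x \<in> comp i" "z = e \<star> x" by auto
      have "z = e \<star> (e \<star> x)" by (simp only: x(2) mul_assoc[symmetric] e)
      also have "\<dots> = u \<star> (f \<star> (v \<star> x))" by (simp only: uv[symmetric] vu[symmetric] mul_assoc)
      finally show "z \<in> (\<lambda>y. u \<star> y) ` ?S" using comp_mul[OF v x(1)] by simp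
    qed
  qed
  moreover have "y = 0" if "y \<in> ?S" "u \<star> y = 0" for y
  proof -
    have "f \<star> y = y" using that(1) unfolding left_image[OF fc f] by simp
    then show ?thesis using that(2) mul_assoc[of v u y] vu by simp
  qed
  ultimately show ?thesis 
    using dim_inj_image[OF linear_mul_left subspace_linear_image[OF linear_mul_left comp_subspace]
        findim_linear_image[OF linear_mul_left findim_V_subset[OF comp_subset_V]], of f "i - d" u] by simp
qed

text \<open>
  Add the Peirce inequality for \<open>e\<close> to the one with the sides exchanged for \<open>f\<close>, and rewrite the dimensions for
  \<open>e\<close> by those for \<open>f\<close>. The shifts act in opposite directions on the two sides, so everything cancels
  except \<open>- W d (dim (f B) + dim (B f))\<close>, which is positive for \<open>f \<noteq> 0\<close>.
\<close>

lemma shifted_idempotents_neg: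
  assumes d: "d < 0" and u: "u \<in> comp d" and v: "v \<in> comp (- d)"
    and uv: "u \<star> v = e" and vu: "v \<star> u = f" and e: "e \<star> e = e" and f: "f \<star> f = f"
  shows "f = 0"
proof (rule ccontr)
  assume f0: "f \<noteq> 0"
  have ec: "e \<in> comp 0" and fc: "f \<in> comp 0" using comp_mul[OF u v] comp_mul[OF v u] uv vu by simp_all
  define p where "p j = int (dim ((\<lambda>x. f \<star> x) ` comp j))" for j
  define q where "q j = int (dim ((\<lambda>x. x \<star> f) ` comp j))" for j
  interpret opp: optimal_alg scale V "\<lambda>x y. y \<star> x" pr lo hi by (rule opposite)
  have L: "int (dim ((\<lambda>x. e \<star> x) ` comp i)) = p (i - d)" for i
    unfolding p_def using dim_left_image_shift[OF u v uv vu e f] by simp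
  have R: "int (dim ((\<lambda>x. x \<star> e) ` comp i)) = q (i + d)" for i
    unfolding q_def using opp.dim_left_image_shift[OF v _ uv vu e f, of i] u by simp
  have out: "p j = 0" "q j = 0" "p (j + d - d) = 0" if "j < lo \<or> hi < j" for j
    using comp_out[OF that] unfolding p_def q_def by simp_all
  have oute: "p (i - d) = 0" "q (i + d) = 0" if "i < lo \<or> hi < i" for i
    using comp_out[OF that] L[of i, symmetric] R[of i, symmetric] by simp_all
  have S1: "(\<Sum>i=lo..hi. slope_defect i * p (i - d)) = (\<Sum>j=lo..hi. slope_defect (j + d) * p j)"
    using sum_shift_int[of lo hi "\<lambda>i. slope_defect i * p (i - d)" d] out oute by simp
  have S2: "(\<Sum>i=lo..hi. slope_defect i * q (i + d)) = (\<Sum>j=lo..hi. slope_defect (j - d) * q j)"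
    using sum_shift_int[of lo hi "\<lambda>i. slope_defect i * q (i + d)" "- d"] out oute by simp
  have "(\<Sum>i=lo..hi. slope_defect i * (p (i - d) - q (i + d))) \<le> 0"
    using peirce_left[OF ec e] unfolding L R .
  moreover have "(\<Sum>j=lo..hi. slope_defect j * (q j - p j)) \<le> 0"
    using peirce_right[OF fc f] unfolding p_def q_def .
  ultimately have "(\<Sum>j=lo..hi. slope_defect (j + d) * p j - slope_defect (j - d) * q j + slope_defect j * (q j - p j)) \<le> 0"
    by (simp add: sum.distrib sum_subtractf right_diff_distrib S1 S2)
  also have "(\<Sum>j=lo..hi. slope_defect (j + d) * p j - slope_defect (j - d) * q j + slope_defect j * (q j - p j))
      = (\<Sum>j=lo..hi. (total_weight * (- d)) * (p j + q j))"
    by (intro sum.cong) (auto simp: slope_defect_def algebra_simps)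
  also have "\<dots> = (total_weight * (- d)) * (\<Sum>j=lo..hi. p j + q j)" by (rule sum_distrib_left[symmetric])
  finally have "(\<Sum>j=lo..hi. p j + q j) \<le> 0"
    using mult_pos_pos[of total_weight "- d"] total_weight_pos d by (simp only: mult_le_0_iff) auto
  moreover have "0 \<le> p j + q j" for j unfolding p_def q_def by simp
  ultimately have z: "p j + q j = 0" if "j \<in> {lo..hi}" for j
    using sum_nonneg_eq_0_iff[of "{lo..hi}" "\<lambda>j. p j + q j"] that
    by (meson finite_atLeastAtMost_int order_antisym sum_nonneg)
  have "0 \<in> {lo..hi}"
  proof (rule ccontr)
    assume "0 \<notin> {lo..hi}"
    then have "comp 0 = {0}" by (intro comp_out) auto
    then show False using fc f0 by blast
  qed
  then have "dim ((\<lambda>x. f \<star> x) ` comp 0) = 0" using z[of 0] unfolding p_def q_def by simp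
  then have "(\<lambda>x. f \<star> x) ` comp 0 = {0}"
    by (intro dim_0_imp_trivial subspace_linear_image[OF linear_mul_left comp_subspace]
          findim_linear_image[OF linear_mul_left findim_V_subset[OF comp_subset_V]])
  moreover have "f \<in> (\<lambda>x. f \<star> x) ` comp 0" using imageI[OF fc, of "\<lambda>x. f \<star> x"] f by simp
  ultimately show False using f0 by blast
qed

lemma shifted_idempotents:
  assumes d: "d \<noteq> 0" and u: "u \<in> comp d" and v: "v \<in> comp (- d)"
    and uv: "u \<star> v = e" and vu: "v \<star> u = f" and e: "e \<star> e = e" and f: "f \<star> f = f"
  shows "e = 0"
proof (cases "d < 0")
  case True
  then have "f = 0" using shifted_idempotents_neg[OF _ u v uv vu e f] by simp
  then have "u \<star> (f \<star> v) = 0" by simp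
  moreover have "u \<star> (f \<star> v) = e \<star> e" by (simp only: uv[symmetric] vu[symmetric] mul_assoc)
  ultimately show ?thesis using e by simp
next
  case False
  then show ?thesis using shifted_idempotents_neg[of "- d", OF _ v _ vu uv f e] u d by simp
qed

text \<open>
  Otherwise some idempotent \<open>e\<close> has the form \<open>u v r\<close> with \<open>r\<close> of degree 0. Then \<open>e u\<close> and \<open>v r e\<close> have opposite
  degrees, their product is \<open>e\<close>, and their product in the other order is idempotent too.
\<close>

lemma opposite_degrees_nilpotent:
  assumes d: "d \<noteq> 0" and u: "u \<in> comp d" and v: "v \<in> comp (- d)"
  shows "\<exists>k. pw (u \<star> v) k = 0"
proof (rule ccontr)
  assume "\<nexists>k. pw (u \<star> v) k = 0"
  then have nn: "\<And>k. pw (u \<star> v) k \<noteq> 0" by blast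
  have "u \<star> v \<in> comp 0" using comp_mul[OF u v] by simp
  then have "pw (u \<star> v) k \<in> comp 0" for k using pw_comp[of "u \<star> v" 0 k] by simp
  then obtain e r where e: "e \<in> comp 0" "e \<noteq> 0" "e \<star> e = e" and r: "r \<in> comp 0" "e = u \<star> v \<star> r"
    by (rule idempotent_of_non_nilpotent[OF nn comp_subspace])
  let ?u = "e \<star> u" and ?v = "v \<star> r \<star> e"
  have 0: "?u \<in> comp d" "?v \<in> comp (- d)"
    using comp_mul[OF e(1) u] comp_mul[OF comp_mul[OF v r(1)] e(1)] by simp_all
  have uv': "u \<star> (v \<star> r) = e" using r(2) by (simp only: mul_assoc)
  have ee: "e \<star> (e \<star> x) = e \<star> x" for x by (simp only: mul_assoc[symmetric] e(3))
  have uv'': "u \<star> (v \<star> (r \<star> x)) = e \<star> x" for x by (simp only: uv'[symmetric] mul_assoc)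
  have 1: "?u \<star> ?v = e" by (simp only: mul_assoc uv'' ee e(3))
  have 2: "(?v \<star> ?u) \<star> (?v \<star> ?u) = ?v \<star> ?u" by (simp only: mul_assoc uv'' ee e(3))
  have "e = 0" by (rule shifted_idempotents[OF d 0 1 refl e(3) 2])
  then show False using e(2) by contradiction
qed

section \<open>The Jacobson radical\<close>

text \<open>
  Gaussian elimination. The coefficient of \<open>w k\<close> in its own equation has degree 0 and lies in the left ideal
  of \<open>x\<close>, hence is nilpotent; so the equation can be solved for \<open>w k\<close>, and substituting the solution into the
  other equations keeps their form. The coefficients are written as \<open>c j i \<star> x\<close> to make membership
  in the left ideal explicit.
\<close>

lemma graded_nakayama:
  assumes "finite S" and d: "d \<noteq> 0" and x: "x \<in> comp d"
    and "\<And>i j. c j i \<in> comp (i - j - d)"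
    and "\<And>i. i \<in> S \<Longrightarrow> w i = (\<Sum>j\<in>S. w j \<star> (c j i \<star> x))"
    and "i \<in> S"
  shows "w i = 0"
  using assms(1,4-)
proof (induction S arbitrary: c i rule: finite_induct)
  case (insert k S)
  let ?z = "c k k \<star> x"
  let ?L = "(\<lambda>r. r \<star> x) ` comp (- d)"
  have ckk: "c k k \<in> comp (- d)" using insert.prems(1)[of k k] by simp
  obtain n where n: "pw ?z n = 0" using opposite_degrees_nilpotent[of "- d" "c k k" x] ckk x d by auto
  have L: "subspace ?L" by (rule subspace_linear_image[OF linear_mul_right comp_subspace])
  have pL: "pw ?z m \<in> ?L" for m
  proof (cases m)
    case (Suc m')
    have "pw ?z m' \<in> comp 0" using pw_comp[of ?z 0 m'] comp_mul[OF ckk x] by simp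
    then have "pw ?z m' \<star> c k k \<in> comp (- d)" using comp_mul[OF _ ckk] by fastforce
    moreover have "pw ?z m = pw ?z m' \<star> c k k \<star> x" using pw_add[of ?z m' 0] Suc by (simp add: mul_assoc)
    ultimately show ?thesis by blast
  qed (use ckk in auto)
  obtain q where q: "q \<in> ?L" "q = ?z + ?z \<star> q"
    by (rule nilpotent_quasi_inverse[OF n L pL])
  then obtain q0 where q0: "q0 \<in> comp (- d)" "q = q0 \<star> x" by auto
  have qc: "q \<in> comp 0" using comp_mul[OF q0(1) x] q0(2) by simp
  define s where "s = (\<Sum>j\<in>S. w j \<star> (c j k \<star> x))"
  have wk: "w k = w k \<star> ?z + s" using insert.prems(2)[of k] insert.hyps unfolding s_def by simp
  \<comment> \<open>multiplying the equation for \<open>w k\<close> by \<open>1 + q\<close>, which is inverse to \<open>1 - c k k x\<close>\<close>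
  have "w k \<star> q = w k \<star> ?z + w k \<star> ?z \<star> q"
    using arg_cong[OF q(2), of "\<lambda>t. w k \<star> t"] by (simp only: mul_add_right mul_assoc)
  moreover have "w k \<star> q = w k \<star> ?z \<star> q + s \<star> q"
    using arg_cong[OF wk, of "\<lambda>t. t \<star> q"] by (simp only: mul_add_left)
  ultimately have "s \<star> q = w k \<star> ?z" by (simp add: add.commute)
  then have wk': "w k = s + s \<star> q" using wk by (simp add: add.commute)
  define b where "b j = c j k \<star> x + c j k \<star> x \<star> q" for j
  have bc: "b j \<in> comp (k - j)" for j
  proof -
    have 1: "c j k \<star> x \<in> comp (k - j)" using comp_mul[OF insert.prems(1)[of j k] x] by simp
    show ?thesis unfolding b_def using comp_closed(2)[OF 1 comp_mul'[OF 1 qc]] by simp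
  qed
  have wkb: "w k = (\<Sum>j\<in>S. w j \<star> b j)"
    unfolding wk' s_def b_def by (simp add: mul_sum_left mul_add_right sum.distrib mul_assoc)
  define c' where "c' j i = c j i + b j \<star> c k i" for j i
  have c'c: "c' j i \<in> comp (i - j - d)" for i j unfolding c'_def
    by (intro comp_closed insert.prems(1) comp_mul'[OF bc insert.prems(1)]) simp
  have wS: "w i = (\<Sum>j\<in>S. w j \<star> (c' j i \<star> x))" if "i \<in> S" for i
  proof -
    have "w i = w k \<star> (c k i \<star> x) + (\<Sum>j\<in>S. w j \<star> (c j i \<star> x))" using insert.prems(2)[of i] insert.hyps that by simp
    also have "w k \<star> (c k i \<star> x) = (\<Sum>j\<in>S. w j \<star> b j \<star> (c k i \<star> x))"
      using arg_cong[OF wkb, of "\<lambda>t. t \<star> (c k i \<star> x)"] by (simp only: mul_sum_left)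
    finally show ?thesis unfolding c'_def by (simp add: sum.distrib mul_add_left mul_add_right mul_assoc add.commute)
  qed
  have zS: "w j = 0" if "j \<in> S" for j by (rule insert.IH[OF c'c wS that])
  then have "w k = 0" unfolding wkb by simp
  then show ?case using zS insert.prems(3) by auto
qed simp

text \<open>
  The Jacobson radical of the algebra \<open>V\<close>, with left quasi-regularity written out.
\<close>

definition radical :: "'v set" where
  "radical = {x \<in> V. \<forall>r\<in>V. \<exists>y\<in>V. y + r \<star> x - y \<star> (r \<star> x) = 0}"

text \<open>
  An element \<open>z = r x\<close> is left quasi-regular as soon as \<open>w \<mapsto> w - w z\<close> is onto, or equivalently injective. If
  \<open>w = w z\<close>, the homogeneous components of \<open>w\<close> satisfy a system as in the graded Nakayama lemma.
\<close>

lemma comp_subset_radical: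
  assumes d: "d \<noteq> 0"
  shows "comp d \<subseteq> radical"
proof
  fix x assume x: "x \<in> comp d"
  have "\<exists>y\<in>V. y + r \<star> x - y \<star> (r \<star> x) = 0" if r: "r \<in> V" for r
  proof -
    let ?z = "r \<star> x"
    let ?T = "\<lambda>w. w - w \<star> ?z"
    have T: "Vector_Spaces.linear scale scale ?T"
      by unfold_locales (simp_all add: mul_add_left mul_scale_left scale_right_diff_distrib)
    have inj: "w = 0" if w: "w \<in> V" "?T w = 0" for w
    proof -
      have eq: "pr i w = (\<Sum>j\<in>{lo..hi}. pr j w \<star> (pr (i - j - d) r \<star> x))" for i
        using pr_mul_sum[of w ?z i] w r pr_mul_comp_right[OF x r] by simp
      have "pr i w = 0" if "i \<in> {lo..hi}" for i
        by (rule graded_nakayama[OF finite_atLeastAtMost_int d x, of "\<lambda>j i. pr (i - j - d) r",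
              OF pr_comp eq that])
      then show ?thesis using pr_sum[OF w(1)] by simp
    qed
    have "?T ` V = V" by (rule inj_imp_surj_on[OF T V_subspace V_findim inj]) auto
    then have "- ?z \<in> ?T ` V" by simp
    then obtain y where y: "y \<in> V" "- ?z = ?T y" by auto
    have "y + ?z - y \<star> ?z = ?T y - (- ?z)" by (simp add: algebra_simps)
    then have "y + ?z - y \<star> ?z = 0" unfolding y(2) by simp
    then show ?thesis using y(1) by blast
  qed
  then show "x \<in> radical" using comp_V[OF x] unfolding radical_def by blast
qed

lemma radical_0: "0 \<in> radical"
  unfolding radical_def using V_closed(1) by (auto intro!: bexI[of _ 0])

text \<open>
  In terms of a formal unit, \<open>(1 - y) (1 - r x) = 1\<close> gives \<open>(1 - y) (1 - r (x + x')) = 1 - (r - y r) x'\<close>,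
  which has a left inverse \<open>1 - y'\<close>; and \<open>(1 - y') (1 - y)\<close> is \<open>1 - (y' + y - y' y)\<close>.
\<close>

lemma radical_add:
  assumes x: "x \<in> radical" and x': "x' \<in> radical"
  shows "x + x' \<in> radical"
proof -
  have "\<exists>y\<in>V. y + r \<star> (x + x') - y \<star> (r \<star> (x + x')) = 0" if r: "r \<in> V" for r
  proof -
    obtain y where y: "y \<in> V" "y + r \<star> x - y \<star> (r \<star> x) = 0" using x r unfolding radical_def by blast
    have "r - y \<star> r \<in> V" using r by simp
    then obtain y' where y': "y' \<in> V" "y' + (r - y \<star> r) \<star> x' - y' \<star> ((r - y \<star> r) \<star> x') = 0"
      using x' unfolding radical_def by blast
    let ?Y = "y' + y - y' \<star> y"
    have "?Y + r \<star> (x + x') - ?Y \<star> (r \<star> (x + x'))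
       = (y + r \<star> x - y \<star> (r \<star> x)) - y' \<star> (y + r \<star> x - y \<star> (r \<star> x))
         + (y' + (r - y \<star> r) \<star> x' - y' \<star> ((r - y \<star> r) \<star> x'))"
      by (simp add: mul_add_left mul_add_right mul_diff_left mul_diff_right mul_assoc algebra_simps)
    then show ?thesis using y y' by (intro bexI[of _ ?Y]) simp_all
  qed
  moreover have "x + x' \<in> V" using x x' unfolding radical_def by simp
  ultimately show ?thesis unfolding radical_def by blast
qed

end

section \<open>Elements of negative degree are central\<close>

lemma sum_telescope_int:
  fixes f :: "int \<Rightarrow> int"
  assumes "a \<le> b + 1"
  shows "(\<Sum>m=a..b. f m - f (m + 1)) = f a - f (b + 1)"
proof -
  have "(\<Sum>m=a..i - 1. f m - f (m + 1)) = f a - f i" if "a \<le> i" for i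
    using that
  proof (induction i rule: int_ge_induct)
    case (step i)
    have "{a..i + 1 - 1} = insert i {a..i - 1}" using step.hyps by auto
    then show ?case using step.IH by simp
  qed simp
  from this[of "b + 1"] assms show ?thesis by simp
qed

context graded_alg
begin

text \<open>
  The split filtration of the grading.
\<close>

definition lead_filt :: "int \<Rightarrow> 'v set" where
  "lead_filt m = {a \<in> V. \<forall>d<m. pr d a = 0}"

lemma lead_filt_subspace: "subspace (lead_filt m)"
  unfolding subspace_def lead_filt_def by simp

lemma lead_filt_V: "lead_filt m \<subseteq> V"
  unfolding lead_filt_def by blast

lemma lead_filt_low: "m \<le> lo \<Longrightarrow> lead_filt m = V"
  unfolding lead_filt_def by (auto intro: pr_out)

lemma lead_filt_high: "hi < m \<Longrightarrow> lead_filt m = {0}"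
proof -
  assume m: "hi < m"
  have "a = 0" if "a \<in> V" "\<forall>d<m. pr d a = 0" for a
    using pr_sum[OF that(1)] that(2) m by simp
  then show ?thesis unfolding lead_filt_def by auto
qed

lemma lead_filt_Suc: "lead_filt (m + 1) = {a \<in> lead_filt m. pr m a = 0}"
  unfolding lead_filt_def by (auto simp: order_le_less)

lemma comp_lead_filt: "a \<in> comp d \<Longrightarrow> m \<le> d \<Longrightarrow> a \<in> lead_filt m"
  unfolding lead_filt_def using comp_V by (auto simp: pr_of_comp)

lemma pr_lead_filt_mul:
  assumes s: "s \<in> lead_filt e" and t: "t \<in> lead_filt g"
  shows "f < e + g \<Longrightarrow> pr f (s \<star> t) = 0" and "pr (e + g) (s \<star> t) = pr e s \<star> pr g t"
proof -
  have V: "s \<in> V" "t \<in> V" using s t lead_filt_V by auto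
  have z: "pr i s = 0" if "i < e" for i using s that unfolding lead_filt_def by simp
  have z': "pr i t = 0" if "i < g" for i using t that unfolding lead_filt_def by simp
  show "pr f (s \<star> t) = 0" if "f < e + g"
  proof -
    have "pr i s \<star> pr (f - i) t = 0" for i
    proof (cases "i < e")
      case False
      then have "f - i < g" using that by linarith
      then show ?thesis using z' by simp
    qed (simp add: z)
    then show ?thesis unfolding pr_mul_sum[OF V] by simp
  qed
  have "pr (e + g) (s \<star> t) = (\<Sum>i=lo..hi. if i = e then pr e s \<star> pr g t else 0)"
    unfolding pr_mul_sum[OF V]
  proof (rule sum.cong[OF refl])
    fix i
    consider "i < e" | "i = e" | "i > e" by linarith
    then show "pr i s \<star> pr (e + g - i) t = (if i = e then pr e s \<star> pr g t else 0)"
      by cases (use z z' in auto)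
  qed
  then show "pr (e + g) (s \<star> t) = pr e s \<star> pr g t" using pr_out[of e s] by auto
qed

lemma lead_filt_mul: "s \<in> lead_filt e \<Longrightarrow> t \<in> lead_filt g \<Longrightarrow> s \<star> t \<in> lead_filt (e + g)"
  using pr_lead_filt_mul(1) unfolding lead_filt_def[of "e + g"] by simp

lemma lead_filt_image: "pr m ` lead_filt m = comp m"
proof
  show "comp m \<subseteq> pr m ` lead_filt m"
  proof
    fix a assume a: "a \<in> comp m"
    show "a \<in> pr m ` lead_filt m"
      using imageI[OF comp_lead_filt[OF a order_refl], of "pr m"] comp_eq[OF a] by simp
  qed
qed auto

lemma dim_lead_filt: "int (dim (lead_filt m)) - int (dim (lead_filt (m + 1))) = int (dim (comp m))"
  using rank_nullity[OF pr_linear lead_filt_subspace findim_V_subset[OF lead_filt_V], of m m]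
  unfolding lead_filt_Suc lead_filt_image by simp

end

context optimal_alg
begin

lemma lo_le_hi: "lo \<le> hi"
  using total_weight_pos unfolding total_weight_def by (rule contrapos_pp) simp

text \<open>
  Let \<open>F m\<close> be the image of the split filtration. The leading forms of degree \<open>d\<close> of the elements of
  \<open>F m\<close> are \<open>H m \<inter> comp d\<close> for a homogeneous filtration \<open>H\<close>, and \<open>H m\<close> has the dimension of \<open>F m\<close>, which is that
  of the split filtration. So the matrix \<open>hdim H d m\<close> of nonnegative numbers has the same row and
  column sums, and optimality gives \<open>\<Sum>d m. d m (hdim H d m) \<ge> square_norm\<close>. Therefore
  \<open>\<Sum>d m. (d - m)\<^sup>2 (hdim H d m) \<le> 0\<close>, the matrix is diagonal, and no element of \<open>F m\<close> has a leading form of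
  degree below \<open>m\<close>.
\<close>

lemma automorphism_preserves_lead_filt:
  assumes lin: "Vector_Spaces.linear scale scale \<phi>"
    and bij: "\<And>a. a \<in> V \<Longrightarrow> \<phi> a = 0 \<Longrightarrow> a = 0" "\<phi> ` V \<subseteq> V"
    and mult: "\<And>a b. a \<in> V \<Longrightarrow> b \<in> V \<Longrightarrow> \<phi> (a \<star> b) = \<phi> a \<star> \<phi> b"
  shows "\<phi> ` lead_filt m \<subseteq> lead_filt m"
proof -
  interpret \<phi>: Vector_Spaces.linear scale scale \<phi> by (rule lin)
  define F where "F m = \<phi> ` lead_filt m" for m
  have Fsub: "subspace (F m)" for m unfolding F_def by (rule subspace_linear_image[OF lin lead_filt_subspace])
  have FV: "F m \<subseteq> V" for m unfolding F_def using bij(2) lead_filt_V by blast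
  have surj: "\<phi> ` V = V" by (rule inj_imp_surj_on[OF lin V_subspace V_findim bij])
  have Fmul: "s \<star> t \<in> F (m + l)" if "s \<in> F m" "t \<in> F l" for s t m l
  proof -
    obtain a b where "a \<in> lead_filt m" "b \<in> lead_filt l" "s = \<phi> a" "t = \<phi> b" using \<open>s \<in> F m\<close> \<open>t \<in> F l\<close> unfolding F_def by auto
    then show ?thesis unfolding F_def
      using mult[of a b] lead_filt_V lead_filt_mul[of a m b l] by (metis image_eqI subsetD)
  qed
  have Fdec: "F (m + 1) \<subseteq> F m" for m unfolding F_def using lead_filt_Suc by blast
  have Fdim: "dim (F m) = dim (lead_filt m)" for m unfolding F_def
    by (rule dim_inj_image[OF lin lead_filt_subspace findim_V_subset[OF lead_filt_V] bij(1)]) (auto dest: subsetD[OF lead_filt_V])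
  define I where "I m d = F m \<inter> lead_filt d" for m d
  have Isub: "subspace (I m d)" for m d unfolding I_def by (rule subspace_inter[OF Fsub lead_filt_subspace])
  have IV: "I m d \<subseteq> V" for m d unfolding I_def using FV by blast
  \<comment> \<open>the space spanned by the leading forms of the elements of \<open>F m\<close>\<close>
  define H where "H m = {z \<in> V. \<forall>d. pr d z \<in> pr d ` I m d}" for m
  have prIsub: "subspace (pr d ` I m d)" for m d by (rule subspace_linear_image[OF pr_linear Isub])
  have Hcomp: "H m \<inter> comp d = pr d ` I m d" for m d
  proof
    show "H m \<inter> comp d \<subseteq> pr d ` I m d"
    proof
      fix z assume "z \<in> H m \<inter> comp d"
      then have "pr d z \<in> pr d ` I m d" "z \<in> comp d" unfolding H_def by blast+
      then show "z \<in> pr d ` I m d" by (simp only: comp_eq)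
    qed
    show "pr d ` I m d \<subseteq> H m \<inter> comp d"
    proof
      fix z assume z: "z \<in> pr d ` I m d"
      then have zc: "z \<in> comp d" by auto
      have "pr e z \<in> pr e ` I m e" for e
        using z subspace_0[OF prIsub[of e m]] by (simp add: pr_of_comp[OF zc])
      then show "z \<in> H m \<inter> comp d" unfolding H_def using zc comp_V by simp
    qed
  qed
  have hf: "hfilt H lo hi" unfolding hfilt_def
  proof (intro conjI allI ballI impI)
    fix m show "subspace (H m)"
      unfolding H_def subspace_def
      by (auto simp: subspace_0[OF prIsub] intro: subspace_add[OF prIsub] subspace_scale[OF prIsub])
    show "H m \<subseteq> V" unfolding H_def by blast
    show "H (m + 1) \<subseteq> H m" unfolding H_def I_def using Fdec by blast
  next
    fix m l x y assume x: "x \<in> H m" and y: "y \<in> H l"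
    have V: "x \<in> V" "y \<in> V" using x y unfolding H_def by auto
    have "pr d (x \<star> y) \<in> pr d ` I (m + l) d" for d
    proof -
      have "pr e x \<star> pr (d - e) y \<in> pr d ` I (m + l) d" for e
      proof -
        obtain s where s: "s \<in> I m e" "pr e x = pr e s" using x unfolding H_def by auto
        obtain t where t: "t \<in> I l (d - e)" "pr (d - e) y = pr (d - e) t" using y unfolding H_def by auto
        have "s \<star> t \<in> I (m + l) d"
          using s(1) t(1) Fmul[of s m t l] lead_filt_mul[of s e t "d - e"] unfolding I_def by simp
        moreover have "pr d (s \<star> t) = pr e s \<star> pr (d - e) t"
          using s(1) t(1) pr_lead_filt_mul(2)[of s e t "d - e"] unfolding I_def by simp
        ultimately show ?thesis unfolding s(2) t(2) by (metis imageI)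
      qed
      then show ?thesis unfolding pr_mul_sum[OF V] by (rule subspace_sum[OF prIsub])
    qed
    then show "x \<star> y \<in> H (m + l)" unfolding H_def by simp
  next
    fix m d x assume x: "x \<in> H m"
    have "pr e (pr d x) \<in> pr e ` I m e" for e
      using x subspace_0[OF prIsub[of e m]] unfolding H_def by (auto simp: pr_pr)
    then show "pr d x \<in> H m" unfolding H_def by simp
  next
    fix m :: int assume m: "m \<le> lo"
    have "F m = V" unfolding F_def lead_filt_low[OF m] surj by (rule refl)
    then have "pr d z \<in> pr d ` I m d" if "z \<in> V" for d z
      using comp_lead_filt[OF pr_comp order_refl, of d z] unfolding I_def
      by (metis (no_types, lifting) Int_iff comp_eq imageI pr_closed pr_comp)
    then show "H m = V" unfolding H_def by blast
  next
    fix m :: int assume m: "hi < m"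
    have "F m = {0}" unfolding F_def lead_filt_high[OF m] by (simp add: \<phi>.zero)
    then have "I m d = {0}" for d unfolding I_def using subspace_0[OF lead_filt_subspace] by auto
    then have "H m = {z \<in> V. \<forall>d. pr d z = 0}" unfolding H_def by simp
    moreover have "z = 0" if "z \<in> V" "\<forall>d. pr d z = 0" for z
      using eq_by_components[OF that(1), of 0] that(2) by simp
    ultimately show "H m = {0}" by auto
  qed
  let ?h = "hdim H"
  have Hsub: "subspace (H m)" and HV: "H m \<subseteq> V" and Hdec: "H (m + 1) \<subseteq> H m" for m
    using hf unfolding hfilt_def by blast+
  have Hhigh: "H m = {0}" if "hi < m" for m using hf that unfolding hfilt_def by blast
  have Hlow: "H m = V" if "m \<le> lo" for m using hf that unfolding hfilt_def by blast
  have HCsub: "subspace (H m \<inter> comp d)" for m d by (rule subspace_inter[OF Hsub comp_subspace])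
  have HCfin: "findim (H m \<inter> comp d)" for m d by (rule findim_V_subset) (use HV in blast)
  have hnn: "0 \<le> ?h d m" for d m
    using dim_mono_findim[OF HCfin HCsub HCsub, of "m + 1" d m d] Hdec[of m] unfolding hdim_def by auto
  have sum1: "(\<Sum>d=lo..hi. int (dim (H m \<inter> comp d))) = int (dim (lead_filt m))" for m
  proof -
    have "int (dim (H m \<inter> comp d)) = int (dim (I m d)) - int (dim (I m (d + 1)))" for d
    proof -
      have "{x \<in> I m d. pr d x = 0} = I m (d + 1)" unfolding I_def lead_filt_Suc by blast
      then show ?thesis using rank_nullity[OF pr_linear Isub findim_V_subset[OF IV], of m d d] Hcomp[of m d] by simp
    qed
    then have "(\<Sum>d=lo..hi. int (dim (H m \<inter> comp d))) = (\<Sum>d=lo..hi. int (dim (I m d)) - int (dim (I m (d + 1))))" by simp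
    also have "\<dots> = int (dim (I m lo)) - int (dim (I m (hi + 1)))"
      using sum_telescope_int[of lo hi "\<lambda>d. int (dim (I m d))"] lo_le_hi by simp
    also have "I m lo = F m" unfolding I_def lead_filt_low[OF order_refl] using FV by blast
    also have "I m (hi + 1) = {0}" unfolding I_def using lead_filt_high[of "hi + 1"] subspace_0[OF Fsub] by auto
    finally show ?thesis using Fdim by simp
  qed
  have col: "(\<Sum>d=lo..hi. ?h d m) = int (dim (comp m))" for m
    using sum1[of m] sum1[of "m + 1"] dim_lead_filt[of m] unfolding hdim_def by (simp add: sum_subtractf)
  have row: "(\<Sum>m=lo..hi. ?h d m) = int (dim (comp d))" for d
  proof -
    have "V \<inter> comp d = comp d" "{0} \<inter> comp d = {0}" using comp_V comp_closed(1) by auto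
    then show ?thesis
      using sum_telescope_int[of lo hi "\<lambda>m. int (dim (H m \<inter> comp d))"] lo_le_hi Hlow[of lo] Hhigh[of "hi + 1"]
      unfolding hdim_def by simp
  qed
  define X where "X = (\<Sum>d=lo..hi. \<Sum>m=lo..hi. d * m * ?h d m)"
  have s1: "(\<Sum>d=lo..hi. \<Sum>m=lo..hi. m * ?h d m) = total_weight"
    unfolding total_weight_def by (subst sum.swap) (simp add: sum_distrib_left[symmetric] col)
  have s2: "(\<Sum>d=lo..hi. \<Sum>m=lo..hi. m * m * ?h d m) = square_norm"
    unfolding square_norm_def by (subst sum.swap) (simp add: sum_distrib_left[symmetric] col)
  have s3: "(\<Sum>d=lo..hi. \<Sum>m=lo..hi. d * d * ?h d m) = square_norm"
    unfolding square_norm_def by (simp add: sum_distrib_left[symmetric] row)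
  have "total_weight * square_norm \<le> total_weight * X"
    using optimal[OF hf] unfolding s1 X_def by (simp add: mult.commute)
  then have QX: "square_norm \<le> X" using total_weight_pos by simp
  have "(\<Sum>d=lo..hi. \<Sum>m=lo..hi. (d - m) * (d - m) * ?h d m)
      = (\<Sum>d=lo..hi. \<Sum>m=lo..hi. d * d * ?h d m + m * m * ?h d m - 2 * (d * m * ?h d m))"
    by (intro sum.cong refl) (simp add: algebra_simps)
  also have "\<dots> = square_norm + square_norm - 2 * X"
    unfolding sum_subtractf sum.distrib s2 s3 X_def by (simp add: sum_distrib_left)
  finally have le0: "(\<Sum>d=lo..hi. \<Sum>m=lo..hi. (d - m) * (d - m) * ?h d m) \<le> 0" using QX by simp
  have nn: "0 \<le> (d - m) * (d - m) * ?h d m" for d m using hnn by simp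
  have hz: "?h d m = 0" if dm: "d \<in> {lo..hi}" "m \<in> {lo..hi}" "d \<noteq> m" for d m
  proof -
    have "(\<Sum>d=lo..hi. \<Sum>m=lo..hi. (d - m) * (d - m) * ?h d m) = 0"
      using le0 by (rule order_antisym) (intro sum_nonneg nn)
    then have "\<forall>d\<in>{lo..hi}. (\<Sum>m=lo..hi. (d - m) * (d - m) * ?h d m) = 0"
      by (subst (asm) sum_nonneg_eq_0_iff) (auto intro: sum_nonneg nn)
    then have "(\<Sum>m=lo..hi. (d - m) * (d - m) * ?h d m) = 0" using dm(1) by blast
    then have "\<forall>m\<in>{lo..hi}. (d - m) * (d - m) * ?h d m = 0"
      by (subst (asm) sum_nonneg_eq_0_iff) (auto intro: nn)
    then show ?thesis using dm by auto
  qed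
  have Hz: "H m \<inter> comp d = {0}" if d: "lo \<le> d" "d \<le> hi" and m: "d < m" for d m
  proof (cases "m \<le> hi + 1")
    case True
    have "(\<Sum>m'=m..hi. ?h d m') = int (dim (H m \<inter> comp d)) - int (dim (H (hi + 1) \<inter> comp d))"
      using sum_telescope_int[OF True, of "\<lambda>m. int (dim (H m \<inter> comp d))"] unfolding hdim_def .
    moreover have "(\<Sum>m'=m..hi. ?h d m') = 0" using hz d m by (intro sum.neutral) auto
    moreover have "H (hi + 1) \<inter> comp d = {0}" using Hhigh[of "hi + 1"] comp_closed(1) by auto
    ultimately show ?thesis by (intro dim_0_imp_trivial[OF HCfin HCsub]) simp
  next
    case False
    then show ?thesis using Hhigh[of m] comp_closed(1) by auto
  qed
  have step: "x \<in> lead_filt d" if x: "x \<in> F m" and d: "lo \<le> d" "d \<le> m" for x d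
    using d
  proof (induction d rule: int_ge_induct)
    case base
    show ?case using lead_filt_low[OF order_refl] x FV by blast
  next
    case (step d)
    have xd: "x \<in> lead_filt d" using step by simp
    have "pr d x = 0"
    proof (cases "d \<le> hi")
      case True
      have "pr d x \<in> pr d ` I m d" using xd x unfolding I_def by blast
      moreover have "pr d ` I m d = {0}" using Hcomp[of m d] Hz[of d m] True step by simp
      ultimately show ?thesis by blast
    qed (simp add: pr_out)
    then show ?case using xd unfolding lead_filt_Suc by simp
  qed
  show ?thesis
  proof (cases "lo \<le> m")
    case True
    then show ?thesis using step[of _ m] unfolding F_def by blast
  next
    case False
    then show ?thesis using lead_filt_low[of m] bij(2) lead_filt_V by simp
  qed
qed

text \<open>
  Here \<open>1 + q\<close> is the inverse of \<open>1 + x\<close>, and \<open>\<phi>\<close> is conjugation by \<open>1 + x\<close>, written without a unit. As \<open>q\<close> is \<open>-x\<close>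
  plus terms of degree below \<open>n\<close>, the component of degree \<open>m + n\<close> of \<open>\<phi> b\<close> is \<open>x b - b x\<close> for \<open>b\<close> of degree \<open>m\<close>.
\<close>

lemma negative_central:
  assumes x: "x \<in> comp n" and n: "n < 0" and a: "a \<in> V"
  shows "x \<star> a = a \<star> x"
proof -
  define S where "S = {a \<in> V. \<forall>d>n. pr d a = 0}"
  have Ssub: "subspace S" unfolding S_def subspace_def by simp
  have mx: "- x \<in> comp n" using x by (rule comp_closed)
  obtain k where k: "pw (- x) k = 0" using homogeneous_nilpotent[OF mx] n by auto
  have pS: "pw (- x) j \<in> S" for j
  proof -
    have c: "pw (- x) j \<in> comp (int (Suc j) * n)" by (rule pw_comp[OF mx])
    have "int (Suc j) * n \<le> 1 * n" using n by (intro mult_right_mono_neg) auto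
    then show ?thesis using comp_V[OF c] unfolding S_def by (auto simp: pr_of_comp[OF c])
  qed
  obtain q where q: "q \<in> S" "q = - x + (- x) \<star> q" "q = - x + q \<star> (- x)"
    by (rule nilpotent_quasi_inverse[OF k Ssub pS])
  have qV: "q \<in> V" using q(1) unfolding S_def by simp
  have xq: "x \<star> q = - x - q" using q(2) by (simp add: algebra_simps)
  have qx: "q \<star> x = - x - q" using q(3) by (simp add: algebra_simps)
  have xqs: "x \<star> (q \<star> s) = - (x \<star> s) - q \<star> s" for s
    using arg_cong[OF xq, of "\<lambda>t. t \<star> s"] by (simp add: mul_assoc mul_diff_left)
  have qxs: "q \<star> (x \<star> s) = - (x \<star> s) - q \<star> s" for s
    using arg_cong[OF qx, of "\<lambda>t. t \<star> s"] by (simp add: mul_assoc mul_diff_left)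
  define \<phi> where "\<phi> a = a + x \<star> a + a \<star> q + x \<star> (a \<star> q)" for a
  have lin: "Vector_Spaces.linear scale scale \<phi>"
    unfolding \<phi>_def by unfold_locales
      (simp_all add: mul_add_left mul_add_right mul_scale_left mul_scale_right scale_right_distrib)
  have inv: "\<phi> a + q \<star> \<phi> a + \<phi> a \<star> x + q \<star> (\<phi> a \<star> x) = a" for a
    unfolding \<phi>_def by (simp add: mul_add_left mul_add_right mul_assoc qx qxs xqs mul_diff_left mul_diff_right)
  have pres: "\<phi> ` lead_filt m \<subseteq> lead_filt m" for m
  proof (rule automorphism_preserves_lead_filt[OF lin])
    show "a = 0" if "\<phi> a = 0" for a using inv[of a] that by simp
    show "\<phi> ` V \<subseteq> V" unfolding \<phi>_def by auto
    show "\<phi> (a \<star> b) = \<phi> a \<star> \<phi> b" for a b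
      unfolding \<phi>_def by (simp add: mul_add_left mul_add_right mul_assoc qx qxs xqs mul_diff_left mul_diff_right)
  qed
  have q0: "pr d q = 0" if "d > n" for d using q(1) that unfolding S_def by simp
  have prq: "pr n q = - x"
    using arg_cong[OF q(2), of "pr n"] q0[of 0] n by (simp add: pr_mul_comp_left[OF x qV] comp_eq[OF x])
  have hom: "x \<star> b = b \<star> x" if b: "b \<in> comp m" for b m
  proof -
    have "\<phi> b \<in> lead_filt m" using pres[of m] comp_lead_filt[OF b order_refl] by blast
    then have "pr (m + n) (\<phi> b) = 0" using n unfolding lead_filt_def by simp
    moreover have "pr (m + n) b = 0" using n by (simp add: pr_of_comp[OF b])
    moreover have "pr (m + n) (x \<star> b) = x \<star> b" using pr_of_comp[OF comp_mul[OF x b], of "m + n"] by simp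
    moreover have "pr (m + n) (b \<star> q) = - (b \<star> x)" using prq by (simp add: pr_mul_comp_left[OF b qV])
    moreover have "pr (m + n) (x \<star> (b \<star> q)) = 0"
      using q0[of 0] n by (simp add: pr_mul_comp_left[OF x] pr_mul_comp_left[OF b qV])
    ultimately show ?thesis unfolding \<phi>_def by simp
  qed
  have "x \<star> (\<Sum>d=lo..hi. pr d a) = (\<Sum>d=lo..hi. pr d a) \<star> x"
    by (simp add: mul_sum_left mul_sum_right hom[OF pr_comp])
  then show ?thesis using pr_sum[OF a] by simp
qed

end

section \<open>Coordinates for module records\<close>

text \<open>
  A record that is identified with a subspace \<open>W\<close> of a vector space given by a type. The axioms of a vector
  space follow by transport, so the locale also serves to show that quotients and \<open>Gr A F\<close> are vector spaces and to compute their dimensions.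
\<close>

locale coordinates = vspace scale for scale :: "'k::field \<Rightarrow> 'v::ab_group_add \<Rightarrow> 'v" (infixr "*s" 75) +
  fixes M :: "('k, 'a) module" (structure) and \<phi> :: "'a \<Rightarrow> 'v" and W :: "'v set"
  assumes W_subspace: "subspace W" and W_findim: "findim W"
    and inj: "inj_on \<phi> (carrier M)" and image: "\<phi> ` carrier M = W"
    and M_zero [simp]: "\<zero> \<in> carrier M"
    and M_add [simp]: "x \<in> carrier M \<Longrightarrow> y \<in> carrier M \<Longrightarrow> x \<oplus> y \<in> carrier M"
    and M_smult [simp]: "x \<in> carrier M \<Longrightarrow> c \<odot> x \<in> carrier M"
    and hom_zero [simp]: "\<phi> \<zero> = 0"
    and hom_add [simp]: "x \<in> carrier M \<Longrightarrow> y \<in> carrier M \<Longrightarrow> \<phi> (x \<oplus> y) = \<phi> x + \<phi> y"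
    and hom_smult [simp]: "x \<in> carrier M \<Longrightarrow> \<phi> (c \<odot> x) = c *s \<phi> x"
begin

lemma eqI: "x \<in> carrier M \<Longrightarrow> y \<in> carrier M \<Longrightarrow> \<phi> x = \<phi> y \<Longrightarrow> x = y"
  using inj by (auto dest: inj_onD)

lemma hom_W: "x \<in> carrier M \<Longrightarrow> \<phi> x \<in> W"
  using image by blast

lemma obtain_preimage:
  assumes "v \<in> W"
  obtains x where "x \<in> carrier M" "\<phi> x = v"
  using assms image by blast

lemma eq_0_iff: "x \<in> carrier M \<Longrightarrow> \<phi> x = 0 \<longleftrightarrow> x = \<zero>"
  using eqI[of x \<zero>] by auto

lemma abelian: "abelian_group M"
proof (rule abelian_groupI)
  fix x assume x: "x \<in> carrier M"
  have "- \<phi> x \<in> W" using subspace_neg[OF W_subspace hom_W[OF x]] .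
  then obtain y where "y \<in> carrier M" "\<phi> y = - \<phi> x" by (rule obtain_preimage)
  then show "\<exists>y\<in>carrier M. y \<oplus> x = \<zero>" using x by (intro bexI[of _ y] eqI) simp_all
qed (auto intro!: eqI simp: add.commute add.assoc)

lemma vectorspace: "vectorspace class_ring M"
proof (rule vectorspace.intro)
  show "field (class_ring :: 'k ring)" by (rule class_field)
  then have "cring (class_ring :: 'k ring)" by (intro domain.axioms(1) field.axioms(1))
  then show "module (class_ring :: 'k ring) M"
    using abelian by (intro Module.moduleI)
      (auto intro!: eqI simp: scale_left_distrib scale_right_distrib)
qed

sublocale M: abelian_group M by (rule abelian)
sublocale M: vectorspace "class_ring :: 'k ring" M by (rule vectorspace)

lemma hom_finsum:
  "(\<And>i. i \<in> I \<Longrightarrow> f i \<in> carrier M) \<Longrightarrow> \<phi> (\<Oplus>i\<in>I. f i) = (\<Sum>i\<in>I. \<phi> (f i))"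
proof (induction I rule: infinite_finite_induct)
  case (insert i I)
  then have "(\<Oplus>i\<in>insert i I. f i) = f i \<oplus> (\<Oplus>i\<in>I. f i)" by (intro M.finsum_insert) auto
  moreover have "(\<Oplus>i\<in>I. f i) \<in> carrier M" by (rule M.finsum_closed) (use insert in auto)
  ultimately show ?case using insert by simp
qed simp_all

lemma hom_uminus: "x \<in> carrier M \<Longrightarrow> \<phi> (\<ominus> x) = - \<phi> x"
proof -
  assume x: "x \<in> carrier M"
  then have "\<phi> (\<ominus> x \<oplus> x) = 0" using M.l_neg by simp
  then show ?thesis using x by (simp add: add_eq_0_iff2 del: M.l_neg)
qed

lemma hom_minus: "x \<in> carrier M \<Longrightarrow> y \<in> carrier M \<Longrightarrow> \<phi> (x \<ominus> y) = \<phi> x - \<phi> y"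
  unfolding a_minus_def by (simp add: hom_uminus)

lemma hom_lincomb:
  assumes "S \<subseteq> carrier M"
  shows "\<phi> (M.lincomb a S) = (\<Sum>s\<in>S. a s *s \<phi> s)"
  unfolding M.lincomb_def using assms by (subst hom_finsum) (auto intro!: sum.cong)

lemma basis_preimage:
  obtains B where "finite B" "M.basis B" "card B = dim W"
proof -
  obtain C where C: "finite C" "independent C" "C \<subseteq> W" "span C = W" "card C = dim W"
    by (rule findim_basis[OF W_findim W_subspace])
  define g where "g = the_inv_into (carrier M) \<phi>"
  have g: "g v \<in> carrier M" "\<phi> (g v) = v" if "v \<in> W" for v
    using that image inj unfolding g_def
    by (auto intro: the_inv_into_into[OF inj] f_the_inv_into_f[OF inj])
  have ginj: "inj_on g C" using g(2) C(3) by (metis inj_on_def subsetD)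
  have gB: "g ` C \<subseteq> carrier M" using g(1) C(3) by blast
  have ind: "\<not> M.lin_dep (g ` C)"
  proof
    assume "M.lin_dep (g ` C)"
    then obtain A a v where A: "finite A" "A \<subseteq> g ` C" "M.lincomb a A = \<zero>" "v \<in> A" "a v \<noteq> 0"
      unfolding M.lin_dep_def by auto
    have AM: "A \<subseteq> carrier M" using A(2) gB by blast
    have "(\<Sum>s\<in>A. a s *s \<phi> s) = 0" using hom_lincomb[OF AM, of a] A(3) by simp
    also have "(\<Sum>s\<in>A. a s *s \<phi> s) = (\<Sum>c\<in>\<phi> ` A. a (g c) *s c)"
    proof (subst sum.reindex)
      show "inj_on \<phi> A" using inj AM inj_on_subset by blast
      have "g (\<phi> s) = s" if "s \<in> A" for s using that AM unfolding g_def by (auto intro: the_inv_into_f_f[OF inj])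
      then show "(\<Sum>s\<in>A. a s *s \<phi> s) = sum ((\<lambda>c. a (g c) *s c) \<circ> \<phi>) A" by (intro sum.cong) auto
    qed
    finally have "(\<Sum>c\<in>\<phi> ` A. a (g c) *s c) = 0" .
    moreover have "\<phi> ` A \<subseteq> C" using A(2) g(2) C(3) by fastforce
    moreover have "g (\<phi> v) = v" using A(4) AM unfolding g_def by (auto intro: the_inv_into_f_f[OF inj])
    ultimately show False using independentD[OF C(2), of "\<phi> ` A" "\<lambda>c. a (g c)" "\<phi> v"] A(1,4,5) by auto
  qed
  have gen: "M.gen_set (g ` C)"
  proof
    show "M.span (g ` C) \<subseteq> carrier M" using M.span_is_subset2[OF gB] .
    show "carrier M \<subseteq> M.span (g ` C)"
    proof
      fix x assume x: "x \<in> carrier M"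
      have "\<phi> x \<in> span C" using hom_W[OF x] C(4) by simp
      then obtain u where u: "\<phi> x = (\<Sum>c\<in>C. u c *s c)" using span_finite[OF C(1)] by auto
      have "\<phi> (M.lincomb (\<lambda>s. u (\<phi> s)) (g ` C)) = (\<Sum>c\<in>C. u c *s c)"
        unfolding hom_lincomb[OF gB] using C(3) g(2) by (subst sum.reindex[OF ginj]) (auto intro!: sum.cong)
      moreover have "M.lincomb (\<lambda>s. u (\<phi> s)) (g ` C) \<in> carrier M" by (rule M.lincomb_closed[OF gB]) simp
      ultimately have "x = M.lincomb (\<lambda>s. u (\<phi> s)) (g ` C)" using eqI[OF x] u by simp
      then show "x \<in> M.span (g ` C)" unfolding M.span_def using C(1) by auto
    qed
  qed
  show thesis using that[of "g ` C"] C(1,5) ind gen gB ginj unfolding M.basis_def by (simp add: card_image)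
qed

lemma dim_eq: "M.dim = dim W"
proof -
  obtain B where "finite B" "M.basis B" "card B = dim W" by (rule basis_preimage)
  then show ?thesis using M.dim_basis by simp
qed

lemma fin_dim: "M.fin_dim"
proof -
  obtain B where "finite B" "M.basis B" "card B = dim W" by (rule basis_preimage)
  then show ?thesis unfolding M.fin_dim_def M.basis_def by blast
qed

lemma subspace_iff:
  "VectorSpace.subspace class_ring N M \<longleftrightarrow> N \<subseteq> carrier M \<and> subspace (\<phi> ` N)"
proof
  assume "VectorSpace.subspace class_ring N M"
  then have N: "submodule class_ring N M" unfolding VectorSpace.subspace_def by simp
  have NM: "N \<subseteq> carrier M" using submodule.subset[OF N] .
  have "subspace (\<phi> ` N)" unfolding subspace_def
  proof (intro conjI ballI allI)
    show "0 \<in> \<phi> ` N" using submodule.zero_closed[OF N] hom_zero by (metis imageI)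
  next
    fix x y assume "x \<in> \<phi> ` N" "y \<in> \<phi> ` N"
    then obtain a b where ab: "a \<in> N" "b \<in> N" "x = \<phi> a" "y = \<phi> b" by blast
    then have "x + y = \<phi> (a \<oplus> b)" using NM by (simp add: subset_iff)
    then show "x + y \<in> \<phi> ` N" using submodule.m_closed[OF N ab(1,2)] by simp
  next
    fix c x assume "x \<in> \<phi> ` N"
    then obtain a where a: "a \<in> N" "x = \<phi> a" by blast
    then have "c *s x = \<phi> (c \<odot> a)" using NM by (simp add: subset_iff)
    then show "c *s x \<in> \<phi> ` N" using submodule.smult_closed[OF N _ a(1), of c] by simp
  qed
  then show "N \<subseteq> carrier M \<and> subspace (\<phi> ` N)" using NM by simp
next
  assume "N \<subseteq> carrier M \<and> subspace (\<phi> ` N)"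
  then have NM: "N \<subseteq> carrier M" and S: "subspace (\<phi> ` N)" by auto
  have mem: "x \<in> N" if "x \<in> carrier M" "\<phi> x \<in> \<phi> ` N" for x
    using that NM eqI by (metis imageE subsetD)
  have "submodule class_ring N M"
  proof (rule submodule.intro)
    show "module class_ring M" by (rule vectorspace.axioms(1)[OF vectorspace])
    show "N \<subseteq> carrier M" by (rule NM)
    show "\<zero> \<in> N" by (rule mem) (simp_all add: subspace_0[OF S])
    show "v \<oplus> w \<in> N" if "v \<in> N" "w \<in> N" for v w
      using subspace_add[OF S imageI[OF that(1)] imageI[OF that(2)]] subsetD[OF NM that(1)] subsetD[OF NM that(2)]
      by (intro mem) simp_all
    show "c \<odot> v \<in> N" if "v \<in> N" for c v
      using subspace_scale[OF S imageI[OF that], of c] subsetD[OF NM that] by (intro mem) simp_all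
  qed
  then show "VectorSpace.subspace class_ring N M" unfolding VectorSpace.subspace_def using vectorspace by simp
qed

lemma mem_iff: "N \<subseteq> carrier M \<Longrightarrow> x \<in> carrier M \<Longrightarrow> \<phi> x \<in> \<phi> ` N \<longleftrightarrow> x \<in> N"
  using inj by (auto dest: inj_onD)

text \<open>
  Cosets are handled through coordinates from here on: membership becomes a statement about differences.
\<close>

lemma coset_mem:
  assumes N: "VectorSpace.subspace class_ring N M" and x: "x \<in> carrier M"
  shows "z \<in> N +>\<^bsub>M\<^esub> x \<longleftrightarrow> z \<in> carrier M \<and> \<phi> z - \<phi> x \<in> \<phi> ` N"
proof
  have NM: "N \<subseteq> carrier M" using N subspace_iff by blast
  show "z \<in> carrier M \<and> \<phi> z - \<phi> x \<in> \<phi> ` N" if "z \<in> N +>\<^bsub>M\<^esub> x"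
  proof -
    obtain h where "h \<in> N" "z = h \<oplus> x" using \<open>z \<in> N +>\<^bsub>M\<^esub> x\<close> unfolding a_r_coset_def r_coset_def by auto
    then show ?thesis using NM x by auto
  qed
  show "z \<in> N +>\<^bsub>M\<^esub> x" if z: "z \<in> carrier M \<and> \<phi> z - \<phi> x \<in> \<phi> ` N"
  proof -
    obtain h where h: "h \<in> N" "\<phi> z - \<phi> x = \<phi> h" using z by auto
    then have "\<phi> z = \<phi> (h \<oplus> x)" using NM x by (simp add: subset_iff) (simp add: algebra_simps)
    then have "z = h \<oplus> x" using NM x z h(1) by (intro eqI) auto
    then show ?thesis using h(1) unfolding a_r_coset_def r_coset_def by auto
  qed
qed

lemma coset_eq_iff:
  assumes N: "VectorSpace.subspace class_ring N M" and x: "x \<in> carrier M" and y: "y \<in> carrier M"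
  shows "N +>\<^bsub>M\<^esub> x = N +>\<^bsub>M\<^esub> y \<longleftrightarrow> \<phi> x - \<phi> y \<in> \<phi> ` N"
proof
  have S: "subspace (\<phi> ` N)" using N subspace_iff by blast
  show "\<phi> x - \<phi> y \<in> \<phi> ` N" if "N +>\<^bsub>M\<^esub> x = N +>\<^bsub>M\<^esub> y"
  proof -
    have "x \<in> N +>\<^bsub>M\<^esub> x" using coset_mem[OF N x] x subspace_0[OF S] by simp
    then show ?thesis using that coset_mem[OF N y] by simp
  qed
  show "N +>\<^bsub>M\<^esub> x = N +>\<^bsub>M\<^esub> y" if xy: "\<phi> x - \<phi> y \<in> \<phi> ` N"
  proof (rule Set.set_eqI)
    fix z
    have "\<phi> z - \<phi> x \<in> \<phi> ` N \<longleftrightarrow> \<phi> z - \<phi> y \<in> \<phi> ` N"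
      using subspace_add[OF S _ xy, of "\<phi> z - \<phi> x"] subspace_diff[OF S _ xy, of "\<phi> z - \<phi> y"] by auto
    then show "z \<in> N +>\<^bsub>M\<^esub> x \<longleftrightarrow> z \<in> N +>\<^bsub>M\<^esub> y" using coset_mem[OF N x] coset_mem[OF N y] by simp
  qed
qed

lemma zero_coset:
  assumes N: "VectorSpace.subspace class_ring N M"
  shows "N +>\<^bsub>M\<^esub> \<zero> = N"
proof (rule Set.set_eqI)
  fix z
  have NM: "N \<subseteq> carrier M" using N subspace_iff by blast
  show "z \<in> N +>\<^bsub>M\<^esub> \<zero> \<longleftrightarrow> z \<in> N" unfolding coset_mem[OF N M_zero] using mem_iff[OF NM, of z] NM by auto
qed

lemma coset_add:
  assumes N: "VectorSpace.subspace class_ring N M" and x: "x \<in> carrier M" and y: "y \<in> carrier M"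
  shows "(N +>\<^bsub>M\<^esub> x) <+>\<^bsub>M\<^esub> (N +>\<^bsub>M\<^esub> y) = N +>\<^bsub>M\<^esub> (x \<oplus> y)"
proof (rule Set.set_eqI)
  fix z
  have S: "subspace (\<phi> ` N)" using N subspace_iff by blast
  have "z \<in> (N +>\<^bsub>M\<^esub> x) <+>\<^bsub>M\<^esub> (N +>\<^bsub>M\<^esub> y) \<longleftrightarrow> (\<exists>a\<in>N +>\<^bsub>M\<^esub> x. \<exists>b\<in>N +>\<^bsub>M\<^esub> y. z = a \<oplus> b)"
    unfolding set_add_def set_mult_def by auto
  also have "\<dots> \<longleftrightarrow> z \<in> N +>\<^bsub>M\<^esub> (x \<oplus> y)"
  proof
    assume "\<exists>a\<in>N +>\<^bsub>M\<^esub> x. \<exists>b\<in>N +>\<^bsub>M\<^esub> y. z = a \<oplus> b"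
    then obtain a b where a: "a \<in> N +>\<^bsub>M\<^esub> x" and b: "b \<in> N +>\<^bsub>M\<^esub> y" and z: "z = a \<oplus> b"
      by (elim bexE)
    have ab: "a \<in> carrier M" "\<phi> a - \<phi> x \<in> \<phi> ` N" "b \<in> carrier M" "\<phi> b - \<phi> y \<in> \<phi> ` N" "z = a \<oplus> b"
      using a b z coset_mem[OF N x, of a] coset_mem[OF N y, of b] by simp_all
    have "\<phi> z - \<phi> (x \<oplus> y) = (\<phi> a - \<phi> x) + (\<phi> b - \<phi> y)" using ab x y by simp
    then have "\<phi> z - \<phi> (x \<oplus> y) \<in> \<phi> ` N" using subspace_add[OF S ab(2,4)] by (simp only:)
    moreover have "z \<in> carrier M" using ab(1,3,5) by simp
    ultimately show "z \<in> N +>\<^bsub>M\<^esub> (x \<oplus> y)" unfolding coset_mem[OF N M_add[OF x y]] by simp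
  next
    assume "z \<in> N +>\<^bsub>M\<^esub> (x \<oplus> y)"
    then have z: "z \<in> carrier M" "\<phi> z - \<phi> (x \<oplus> y) \<in> \<phi> ` N" unfolding coset_mem[OF N M_add[OF x y]] by auto
    have "z = x \<oplus> (z \<ominus> x)" using z x by (intro eqI) (simp_all add: hom_minus)
    moreover have "x \<in> N +>\<^bsub>M\<^esub> x" using coset_mem[OF N x] x subspace_0[OF S] by simp
    moreover have "z \<ominus> x \<in> N +>\<^bsub>M\<^esub> y" using coset_mem[OF N y] z x y by (simp add: hom_minus diff_diff_eq)
    ultimately show "\<exists>a\<in>N +>\<^bsub>M\<^esub> x. \<exists>b\<in>N +>\<^bsub>M\<^esub> y. z = a \<oplus> b" by (intro bexI)
  qed
  finally show "z \<in> (N +>\<^bsub>M\<^esub> x) <+>\<^bsub>M\<^esub> (N +>\<^bsub>M\<^esub> y) \<longleftrightarrow> z \<in> N +>\<^bsub>M\<^esub> (x \<oplus> y)" .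
qed

lemma coset_smult:
  assumes N: "VectorSpace.subspace class_ring N M" and x: "x \<in> carrier M"
  shows "(\<Union>z\<in>N +>\<^bsub>M\<^esub> x. N +>\<^bsub>M\<^esub> (c \<odot> z)) = N +>\<^bsub>M\<^esub> (c \<odot> x)"
proof -
  have S: "subspace (\<phi> ` N)" using N subspace_iff by blast
  have "N +>\<^bsub>M\<^esub> (c \<odot> z) = N +>\<^bsub>M\<^esub> (c \<odot> x)" if "z \<in> N +>\<^bsub>M\<^esub> x" for z
  proof -
    have z: "z \<in> carrier M" "\<phi> z - \<phi> x \<in> \<phi> ` N" using that coset_mem[OF N x] by auto
    have "\<phi> (c \<odot> z) - \<phi> (c \<odot> x) = c *s (\<phi> z - \<phi> x)" using z x by (simp add: scale_right_diff_distrib)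
    then show ?thesis using coset_eq_iff[OF N M_smult M_smult] z x subspace_scale[OF S z(2)] by simp
  qed
  moreover have "x \<in> N +>\<^bsub>M\<^esub> x" using coset_mem[OF N x] x subspace_0[OF S] by simp
  ultimately show ?thesis by blast
qed

end

context vspace
begin

text \<open>
  Supplies the map that makes a quotient space a subspace: \<open>T\<close> modulo \<open>S\<close> is the image of \<open>T\<close> under \<open>p\<close>.
\<close>

lemma linear_with_kernel:
  assumes T: "findim T" "subspace T" and S: "subspace S" "S \<subseteq> T"
  obtains p where "Vector_Spaces.linear scale scale p" "\<And>x. x \<in> T \<Longrightarrow> p x = 0 \<longleftrightarrow> x \<in> S"
proof -
  obtain B where B: "finite B" "independent B" "B \<subseteq> S" "span B = S" "card B = dim S"
    by (rule findim_basis[OF findim_subset[OF T(1) S(2)] S(1)])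
  have BT: "B \<subseteq> T" using B(3) S(2) by blast
  obtain C where C: "finite C" "independent C" "B \<subseteq> C" "C \<subseteq> T" "span C = T" "card C = dim T"
    by (rule findim_basis_extend[OF T BT B(2) BT order_refl span_superset])
  interpret vp: vector_space_pair scale scale ..
  define f where "f b = (if b \<in> B then 0 else b)" for b
  obtain p where p: "Vector_Spaces.linear scale scale p" "\<forall>x\<in>C. p x = f x"
    using vp.linear_independent_extend[OF C(2), of f] by blast
  interpret p: Vector_Spaces.linear scale scale p by (rule p(1))
  have sub: "subspace {x \<in> T. p x = 0}"
    using T(2) unfolding subspace_def by (auto simp: p.zero p.add p.scale)
  have SK: "S \<subseteq> {x \<in> T. p x = 0}"
    unfolding B(4)[symmetric] by (rule span_minimal[OF _ sub]) (use p(2) C(3) BT in \<open>auto simp: f_def\<close>)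
  have "p ` T = span (p ` C)" unfolding C(5)[symmetric] by (rule p.span_image[symmetric])
  moreover have "C - B \<subseteq> p ` C"
  proof
    fix x assume x: "x \<in> C - B"
    then have "p x = x" using p(2) unfolding f_def by auto
    then show "x \<in> p ` C" using x by (metis DiffD1 imageI)
  qed
  ultimately have "C - B \<subseteq> p ` T" using span_superset by blast
  then have "span (C - B) \<subseteq> p ` T" by (rule span_minimal[OF _ subspace_linear_image[OF p(1) T(2)]])
  then have "dim (span (C - B)) \<le> dim (p ` T)"
    by (intro dim_mono_findim findim_linear_image[OF p(1) T(1)] subspace_linear_image[OF p(1) T(2)] subspace_span)
  moreover have "dim (span (C - B)) = dim T - dim S"
    using dim_span_eq_card_independent[OF independent_mono[OF C(2)], of "C - B"] B(1,5) C(3,6)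
    by (simp add: card_Diff_subset)
  moreover have "dim S \<le> dim T" by (rule dim_mono_findim[OF T S])
  ultimately have "dim {x \<in> T. p x = 0} \<le> dim S" using rank_nullity[OF p(1) T(2,1)] by linarith
  then have "S = {x \<in> T. p x = 0}"
    by (intro dim_eq_imp_eq[OF _ sub S(1) SK] findim_subset[OF T(1)]) auto
  then show thesis using that[OF p(1)] by blast
qed

end

context coordinates
begin

context
  fixes U N :: "'a set" and p :: "'v \<Rightarrow> 'v"
  assumes U: "VectorSpace.subspace class_ring U M" and N: "VectorSpace.subspace class_ring N M" and NU: "N \<subseteq> U"
    and p: "Vector_Spaces.linear scale scale p" "\<And>x. x \<in> \<phi> ` U \<Longrightarrow> p x = 0 \<longleftrightarrow> x \<in> \<phi> ` N"
begin

lemma quotient_value: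
  assumes x: "x \<in> U"
  shows "p (\<phi> (SOME z. z \<in> N +>\<^bsub>M\<^esub> x)) = p (\<phi> x)"
proof -
  interpret p: Vector_Spaces.linear scale scale p by (rule p(1))
  have xM: "x \<in> carrier M" and NS: "subspace (\<phi> ` N)" using x U N subspace_iff by auto
  have "x \<in> N +>\<^bsub>M\<^esub> x" using coset_mem[OF N xM] xM subspace_0[OF NS] by simp
  then have "(SOME z. z \<in> N +>\<^bsub>M\<^esub> x) \<in> N +>\<^bsub>M\<^esub> x" by (rule someI)
  then have "\<phi> (SOME z. z \<in> N +>\<^bsub>M\<^esub> x) - \<phi> x \<in> \<phi> ` N" using coset_mem[OF N xM] by simp
  then have "p (\<phi> (SOME z. z \<in> N +>\<^bsub>M\<^esub> x) - \<phi> x) = 0" using p(2) NU by blast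
  then show ?thesis by (simp add: p.diff)
qed

lemma quotient_coordinates:
  "coordinates scale (quotient_space M U N) (\<lambda>X. p (\<phi> (SOME x. x \<in> X))) (p ` \<phi> ` U)"
proof -
  let ?Q = "quotient_space M U N" and ?f = "\<lambda>X. p (\<phi> (SOME x. x \<in> X))"
  have UM: "U \<subseteq> carrier M" and US: "subspace (\<phi> ` U)" using U subspace_iff by auto
  have Um: "submodule class_ring U M" using U unfolding VectorSpace.subspace_def by simp
  have UW: "\<phi> ` U \<subseteq> W" using UM image by blast
  have Ufin: "findim (\<phi> ` U)" by (rule findim_subset[OF W_findim UW])
  interpret p: Vector_Spaces.linear scale scale p by (rule p(1))
  note f = quotient_value
  have carr: "x \<in> U \<Longrightarrow> x \<in> carrier M" for x using UM by blast
  have cQ: "carrier ?Q = (\<lambda>x. N +>\<^bsub>M\<^esub> x) ` U" unfolding quotient_space_def by simp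
  have aQ: "(N +>\<^bsub>M\<^esub> x) \<oplus>\<^bsub>?Q\<^esub> (N +>\<^bsub>M\<^esub> y) = N +>\<^bsub>M\<^esub> (x \<oplus> y)" if "x \<in> U" "y \<in> U" for x y
    unfolding quotient_space_def using coset_add[OF N carr carr] that by simp
  have sQ: "c \<odot>\<^bsub>?Q\<^esub> (N +>\<^bsub>M\<^esub> x) = N +>\<^bsub>M\<^esub> (c \<odot> x)" if "x \<in> U" for x c
    unfolding quotient_space_def using coset_smult[OF N carr] that by simp
  have zQ: "\<zero>\<^bsub>?Q\<^esub> = N +>\<^bsub>M\<^esub> \<zero>" unfolding quotient_space_def zero_coset[OF N] by simp
  have z: "\<zero> \<in> U" using submodule.zero_closed[OF Um] .
  have cl: "x \<oplus> y \<in> U" if "x \<in> U" "y \<in> U" for x y using submodule.m_closed[OF Um that] .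
  have cs: "c \<odot> x \<in> U" if "x \<in> U" for x c using submodule.smult_closed[OF Um _ that, of c] by simp
  show ?thesis
  proof (unfold_locales)
    show "subspace (p ` \<phi> ` U)" by (rule subspace_linear_image[OF p(1) US])
    show "findim (p ` \<phi> ` U)" by (rule findim_linear_image[OF p(1) Ufin])
    show "inj_on ?f (carrier ?Q)"
    proof (rule inj_onI)
      fix X Y assume "X \<in> carrier ?Q" "Y \<in> carrier ?Q" and eq: "?f X = ?f Y"
      then obtain x y where xy: "x \<in> U" "y \<in> U" "X = N +>\<^bsub>M\<^esub> x" "Y = N +>\<^bsub>M\<^esub> y" unfolding cQ by blast
      have "p (\<phi> x - \<phi> y) = 0" using eq f xy by (simp add: p.diff)
      moreover have "\<phi> x - \<phi> y \<in> \<phi> ` U" using subspace_diff[OF US] xy by blast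
      ultimately have "\<phi> x - \<phi> y \<in> \<phi> ` N" using p(2) by blast
      then show "X = Y" using coset_eq_iff[OF N carr carr] xy by simp
    qed
    show "?f ` carrier ?Q = p ` \<phi> ` U" unfolding cQ image_image using f by (intro image_cong) auto
    show "\<zero>\<^bsub>?Q\<^esub> \<in> carrier ?Q" unfolding cQ zQ using z by blast
    show "?f \<zero>\<^bsub>?Q\<^esub> = 0" unfolding zQ f[OF z] by (simp add: p.zero)
    fix X assume "X \<in> carrier ?Q"
    then obtain x where x: "x \<in> U" "X = N +>\<^bsub>M\<^esub> x" unfolding cQ by blast
    show "c \<odot>\<^bsub>?Q\<^esub> X \<in> carrier ?Q" for c unfolding x(2) sQ[OF x(1)] cQ using cs x(1) by blast
    show "?f (c \<odot>\<^bsub>?Q\<^esub> X) = c *s ?f X" for c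
      unfolding x(2) sQ[OF x(1)] f[OF x(1)] f[OF cs[OF x(1)]] using carr[OF x(1)] by (simp add: p.scale)
    fix Y assume "Y \<in> carrier ?Q"
    then obtain y where y: "y \<in> U" "Y = N +>\<^bsub>M\<^esub> y" unfolding cQ by blast
    show "X \<oplus>\<^bsub>?Q\<^esub> Y \<in> carrier ?Q" unfolding x(2) y(2) aQ[OF x(1) y(1)] cQ using cl x(1) y(1) by blast
    show "?f (X \<oplus>\<^bsub>?Q\<^esub> Y) = ?f X + ?f Y"
      unfolding x(2) y(2) aQ[OF x(1) y(1)] f[OF x(1)] f[OF y(1)] f[OF cl[OF x(1) y(1)]]
      using carr[OF x(1)] carr[OF y(1)] by (simp add: p.add)
  qed
qed

end

lemma quotient_dim:
  assumes U: "VectorSpace.subspace class_ring U M" and N: "VectorSpace.subspace class_ring N M" and NU: "N \<subseteq> U"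
  shows "int (vectorspace.dim class_ring (quotient_space M U N)) = int (dim (\<phi> ` U)) - int (dim (\<phi> ` N))"
proof -
  have US: "subspace (\<phi> ` U)" and NS: "subspace (\<phi> ` N)" and UW: "\<phi> ` U \<subseteq> W" using U N subspace_iff image by auto
  have Ufin: "findim (\<phi> ` U)" by (rule findim_subset[OF W_findim UW])
  obtain p where p: "Vector_Spaces.linear scale scale p" "\<And>x. x \<in> \<phi> ` U \<Longrightarrow> p x = 0 \<longleftrightarrow> x \<in> \<phi> ` N"
    by (rule linear_with_kernel[OF Ufin US NS]) (use NU in auto)
  interpret Q: coordinates scale "quotient_space M U N" "\<lambda>X. p (\<phi> (SOME x. x \<in> X))" "p ` \<phi> ` U"
    by (rule quotient_coordinates[OF U N NU p])
  have "{x \<in> \<phi> ` U. p x = 0} = \<phi> ` N" using p(2) NU by blast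
  then show ?thesis using Q.dim_eq rank_nullity[OF p(1) US Ufin] by simp
qed

end

context coordinates
begin

lemma finsum_in_carrier: "(\<And>i. i \<in> I \<Longrightarrow> f i \<in> carrier M) \<Longrightarrow> (\<Oplus>i\<in>I. f i) \<in> carrier M"
  by (rule abelian_monoid.finsum_closed[OF abelian_group.axioms(1)[OF abelian]]) auto

lemma filtration_subspace: "filtration M K \<Longrightarrow> VectorSpace.subspace class_ring (K i) M"
  and filtration_antimono: "filtration M K \<Longrightarrow> i \<le> j \<Longrightarrow> K j \<subseteq> K i"
  unfolding filtration_def by blast+

lemma filtration_carrier: "filtration M K \<Longrightarrow> K i \<subseteq> carrier M"
  using filtration_subspace subspace_iff by blast

lemma gr_dim_eq:
  "filtration M K \<Longrightarrow> int (gr_dim M K m) = int (dim (\<phi> ` K m)) - int (dim (\<phi> ` K (m + 1)))"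
  unfolding gr_dim_def gr_piece_def
  by (intro quotient_dim filtration_subspace filtration_antimono) simp_all

text \<open>
  Sums over the weights become sums over any interval that contains them, which allows reindexing.
\<close>

lemma sum_weights:
  fixes g :: "int \<Rightarrow> int"
  assumes K: "filtration M K" and low: "\<And>m. m \<le> a \<Longrightarrow> K m = carrier M" and high: "\<And>m. b < m \<Longrightarrow> K m = {\<zero>}"
  shows "(\<Sum>m\<in>weights K. g m * int (gr_dim M K m))
     = (\<Sum>m=a..b. g m * (int (dim (\<phi> ` K m)) - int (dim (\<phi> ` K (m + 1)))))"
proof -
  have "(\<Sum>m\<in>weights K. g m * int (gr_dim M K m)) = (\<Sum>m=a..b. g m * int (gr_dim M K m))"
  proof (rule sum.mono_neutral_left)
    show "weights K \<subseteq> {a..b}"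
    proof
      fix m assume m: "m \<in> weights K"
      show "m \<in> {a..b}"
      proof (rule ccontr)
        assume "m \<notin> {a..b}"
        then have "m + 1 \<le> a \<or> b < m" by auto
        then have "K m = K (m + 1)"
        proof
          assume le: "m + 1 \<le> a"
          then have "m \<le> a" by simp
          then show ?thesis using low[OF le] by (simp only: low)
        next
          assume less: "b < m"
          then have "b < m + 1" by simp
          then show ?thesis using high[OF less] by (simp only: high)
        qed
        then show False using m unfolding weights_def by simp
      qed
    qed
    show "\<forall>m\<in>{a..b} - weights K. g m * int (gr_dim M K m) = 0"
      unfolding gr_dim_eq[OF K] weights_def by simp
  qed simp
  then show ?thesis unfolding gr_dim_eq[OF K] .
qed

lemma filtration_norm_eq:
  assumes K: "filtration M K" and low: "\<And>m. m \<le> a \<Longrightarrow> K m = carrier M" and high: "\<And>m. b < m \<Longrightarrow> K m = {\<zero>}"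
  shows "filtration_norm M K
     = sqrt (real_of_int (\<Sum>m=a..b. m * m * (int (dim (\<phi> ` K m)) - int (dim (\<phi> ` K (m + 1))))))"
proof -
  have "(\<Sum>m\<in>weights K. (real_of_int m)\<^sup>2 * real (gr_dim M K m)) = real_of_int (\<Sum>m\<in>weights K. m * m * int (gr_dim M K m))"
    by (simp add: power2_eq_square)
  then show ?thesis unfolding filtration_norm_def using sum_weights[OF assms, where g = "\<lambda>m. m * m"] by simp
qed

lemma wt_trivial: "wt M (trivial_filtration M) = 0"
proof -
  have "weights (trivial_filtration M) \<subseteq> {0}"
    unfolding weights_def trivial_filtration_def by auto
  then show ?thesis unfolding wt_def by (intro sum.neutral) auto
qed

end

section \<open>Perturbing a minimal filtration\<close>

locale algebra_coordinates = coordinates scale A \<phi> V + alg: fin_dim_algebra A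
  for scale :: "'k::field \<Rightarrow> 'v::ab_group_add \<Rightarrow> 'v" (infixr "*s" 75)
    and A :: "('k, 'a) module" (structure) and \<phi> :: "'a \<Rightarrow> 'v" and V :: "'v set"
begin

definition lift :: "'v \<Rightarrow> 'a" where
  "lift = the_inv_into (carrier A) \<phi>"

lemma lift: "v \<in> V \<Longrightarrow> lift v \<in> carrier A" "v \<in> V \<Longrightarrow> \<phi> (lift v) = v"
  unfolding lift_def using the_inv_into_into[OF inj, of v] f_the_inv_into_f[OF inj, of v] by (simp_all add: image)

lemma lift_hom: "x \<in> carrier A \<Longrightarrow> lift (\<phi> x) = x"
  unfolding lift_def by (rule the_inv_into_f_f[OF inj])

lemma lift_add: "v \<in> V \<Longrightarrow> w \<in> V \<Longrightarrow> lift (v + w) = lift v \<oplus> lift w"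
  by (rule eqI) (simp_all add: lift subspace_add[OF W_subspace])

lemma lift_scale: "v \<in> V \<Longrightarrow> lift (c *s v) = c \<odot> lift v"
  by (rule eqI) (simp_all add: lift subspace_scale[OF W_subspace])

text \<open>
  The multiplication of the record, in coordinates.
\<close>

definition mu :: "'v \<Rightarrow> 'v \<Rightarrow> 'v" where
  "mu v w = \<phi> (lift v \<otimes> lift w)"

lemma mu_add_left: "u \<in> V \<Longrightarrow> v \<in> V \<Longrightarrow> w \<in> V \<Longrightarrow> mu (u + v) w = mu u w + mu v w"
  unfolding mu_def by (simp add: lift_add lift alg.mult_add_left alg.mult_closed)

lemma mu_add_right: "u \<in> V \<Longrightarrow> v \<in> V \<Longrightarrow> w \<in> V \<Longrightarrow> mu u (v + w) = mu u v + mu u w"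
  unfolding mu_def by (simp add: lift_add lift alg.mult_add_right alg.mult_closed)

lemma mu_scale_left: "v \<in> V \<Longrightarrow> w \<in> V \<Longrightarrow> mu (c *s v) w = c *s mu v w"
  unfolding mu_def by (simp add: lift_scale lift alg.smult_mult_left alg.mult_closed)

lemma mu_scale_right: "v \<in> V \<Longrightarrow> w \<in> V \<Longrightarrow> mu v (c *s w) = c *s mu v w"
  unfolding mu_def by (simp add: lift_scale lift alg.smult_mult_right alg.mult_closed)

lemma mu_assoc: "u \<in> V \<Longrightarrow> v \<in> V \<Longrightarrow> w \<in> V \<Longrightarrow> mu (mu u v) w = mu u (mu v w)"
  unfolding mu_def by (simp add: lift_hom lift alg.mult_closed alg.mult_assoc)

lemma V0: "0 \<in> V"
  by (rule subspace_0[OF W_subspace])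

lemma mu_0: "v \<in> V \<Longrightarrow> mu 0 v = 0" "v \<in> V \<Longrightarrow> mu v 0 = 0"
  using mu_scale_left[OF V0, of v 0] mu_scale_right[OF _ V0, of v 0] by simp_all

lemma mu_sum: "(\<And>i. i \<in> I \<Longrightarrow> f i \<in> V) \<Longrightarrow> (\<And>j. j \<in> J \<Longrightarrow> g j \<in> V) \<Longrightarrow>
  mu (\<Sum>i\<in>I. f i) (\<Sum>j\<in>J. g j) = (\<Sum>i\<in>I. \<Sum>j\<in>J. mu (f i) (g j))"
proof -
  assume f: "\<And>i. i \<in> I \<Longrightarrow> f i \<in> V" and g: "\<And>j. j \<in> J \<Longrightarrow> g j \<in> V"
  have R: "mu v (\<Sum>j\<in>J. g j) = (\<Sum>j\<in>J. mu v (g j))" if v: "v \<in> V" for v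
    using g
  proof (induction J rule: infinite_finite_induct)
    case (insert j J)
    then have "(\<Sum>j\<in>J. g j) \<in> V" by (intro subspace_sum[OF W_subspace]) auto
    then show ?case using insert by (simp add: mu_add_right v)
  qed (simp_all add: mu_0 v)
  have gV: "(\<Sum>j\<in>J. g j) \<in> V" by (rule subspace_sum[OF W_subspace g])
  show ?thesis
    using f
  proof (induction I rule: infinite_finite_induct)
    case (insert i I)
    then have "(\<Sum>i\<in>I. f i) \<in> V" by (intro subspace_sum[OF W_subspace]) auto
    then show ?case using insert by (simp add: mu_add_left gV R[of "f i"])
  qed (simp_all add: mu_0 gV)
qed

lemma mu_hom: "x \<in> carrier A \<Longrightarrow> y \<in> carrier A \<Longrightarrow> mu (\<phi> x) (\<phi> y) = \<phi> (x \<otimes> y)"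
  unfolding mu_def by (simp add: lift_hom)

end

text \<open>
  \<open>V\<close> carries two multiplications: \<open>mu\<close> is that of \<open>A\<close>, and \<open>\<star>\<close> is that of the associated graded algebra of \<open>F\<close>,
  with which \<open>mu\<close> agrees up to terms of higher degree.
\<close>

locale graded_model = graded_alg scale V mul pr lo hi + algebra_coordinates scale A \<phi> V
  for scale :: "'k::field \<Rightarrow> 'v::ab_group_add \<Rightarrow> 'v" (infixr "*s" 75)
    and V :: "'v set" and mul :: "'v \<Rightarrow> 'v \<Rightarrow> 'v" (infixl "\<star>" 70)
    and pr :: "int \<Rightarrow> 'v \<Rightarrow> 'v" and lo hi :: int
    and A :: "('k, 'a) module" (structure) and \<phi> :: "'a \<Rightarrow> 'v" +
  fixes F :: "int \<Rightarrow> 'a set"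
  assumes F_filtration: "filtration A F"
    and F_lead: "\<phi> ` F m = lead_filt m"
    and gr_mul: "v \<in> comp d \<Longrightarrow> w \<in> comp e \<Longrightarrow> mu v w - v \<star> w \<in> lead_filt (d + e + 1)"
begin

lemma F_low: "m \<le> lo \<Longrightarrow> F m = carrier A"
proof -
  assume m: "m \<le> lo"
  have "x \<in> F m" if x: "x \<in> carrier A" for x
    using mem_iff[OF filtration_carrier[OF F_filtration] x, of m] hom_W[OF x] F_lead[of m] lead_filt_low[OF m] by simp
  then show ?thesis using filtration_carrier[OF F_filtration] by blast
qed

lemma F_high: "hi < m \<Longrightarrow> F m = {\<zero>}"
proof -
  assume m: "hi < m"
  have "x \<in> F m \<longleftrightarrow> x = \<zero>" if x: "x \<in> carrier A" for x
    using mem_iff[OF filtration_carrier[OF F_filtration] x, of m] F_lead[of m] lead_filt_high[OF m] eq_0_iff[OF x] by simp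
  then show ?thesis using filtration_carrier[OF F_filtration, of m] M_zero by blast
qed

lemma wt_F: "wt A F = total_weight"
  unfolding wt_def total_weight_def
  using sum_weights[OF F_filtration F_low F_high, where g = "\<lambda>m. m"] by (simp add: F_lead dim_lead_filt)

lemma norm_F: "filtration_norm A F = sqrt (real_of_int square_norm)"
  unfolding square_norm_def
  using filtration_norm_eq[OF F_filtration F_low F_high] by (simp add: F_lead dim_lead_filt)

text \<open>
  Telescoping over the intersections of \<open>S\<close> with the split filtration.
\<close>

lemma dim_homogeneous:
  assumes S: "subspace S" "S \<subseteq> V" and hom: "\<And>x d. x \<in> S \<Longrightarrow> pr d x \<in> S"
  shows "int (dim S) = (\<Sum>d=lo..hi. int (dim (S \<inter> comp d)))"
proof (cases "lo \<le> hi + 1")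
  case True
  have L: "subspace (S \<inter> lead_filt d)" for d by (rule subspace_inter[OF S(1) lead_filt_subspace])
  have "int (dim (S \<inter> comp d)) = int (dim (S \<inter> lead_filt d)) - int (dim (S \<inter> lead_filt (d + 1)))" for d
  proof -
    have "{x \<in> S \<inter> lead_filt d. pr d x = 0} = S \<inter> lead_filt (d + 1)" unfolding lead_filt_Suc by blast
    moreover have "pr d ` (S \<inter> lead_filt d) = S \<inter> comp d"
    proof
      show "S \<inter> comp d \<subseteq> pr d ` (S \<inter> lead_filt d)"
      proof
        fix x assume x: "x \<in> S \<inter> comp d"
        then have "x \<in> S \<inter> lead_filt d" using comp_lead_filt[of x d d] by simp
        then show "x \<in> pr d ` (S \<inter> lead_filt d)" using x comp_eq[of x d] by (metis IntD2 imageI)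
      qed
    qed (use hom in auto)
    ultimately show ?thesis
      using rank_nullity[OF pr_linear L findim_V_subset, of d d] S(2) by (simp add: le_infI1)
  qed
  then have "(\<Sum>d=lo..hi. int (dim (S \<inter> comp d))) = int (dim (S \<inter> lead_filt lo)) - int (dim (S \<inter> lead_filt (hi + 1)))"
    using sum_telescope_int[OF True, of "\<lambda>d. int (dim (S \<inter> lead_filt d))"] by simp
  moreover have "S \<inter> lead_filt lo = S" using lead_filt_low[OF order_refl] S(2) by blast
  moreover have "S \<inter> lead_filt (hi + 1) = {0}" using lead_filt_high[of "hi + 1"] subspace_0[OF S(1)] by auto
  ultimately show ?thesis by simp
next
  case False
  then have "V = {0}" using lead_filt_high[of lo] lead_filt_low[of lo] by simp
  then have "S = {0}" using S(2) subspace_0[OF S(1)] by blast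
  then show ?thesis using False by simp
qed

lemma hfilt_antimono:
  assumes H: "hfilt H a b" and "i \<le> j"
  shows "H j \<subseteq> H i"
  using assms(2)
proof (induction j rule: int_ge_induct)
  case (step j)
  have "H (j + 1) \<subseteq> H j" using H unfolding hfilt_def by blast
  then show ?case using step.IH by blast
qed simp

text \<open>
  Weight \<open>N d + j\<close> for the elements of degree \<open>d\<close> and \<open>H\<close>-weight \<open>j\<close>: for large \<open>N\<close> this orders the pairs
  \<open>(d, j)\<close> lexicographically.
\<close>

definition lex_filt :: "(int \<Rightarrow> 'v set) \<Rightarrow> int \<Rightarrow> int \<Rightarrow> 'v set" where
  "lex_filt H N m = {x \<in> V. \<forall>d. pr d x \<in> H (m - N * d)}"

definition pullback :: "(int \<Rightarrow> 'v set) \<Rightarrow> int \<Rightarrow> 'a set" where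
  "pullback H m = {x \<in> carrier A. \<phi> x \<in> H m}"

context
  fixes H :: "int \<Rightarrow> 'v set" and a b N :: int
  assumes H: "hfilt H a b" and N: "0 \<le> N" "2 * b - a \<le> N"
begin

lemma H_subspace: "subspace (H m)" and H_V: "H m \<subseteq> V" and H_mul: "x \<in> H m \<Longrightarrow> y \<in> H l \<Longrightarrow> x \<star> y \<in> H (m + l)"
  and H_low: "m \<le> a \<Longrightarrow> H m = V" and H_high: "b < m \<Longrightarrow> H m = {0}"
  using H unfolding hfilt_def by blast+

lemma lex_filt_subspace: "subspace (lex_filt H N m)"
  unfolding lex_filt_def subspace_def
  by (auto simp: subspace_0[OF H_subspace] intro: subspace_add[OF H_subspace] subspace_scale[OF H_subspace])

lemma lex_filt_V: "lex_filt H N m \<subseteq> V"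
  unfolding lex_filt_def by blast

lemma lex_filt_homogeneous: "x \<in> lex_filt H N m \<Longrightarrow> pr d x \<in> lex_filt H N m"
  unfolding lex_filt_def by (auto simp: pr_pr subspace_0[OF H_subspace])

lemma lex_filt_comp: "lex_filt H N m \<inter> comp d = H (m - N * d) \<inter> comp d"
proof
  show "lex_filt H N m \<inter> comp d \<subseteq> H (m - N * d) \<inter> comp d"
  proof
    fix x assume x: "x \<in> lex_filt H N m \<inter> comp d"
    then have "pr d x \<in> H (m - N * d)" unfolding lex_filt_def by blast
    then show "x \<in> H (m - N * d) \<inter> comp d" using x by (simp add: comp_eq)
  qed
  show "H (m - N * d) \<inter> comp d \<subseteq> lex_filt H N m \<inter> comp d"
    unfolding lex_filt_def using subspace_0[OF H_subspace] by (auto simp: pr_of_comp comp_V)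
qed

lemma lex_filt_low: "m \<le> a + N * lo \<Longrightarrow> lex_filt H N m = V"
proof -
  assume m: "m \<le> a + N * lo"
  have "pr d x \<in> H (m - N * d)" if "x \<in> V" for d x
  proof (cases "lo \<le> d")
    case True
    then have "N * lo \<le> N * d" using N(1) by (rule mult_left_mono)
    then show ?thesis using H_low[of "m - N * d"] m by simp
  qed (simp add: pr_out subspace_0[OF H_subspace])
  then show ?thesis unfolding lex_filt_def by blast
qed

lemma lex_filt_high: "b + N * hi < m \<Longrightarrow> lex_filt H N m = {0}"
proof -
  assume m: "b + N * hi < m"
  have z: "pr d x = 0" if "x \<in> lex_filt H N m" for x d
  proof (cases "d \<le> hi")
    case True
    then have "N * d \<le> N * hi" using N(1) by (rule mult_left_mono)
    then show ?thesis using H_high[of "m - N * d"] m that unfolding lex_filt_def by auto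
  qed (simp add: pr_out)
  have "x = 0" if x: "x \<in> lex_filt H N m" for x
    using eq_by_components[of x 0] z[OF x] x lex_filt_V by auto
  then show ?thesis using subspace_0[OF lex_filt_subspace] by blast
qed

text \<open>
  The part of the product of degree \<open>d + e\<close> is controlled by \<open>H\<close>. In a higher degree a weight of at least \<open>N\<close> is
  gained, which outweighs all that \<open>H\<close> can demand, namely \<open>2 b - a\<close>.
\<close>

lemma lex_filt_mult:
  assumes x: "x \<in> lex_filt H N m" and y: "y \<in> lex_filt H N l"
  shows "mu x y \<in> lex_filt H N (m + l)"
proof -
  have "mu (pr d x) (pr e y) \<in> lex_filt H N (m + l)" for d e
  proof -
    define u where "u = pr d x"
    define v where "v = pr e y"
    have u: "u \<in> H (m - N * d)" "u \<in> comp d" and v: "v \<in> H (l - N * e)" "v \<in> comp e"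
      using x y unfolding u_def v_def lex_filt_def by auto
    define r where "r = mu (pr d x) (pr e y) - u \<star> v"
    have r: "r \<in> lead_filt (d + e + 1)"
      using gr_mul[OF u(2) v(2)] unfolding r_def u_def v_def .
    have rV: "r \<in> V" using r lead_filt_V by blast
    have uv: "u \<star> v \<in> lex_filt H N (m + l)"
    proof -
      have "u \<star> v \<in> H ((m - N * d) + (l - N * e))" by (rule H_mul[OF u(1) v(1)])
      moreover have "(m - N * d) + (l - N * e) = (m + l) - N * (d + e)" by (simp add: algebra_simps)
      ultimately have "u \<star> v \<in> H ((m + l) - N * (d + e)) \<inter> comp (d + e)" using comp_mul[OF u(2) v(2)] by simp
      then show ?thesis unfolding lex_filt_comp[symmetric] by blast
    qed
    show ?thesis
    proof (cases "u = 0 \<or> v = 0")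
      case True
      then show ?thesis using subspace_0[OF lex_filt_subspace] mu_0[OF pr_closed] unfolding u_def v_def by auto
    next
      case False
      have "m - N * d \<le> b" using H_high[of "m - N * d"] u(1) False by (cases "b < m - N * d") auto
      moreover have "l - N * e \<le> b" using H_high[of "l - N * e"] v(1) False by (cases "b < l - N * e") auto
      ultimately have ml: "m + l - N * (d + e) \<le> 2 * b" by (simp add: algebra_simps)
      have "pr g r \<in> H (m + l - N * g)" for g
      proof (cases "g < d + e + 1")
        case True
        then show ?thesis using r subspace_0[OF H_subspace] unfolding lead_filt_def by simp
      next
        case False
        then have "N * (d + e + 1) \<le> N * g" using N(1) by (intro mult_left_mono) auto
        then have "m + l - N * g \<le> a" using ml N(2) by (simp add: algebra_simps)
        then show ?thesis using H_low by simp
      qed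
      then have "r \<in> lex_filt H N (m + l)" using rV unfolding lex_filt_def by simp
      then have "r + u \<star> v \<in> lex_filt H N (m + l)" using uv by (rule subspace_add[OF lex_filt_subspace])
      then show ?thesis unfolding r_def by simp
    qed
  qed
  moreover have "mu x y = (\<Sum>d=lo..hi. \<Sum>e=lo..hi. mu (pr d x) (pr e y))"
    using mu_sum[of "{lo..hi}" "\<lambda>d. pr d x" "{lo..hi}" "\<lambda>e. pr e y"]
      pr_sum[OF subsetD[OF lex_filt_V x]] pr_sum[OF subsetD[OF lex_filt_V y]] by simp
  ultimately show ?thesis by (simp add: subspace_sum[OF lex_filt_subspace])
qed

lemma pullback_image: "\<phi> ` pullback (lex_filt H N) m = lex_filt H N m"
proof
  show "lex_filt H N m \<subseteq> \<phi> ` pullback (lex_filt H N) m"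
  proof
    fix v assume v: "v \<in> lex_filt H N m"
    then have "v \<in> V" using lex_filt_V by blast
    then obtain x where "x \<in> carrier A" "\<phi> x = v" by (rule obtain_preimage)
    then show "v \<in> \<phi> ` pullback (lex_filt H N) m" unfolding pullback_def using v by auto
  qed
qed (auto simp: pullback_def)

lemma pullback_low: "m \<le> a + N * lo \<Longrightarrow> pullback (lex_filt H N) m = carrier A"
  unfolding pullback_def using lex_filt_low hom_W by auto

lemma pullback_high: "b + N * hi < m \<Longrightarrow> pullback (lex_filt H N) m = {\<zero>}"
  unfolding pullback_def using lex_filt_high eq_0_iff by auto

lemma pullback_filtration: "filtration A (pullback (lex_filt H N))"
  unfolding filtration_def
proof (intro conjI allI impI ballI)
  fix i show "VectorSpace.subspace class_ring (pullback (lex_filt H N) i) A"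
    unfolding subspace_iff pullback_image using lex_filt_subspace unfolding pullback_def by auto
next
  fix i j :: int assume ij: "i \<le> j"
  have "lex_filt H N j \<subseteq> lex_filt H N i"
    unfolding lex_filt_def using hfilt_antimono[OF H, of "i - N * d" "j - N * d" for d] ij by auto
  then show "pullback (lex_filt H N) j \<subseteq> pullback (lex_filt H N) i" unfolding pullback_def by auto
next
  fix i j x y assume "x \<in> pullback (lex_filt H N) i" "y \<in> pullback (lex_filt H N) j"
  then show "x \<otimes> y \<in> pullback (lex_filt H N) (i + j)"
    unfolding pullback_def using lex_filt_mult[of "\<phi> x" i "\<phi> y" j] by (auto simp: mu_hom alg.mult_closed)
next
  show "\<exists>n. \<forall>i\<le>n. pullback (lex_filt H N) i = carrier A" using pullback_low by blast
  show "\<exists>n. \<forall>i\<ge>n. pullback (lex_filt H N) i = {\<zero>}"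
    using pullback_high by (intro exI[of _ "b + N * hi + 1"]) auto
qed

text \<open>
  The weights of the perturbed filtration are the numbers \<open>j + N d\<close> with multiplicity \<open>hdim H d j\<close>. With \<open>g\<close> the
  identity or the square, this computes its weight and its norm.
\<close>

lemma lex_filt_sum:
  fixes g :: "int \<Rightarrow> int"
  shows "(\<Sum>m = a + N * lo..b + N * hi. g m * (int (dim (lex_filt H N m)) - int (dim (lex_filt H N (m + 1)))))
    = (\<Sum>d=lo..hi. \<Sum>j=a..b. g (j + N * d) * hdim H d j)"
proof -
  have dm: "int (dim (lex_filt H N m)) - int (dim (lex_filt H N (m + 1))) = (\<Sum>d=lo..hi. hdim H d (m - N * d))" for m
  proof -
    have "int (dim (lex_filt H N i)) = (\<Sum>d=lo..hi. int (dim (H (i - N * d) \<inter> comp d)))" for i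
      using dim_homogeneous[OF lex_filt_subspace lex_filt_V lex_filt_homogeneous, of i] by (simp add: lex_filt_comp)
    then show ?thesis unfolding hdim_def by (simp add: sum_subtractf add_diff_eq[symmetric] diff_add_eq)
  qed
  have inner: "(\<Sum>m = a + N * lo..b + N * hi. g m * hdim H d (m - N * d)) = (\<Sum>j=a..b. g (j + N * d) * hdim H d j)"
    if d: "d \<in> {lo..hi}" for d
  proof -
    have le: "N * lo \<le> N * d" "N * d \<le> N * hi" using d N(1) by (auto intro: mult_left_mono)
    have "(\<Sum>m = a + N * lo..b + N * hi. g m * hdim H d (m - N * d)) = (\<Sum>m = a + N * d..b + N * d. g m * hdim H d (m - N * d))"
    proof (rule sum.mono_neutral_right)
      show "{a + N * d..b + N * d} \<subseteq> {a + N * lo..b + N * hi}" using le by auto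
      show "\<forall>m\<in>{a + N * lo..b + N * hi} - {a + N * d..b + N * d}. g m * hdim H d (m - N * d) = 0"
      proof
        fix m assume m: "m \<in> {a + N * lo..b + N * hi} - {a + N * d..b + N * d}"
        then have "m - N * d + 1 \<le> a \<or> b < m - N * d" by auto
        then have "H (m - N * d) = H (m - N * d + 1)"
        proof
          assume "m - N * d + 1 \<le> a"
          then show ?thesis using H_low[of "m - N * d"] H_low[of "m - N * d + 1"] by simp
        next
          assume "b < m - N * d"
          then show ?thesis using H_high[of "m - N * d"] H_high[of "m - N * d + 1"] by simp
        qed
        then show "g m * hdim H d (m - N * d) = 0" unfolding hdim_def by simp
      qed
    qed simp
    also have "\<dots> = (\<Sum>j=a..b. g (j + N * d) * hdim H d j)"
      by (rule sum.reindex_bij_witness[of _ "\<lambda>j. j + N * d" "\<lambda>m. m - N * d"]) auto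
    finally show ?thesis .
  qed
  have "(\<Sum>m = a + N * lo..b + N * hi. g m * (int (dim (lex_filt H N m)) - int (dim (lex_filt H N (m + 1)))))
    = (\<Sum>m = a + N * lo..b + N * hi. \<Sum>d=lo..hi. g m * hdim H d (m - N * d))"
    unfolding dm by (simp add: sum_distrib_left)
  also have "\<dots> = (\<Sum>d=lo..hi. \<Sum>m = a + N * lo..b + N * hi. g m * hdim H d (m - N * d))" by (rule sum.swap)
  also have "\<dots> = (\<Sum>d=lo..hi. \<Sum>j=a..b. g (j + N * d) * hdim H d j)" by (rule sum.cong[OF refl inner])
  finally show ?thesis .
qed

end

end

lemma int_le_square: "(m::int) \<le> m * m"
proof (cases "m \<le> 0")
  case False
  then show ?thesis using mult_left_mono[of 1 m m] by simp
qed (use zero_le_square[of m] in linarith)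

context graded_model
begin

text \<open>
  A destabilising filtration has a negative slope, and the slope of \<open>F\<close> is at most that.
\<close>

lemma wt_F_pos:
  assumes unst: "unstable A"
    and min: "\<And>F'. filtration A F' \<Longrightarrow> F' \<noteq> trivial_filtration A \<Longrightarrow> nu A F \<le> nu A F'"
  shows "0 < total_weight"
proof -
  obtain F' where F': "filtration A F'" "- wt A F' < 0" using unst unfolding semistable_def by force
  then have nt: "F' \<noteq> trivial_filtration A" using wt_trivial by auto
  obtain n n' where n: "\<forall>i\<le>n. F' i = carrier A" "\<forall>i\<ge>n'. F' i = {\<zero>}" using F'(1) unfolding filtration_def by blast
  have pos: "0 < filtration_norm A F'"
  proof -
    have "wt A F' = (\<Sum>m=n..n'. m * int (gr_dim A F' m))"
      unfolding wt_def using sum_weights[OF F'(1), where g = "\<lambda>m. m" and a = n and b = n'] n gr_dim_eq[OF F'(1)] by simp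
    also have "\<dots> \<le> (\<Sum>m=n..n'. m * m * int (gr_dim A F' m))"
      by (intro sum_mono mult_right_mono) (auto simp: int_le_square)
    finally have "0 < (\<Sum>m=n..n'. m * m * int (gr_dim A F' m))" using F'(2) by simp
    moreover have "filtration_norm A F' = sqrt (real_of_int (\<Sum>m=n..n'. m * m * int (gr_dim A F' m)))"
      unfolding gr_dim_eq[OF F'(1)] by (rule filtration_norm_eq[OF F'(1)]) (use n in auto)
    ultimately show ?thesis by (simp only: real_sqrt_gt_0_iff of_int_0_less_iff)
  qed
  have "nu A F' < 0" unfolding nu_def using pos F'(2) by (simp add: divide_neg_pos)
  then have "nu A F < 0" using min[OF F'(1) nt] by simp
  have "0 < wt A F"
  proof (rule ccontr)
    assume "\<not> 0 < wt A F"
    then have "0 \<le> - real_of_int (wt A F)" by simp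
    moreover have "0 \<le> filtration_norm A F" unfolding norm_F using square_norm_nonneg by simp
    ultimately have "0 \<le> nu A F" unfolding nu_def by (rule divide_nonneg_nonneg)
    then show False using \<open>nu A F < 0\<close> by simp
  qed
  then show ?thesis unfolding wt_F .
qed

text \<open>
  With \<open>w\<close>, \<open>p\<close>, \<open>q\<close> the weight of \<open>H\<close>, its pairing with the grading and its squared norm, the perturbed
  filtration has weight \<open>N W + w\<close> and squared norm \<open>N\<^sup>2 Q + 2 N p + q\<close>. Minimality of \<open>F\<close> then reads
  \<open>(N W + w)\<^sup>2 Q \<le> W\<^sup>2 (N\<^sup>2 Q + 2 N p + q)\<close>; the terms in \<open>N\<^sup>2\<close> cancel and those in \<open>N\<close> give \<open>Q w \<le> W p\<close>.
\<close>

theorem optimal_of_minimal: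
  assumes unst: "unstable A"
    and min: "\<And>F'. filtration A F' \<Longrightarrow> F' \<noteq> trivial_filtration A \<Longrightarrow> nu A F \<le> nu A F'"
  shows "optimal_alg scale V mul pr lo hi"
proof (unfold_locales)
  let ?W = total_weight and ?Q = square_norm
  show W: "0 < ?W" by (rule wt_F_pos[OF assms])
  fix H a b assume H: "hfilt H a b"
  define w where "w = (\<Sum>d=lo..hi. \<Sum>m=a..b. m * hdim H d m)"
  define p where "p = (\<Sum>d=lo..hi. \<Sum>m=a..b. d * m * hdim H d m)"
  define q where "q = (\<Sum>d=lo..hi. \<Sum>m=a..b. m * m * hdim H d m)"
  have ab: "a \<le> b + 1"
  proof (rule ccontr)
    assume "\<not> a \<le> b + 1"
    then have "H a = V" "H a = {0}" using H unfolding hfilt_def by auto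
    then have "comp d = {0}" for d using comp_subset_V[of d] comp_closed(1)[of d] by auto
    then show False using W unfolding total_weight_def by simp
  qed
  have row: "(\<Sum>m=a..b. hdim H d m) = int (dim (comp d))" for d
  proof -
    have "H a \<inter> comp d = comp d" "H (b + 1) \<inter> comp d = {0}"
      using H comp_subset_V[of d] comp_closed(1)[of d] unfolding hfilt_def by auto
    then show ?thesis
      using sum_telescope_int[OF ab, of "\<lambda>m. int (dim (H m \<inter> comp d))"] unfolding hdim_def by simp
  qed
  show "?Q * w \<le> ?W * p"
  proof (rule ccontr)
    assume "\<not> ?Q * w \<le> ?W * p"
    then have gap: "?W * p + 1 \<le> ?Q * w" by simp
    \<comment> \<open>large enough for the perturbed filtration to exist, to have positive weight, and for the final contradiction\<close>
    define N where "N = 1 + \<bar>2 * b - a\<bar> + \<bar>w\<bar> + ?W * ?W * \<bar>q\<bar>"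
    have WWq: "0 \<le> ?W * ?W * \<bar>q\<bar>" by simp
    have N: "0 \<le> N" "2 * b - a \<le> N" "1 + \<bar>w\<bar> \<le> N" "?W * ?W * \<bar>q\<bar> < N" using WWq unfolding N_def by linarith+
    define K where "K = pullback (lex_filt H N)"
    note K = pullback_filtration[OF H N(1,2), folded K_def]
    have low: "m \<le> a + N * lo \<Longrightarrow> K m = carrier A" for m unfolding K_def by (rule pullback_low[OF H N(1,2)])
    have high: "b + N * hi < m \<Longrightarrow> K m = {\<zero>}" for m unfolding K_def by (rule pullback_high[OF H N(1,2)])
    have Kim: "\<phi> ` K m = lex_filt H N m" for m unfolding K_def by (rule pullback_image[OF H N(1,2)])
    define wK where "wK = N * ?W + w"
    define qK where "qK = N * N * ?Q + 2 * N * p + q"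
    have "wt A K = (\<Sum>d=lo..hi. \<Sum>j=a..b. (j + N * d) * hdim H d j)"
      unfolding wt_def
      using sum_weights[OF K low high, where g = "\<lambda>m. m"] lex_filt_sum[OF H N(1,2), of "\<lambda>m. m"] by (simp add: Kim)
    also have "\<dots> = (\<Sum>d=lo..hi. (\<Sum>j=a..b. j * hdim H d j) + N * (d * (\<Sum>j=a..b. hdim H d j)))"
      by (intro sum.cong refl) (simp add: distrib_right sum.distrib sum_distrib_left mult.assoc)
    also have "\<dots> = wK"
      unfolding row wK_def w_def total_weight_def by (simp add: sum.distrib sum_distrib_left)
    finally have wtK: "wt A K = wK" .
    have Knorm: "(\<Sum>m = a + N * lo..b + N * hi. m * m * (int (dim (\<phi> ` K m)) - int (dim (\<phi> ` K (m + 1))))) = qK"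
    proof -
      have "(\<Sum>m = a + N * lo..b + N * hi. m * m * (int (dim (\<phi> ` K m)) - int (dim (\<phi> ` K (m + 1)))))
        = (\<Sum>d=lo..hi. \<Sum>j=a..b. (j + N * d) * (j + N * d) * hdim H d j)"
        using lex_filt_sum[OF H N(1,2), of "\<lambda>m. m * m"] by (simp add: Kim)
      also have "\<dots> = (\<Sum>d=lo..hi. (\<Sum>j=a..b. j * j * hdim H d j) + 2 * N * (\<Sum>j=a..b. d * j * hdim H d j)
          + N * N * (d * d) * (\<Sum>j=a..b. hdim H d j))"
      proof (rule sum.cong[OF refl])
        fix d
        have "(\<Sum>j=a..b. (j + N * d) * (j + N * d) * hdim H d j)
            = (\<Sum>j=a..b. j * j * hdim H d j + 2 * N * (d * j * hdim H d j) + N * N * (d * d) * hdim H d j)"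
          by (intro sum.cong refl) (simp add: algebra_simps)
        then show "(\<Sum>j=a..b. (j + N * d) * (j + N * d) * hdim H d j)
            = (\<Sum>j=a..b. j * j * hdim H d j) + 2 * N * (\<Sum>j=a..b. d * j * hdim H d j)
              + N * N * (d * d) * (\<Sum>j=a..b. hdim H d j)"
          by (simp only: sum.distrib sum_distrib_left[symmetric])
      qed
      also have "\<dots> = qK"
        unfolding row qK_def q_def p_def square_norm_def
        by (simp only: sum.distrib mult.assoc sum_distrib_left[symmetric])
      finally show ?thesis .
    qed
    have normK: "filtration_norm A K = sqrt (real_of_int qK)"
      unfolding Knorm[symmetric] by (rule filtration_norm_eq[OF K low high])
    have "N * 1 \<le> N * ?W" using N(1) W by (intro mult_left_mono) auto
    then have wKpos: "0 < wK" unfolding wK_def using N(3) by linarith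
    \<comment> \<open>minimality of \<open>F\<close> only speaks of nontrivial filtrations\<close>
    have nt: "K \<noteq> trivial_filtration A" using wtK wKpos wt_trivial by auto
    \<comment> \<open>an integer is at most its square; this makes the norm positive\<close>
    have "wK \<le> qK"
    proof -
      have "wK = (\<Sum>m = a + N * lo..b + N * hi. m * int (gr_dim A K m))"
        using sum_weights[OF K low high, where g = "\<lambda>m. m"] wtK unfolding wt_def by (simp add: gr_dim_eq[OF K])
      also have "\<dots> \<le> (\<Sum>m = a + N * lo..b + N * hi. m * m * int (gr_dim A K m))"
        by (intro sum_mono mult_right_mono) (auto simp: int_le_square)
      also have "\<dots> = qK" unfolding Knorm[symmetric] by (simp add: gr_dim_eq[OF K])
      finally show ?thesis .
    qed
    then have qKpos: "0 < qK" using wKpos by simp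
    have "?W \<le> ?Q" unfolding total_weight_def square_norm_def
      by (intro sum_mono mult_right_mono) (auto simp: int_le_square)
    then have Qpos: "0 < ?Q" using W by simp
    have "nu A F \<le> nu A K" by (rule min[OF K nt])
    then have "real_of_int wK / sqrt (real_of_int qK) \<le> real_of_int ?W / sqrt (real_of_int ?Q)"
      unfolding nu_def wt_F norm_F wtK normK by simp
    then have "real_of_int wK * sqrt (real_of_int ?Q) \<le> real_of_int ?W * sqrt (real_of_int qK)"
      using qKpos Qpos by (simp add: field_simps)
    then have "(real_of_int wK * sqrt (real_of_int ?Q))\<^sup>2 \<le> (real_of_int ?W * sqrt (real_of_int qK))\<^sup>2"
      using wKpos Qpos by (intro power_mono) auto
    then have "real_of_int (wK * wK * ?Q) \<le> real_of_int (?W * ?W * qK)"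
      using qKpos Qpos by (simp add: power_mult_distrib) (simp add: power2_eq_square)
    then have "wK * wK * ?Q \<le> ?W * ?W * qK" by (simp only: of_int_le_iff)
    then have ineq: "2 * (N * ?W) * (?Q * w - ?W * p) + w * w * ?Q \<le> ?W * ?W * q"
      unfolding wK_def qK_def by (simp add: algebra_simps)
    have "2 * (N * ?W) * 1 \<le> 2 * (N * ?W) * (?Q * w - ?W * p)"
      using gap N(1) W by (intro mult_left_mono) auto
    moreover have "0 \<le> w * w * ?Q" using Qpos by simp
    moreover have "?W * ?W * q \<le> ?W * ?W * \<bar>q\<bar>" by (intro mult_left_mono) auto
    ultimately have "2 * (N * ?W) < N" using ineq N(4) by linarith
    then show False using \<open>N * 1 \<le> N * ?W\<close> N(1,3) by linarith
  qed
qed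

end

section \<open>Transfer to records\<close>

lemma graded_sumE:
  assumes "x \<in> graded_sum R C S"
  obtains I g where "finite I" "I \<subseteq> S" "\<forall>i\<in>I. g i \<in> C i" "x = (\<Oplus>\<^bsub>R\<^esub>i\<in>I. g i)"
  using assms unfolding graded_sum_def by auto

context optimal_alg
begin

text \<open>
  For any record \<open>R\<close> that is isomorphic to the graded algebra \<open>V\<close>; it is used both for \<open>A\<close> and for \<open>Gr A F\<close>.
\<close>

lemma radical_center_annihilator:
  fixes R :: "('k, 'r) module" (structure) and \<theta> :: "'r \<Rightarrow> 'v" and C :: "int \<Rightarrow> 'r set"
  assumes co: "coordinates scale R \<theta> V"
    and mult: "\<And>x y. x \<in> carrier R \<Longrightarrow> y \<in> carrier R \<Longrightarrow> x \<otimes> y \<in> carrier R \<and> \<theta> (x \<otimes> y) = \<theta> x \<star> \<theta> y"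
    and C: "\<And>d. C d = {x \<in> carrier R. \<theta> x \<in> comp d}"
  shows "graded_sum R C {..<0} \<subseteq> jacobson_radical R \<inter> center R"
    and "graded_sum R C {0<..} \<subseteq> jacobson_radical R"
    and "n < 0 \<Longrightarrow> annihilator R \<inter> C n = {\<zero>}"
proof -
  interpret R: coordinates scale R \<theta> V by (rule co)
  have J: "x \<in> jacobson_radical R" if x: "x \<in> carrier R" "\<theta> x \<in> radical" for x
  proof -
    have "left_quasi_regular R (r \<otimes> x)" if r: "r \<in> carrier R" for r
    proof -
      obtain y where y: "y \<in> V" "y + \<theta> r \<star> \<theta> x - y \<star> (\<theta> r \<star> \<theta> x) = 0"
        using x(2) R.hom_W[OF r] unfolding radical_def by blast
      obtain y' where y': "y' \<in> carrier R" "\<theta> y' = y" by (rule R.obtain_preimage[OF y(1)])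
      note rx = mult[OF r x(1)]
      note yrx = mult[OF y'(1) conjunct1[OF rx]]
      have "\<theta> ((y' \<oplus> r \<otimes> x) \<ominus> (y' \<otimes> (r \<otimes> x))) = 0"
        using R.hom_minus[of "y' \<oplus> r \<otimes> x" "y' \<otimes> (r \<otimes> x)"] rx yrx y y' by simp
      moreover have "(y' \<oplus> r \<otimes> x) \<ominus> (y' \<otimes> (r \<otimes> x)) \<in> carrier R"
        using rx yrx y' abelian_group.minus_closed[OF R.abelian] by simp
      ultimately have "(y' \<oplus> r \<otimes> x) \<ominus> (y' \<otimes> (r \<otimes> x)) = \<zero>" using R.eq_0_iff by blast
      then show ?thesis unfolding left_quasi_regular_def using y'(1) by blast
    qed
    then show ?thesis unfolding jacobson_radical_def using x(1) by blast
  qed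
  have CR: "x \<in> carrier R" "\<theta> x \<in> comp d" if "x \<in> C d" for x d using that C by auto
  have gs: "\<exists>I f. finite I \<and> I \<subseteq> S \<and> (\<forall>i\<in>I. f i \<in> comp i) \<and> x \<in> carrier R \<and> \<theta> x = (\<Sum>i\<in>I. f i)"
    if "x \<in> graded_sum R C S" for x S
  proof -
    obtain I g where I: "finite I" "I \<subseteq> S" "\<forall>i\<in>I. g i \<in> C i" "x = (\<Oplus>i\<in>I. g i)"
      by (rule graded_sumE[OF \<open>x \<in> graded_sum R C S\<close>])
    have g: "g i \<in> carrier R" "\<theta> (g i) \<in> comp i" if "i \<in> I" for i using CR[of "g i" i] I(3) that by simp_all
    show ?thesis
    proof (intro exI conjI ballI)
      show "finite I" "I \<subseteq> S" by (rule I)+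
      show "\<theta> (g i) \<in> comp i" if "i \<in> I" for i by (rule g(2)[OF that])
      show "x \<in> carrier R" unfolding I(4) by (rule R.finsum_in_carrier[OF g(1)])
      show "\<theta> x = (\<Sum>i\<in>I. \<theta> (g i))" unfolding I(4) by (rule R.hom_finsum[OF g(1)])
    qed
  qed
  have rad: "(\<Sum>i\<in>I. f i) \<in> radical" if "finite I" "0 \<notin> I" "\<forall>i\<in>I. f i \<in> comp i" for I f
    using that
  proof (induction I rule: finite_induct)
    case (insert i I)
    then show ?case using radical_add comp_subset_radical[of i] by auto
  qed (simp add: radical_0)
  have sub: "graded_sum R C S \<subseteq> jacobson_radical R" if "0 \<notin> S" for S
  proof
    fix x assume x: "x \<in> graded_sum R C S"
    from gs[OF x] obtain I f where I: "finite I" "I \<subseteq> S" "\<forall>i\<in>I. f i \<in> comp i" "x \<in> carrier R" "\<theta> x = (\<Sum>i\<in>I. f i)"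
      by blast
    then have "\<theta> x \<in> radical" using rad[of I f] that by auto
    then show "x \<in> jacobson_radical R" using J I(4) by blast
  qed
  have cen: "graded_sum R C {..<0} \<subseteq> center R"
  proof
    fix x assume x: "x \<in> graded_sum R C {..<0}"
    from gs[OF x] obtain I f where I: "finite I" "I \<subseteq> {..<0}" "\<forall>i\<in>I. f i \<in> comp i" "x \<in> carrier R" "\<theta> x = (\<Sum>i\<in>I. f i)"
      by blast
    have "x \<otimes> a = a \<otimes> x" if a: "a \<in> carrier R" for a
    proof (rule R.eqI)
      have "f i \<star> \<theta> a = \<theta> a \<star> f i" if "i \<in> I" for i
        using negative_central[of "f i" i "\<theta> a"] I that R.hom_W[OF a] by auto
      then have "\<theta> x \<star> \<theta> a = \<theta> a \<star> \<theta> x" unfolding I(5) mul_sum_left mul_sum_right by (rule sum.cong[OF refl])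
      then show "\<theta> (x \<otimes> a) = \<theta> (a \<otimes> x)" using mult a I(4) by simp
    qed (use mult a I(4) in auto)
    then show "x \<in> center R" unfolding center_def using I(4) by blast
  qed
  show "graded_sum R C {..<0} \<subseteq> jacobson_radical R \<inter> center R" using sub[of "{..<0}"] cen by auto
  show "graded_sum R C {0<..} \<subseteq> jacobson_radical R" using sub[of "{0<..}"] by auto
  show "annihilator R \<inter> C n = {\<zero>}" if n: "n < 0"
  proof
    show "annihilator R \<inter> C n \<subseteq> {\<zero>}"
    proof
      fix x assume x: "x \<in> annihilator R \<inter> C n"
      then have xR: "x \<in> carrier R" "\<theta> x \<in> comp n" using CR by auto
      have "\<theta> x \<star> b = 0 \<and> b \<star> \<theta> x = 0" if b: "b \<in> V" for b
      proof -
        obtain b' where b': "b' \<in> carrier R" "\<theta> b' = b" by (rule R.obtain_preimage[OF b])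
        then have "x \<otimes> b' = \<zero>" "b' \<otimes> x = \<zero>" using x unfolding annihilator_def by auto
        then show ?thesis using mult[OF xR(1) b'(1)] mult[OF b'(1) xR(1)] b'(2) by simp
      qed
      then have "\<theta> x \<in> {a \<in> comp n. \<forall>b\<in>V. a \<star> b = 0 \<and> b \<star> a = 0}" using xR(2) by simp
      then have "\<theta> x = 0" unfolding annihilator_negative[OF n] by simp
      then show "x \<in> {\<zero>}" using R.eq_0_iff[OF xR(1)] by simp
    qed
    have "\<zero> \<otimes> b = \<zero> \<and> b \<otimes> \<zero> = \<zero>" if b: "b \<in> carrier R" for b
      using mult[OF R.M_zero b] mult[OF b R.M_zero] R.eq_0_iff[of "\<zero> \<otimes> b"] R.eq_0_iff[of "b \<otimes> \<zero>"] by simp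
    then show "{\<zero>} \<subseteq> annihilator R \<inter> C n" unfolding annihilator_def C using comp_closed(1) by auto
  qed
qed

end

section \<open>Existence of coordinates adapted to a filtration\<close>

definition fun_scale :: "'k::field \<Rightarrow> ('a \<Rightarrow> 'k) \<Rightarrow> 'a \<Rightarrow> 'k" where
  "fun_scale c f = (\<lambda>i. c * f i)"

interpretation fun_space: vspace fun_scale
  by unfold_locales (auto simp: fun_scale_def fun_eq_iff algebra_simps)

lemma (in fin_dim_algebra) exists_coordinates:
  obtains \<phi> :: "'a \<Rightarrow> 'a \<Rightarrow> 'k" and V where "coordinates fun_scale A \<phi> V"
proof -
  obtain B where B: "finite B" "basis B" using finite_basis_exists[OF fin_dim] by blast
  have BA: "B \<subseteq> carrier A" and ind: "lin_indpt B" and gen: "gen_set B" using B(2) unfolding basis_def by auto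
  define V where "V = {f :: 'a \<Rightarrow> 'k. \<forall>b. b \<notin> B \<longrightarrow> f b = 0}"
  define \<psi> where "\<psi> f = lincomb f B" for f
  have \<psi>A: "\<psi> f \<in> carrier A" for f unfolding \<psi>_def by (rule lincomb_closed[OF BA]) simp
  have smB: "f b \<odot>\<^bsub>A\<^esub> b \<in> carrier A" if "b \<in> B" for f b using BA that by auto
  have \<psi>_add: "\<psi> (f + g) = \<psi> f \<oplus>\<^bsub>A\<^esub> \<psi> g" for f g
  proof -
    have "(\<Oplus>\<^bsub>A\<^esub>b\<in>B. (f b \<odot>\<^bsub>A\<^esub> b) \<oplus>\<^bsub>A\<^esub> (g b \<odot>\<^bsub>A\<^esub> b)) = \<psi> f \<oplus>\<^bsub>A\<^esub> \<psi> g"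
      unfolding \<psi>_def lincomb_def using smB by (intro M.finsum_addf) auto
    moreover have "\<psi> (f + g) = (\<Oplus>\<^bsub>A\<^esub>b\<in>B. (f b \<odot>\<^bsub>A\<^esub> b) \<oplus>\<^bsub>A\<^esub> (g b \<odot>\<^bsub>A\<^esub> b))"
      unfolding \<psi>_def lincomb_def using smB BA smult_l_distr by (intro M.finsum_cong') (auto simp: subset_iff)
    ultimately show ?thesis by simp
  qed
  have \<psi>_scale: "\<psi> (fun_scale c f) = c \<odot>\<^bsub>A\<^esub> \<psi> f" for c f
  proof -
    have "c \<odot>\<^bsub>A\<^esub> \<psi> f = (\<Oplus>\<^bsub>A\<^esub>b\<in>B. c \<odot>\<^bsub>A\<^esub> (f b \<odot>\<^bsub>A\<^esub> b))"
      unfolding \<psi>_def lincomb_def using smB by (intro finsum_smult) auto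
    moreover have "\<psi> (fun_scale c f) = (\<Oplus>\<^bsub>A\<^esub>b\<in>B. c \<odot>\<^bsub>A\<^esub> (f b \<odot>\<^bsub>A\<^esub> b))"
      unfolding \<psi>_def lincomb_def using smB BA smult_assoc1 by (intro M.finsum_cong') (auto simp: fun_scale_def subset_iff)
    ultimately show ?thesis by simp
  qed
  have \<psi>0: "f b = 0" if "\<psi> f = \<zero>\<^bsub>A\<^esub>" "b \<in> B" for f b
    using ind that B(1) unfolding lin_dep_def \<psi>_def by fastforce
  have \<psi>_zero: "\<psi> 0 = \<zero>\<^bsub>A\<^esub>" using \<psi>_scale[of 0 0] smult_l_null[OF \<psi>A[of 0]] by (simp add: fun_scale_def zero_fun_def)
  have V: "fun_space.subspace V" unfolding fun_space.subspace_def V_def by (auto simp: fun_scale_def)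
  have injV: "inj_on \<psi> V"
  proof (rule inj_onI)
    fix f g assume f: "f \<in> V" and g: "g \<in> V" and eq: "\<psi> f = \<psi> g"
    have "\<psi> (f + fun_scale (-1) g) = \<psi> f \<oplus>\<^bsub>A\<^esub> (-1) \<odot>\<^bsub>A\<^esub> \<psi> f"
      unfolding \<psi>_add \<psi>_scale eq by (rule refl)
    also have "\<dots> = \<psi> (f + fun_scale (-1) f)" unfolding \<psi>_add \<psi>_scale by (rule refl)
    also have "f + fun_scale (-1) f = 0" by (rule ext) (simp add: fun_scale_def)
    finally have "\<psi> (f + fun_scale (-1) g) = \<zero>\<^bsub>A\<^esub>" unfolding \<psi>_zero .
    then have "f b = g b" if "b \<in> B" for b using \<psi>0[of "f + fun_scale (-1) g" b] that by (simp add: fun_scale_def)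
    moreover have "f b = g b" if "b \<notin> B" for b using f g that unfolding V_def by simp
    ultimately show "f = g" by blast
  qed
  have imV: "\<psi> ` V = carrier A"
  proof
    show "carrier A \<subseteq> \<psi> ` V"
    proof
      fix x assume "x \<in> carrier A"
      then obtain a where a: "x = lincomb a B" using gen finite_in_span[OF B(1) BA, of x] by auto
      define f where "f b = (if b \<in> B then a b else 0)" for b
      have "\<psi> f = x" unfolding \<psi>_def lincomb_def a f_def using smB by (intro M.finsum_cong') auto
      moreover have "f \<in> V" unfolding V_def f_def by simp
      ultimately show "x \<in> \<psi> ` V" by blast
    qed
  qed (use \<psi>A in auto)
  define \<phi> where "\<phi> = the_inv_into V \<psi>"
  have \<phi>\<psi>: "\<phi> (\<psi> f) = f" if "f \<in> V" for f unfolding \<phi>_def by (rule the_inv_into_f_f[OF injV that])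
  have \<psi>\<phi>: "\<psi> (\<phi> x) = x" and \<phi>V: "\<phi> x \<in> V" if "x \<in> carrier A" for x
    unfolding \<phi>_def using that imV f_the_inv_into_f[OF injV, of x] the_inv_into_into[OF injV, of x V] by auto
  have "coordinates fun_scale A \<phi> V"
  proof unfold_locales
    show "fun_space.subspace V" by (rule V)
    have "V \<subseteq> fun_space.span ((\<lambda>b i. if i = b then 1 else 0) ` B)"
    proof
      fix f assume f: "f \<in> V"
      have "(\<Sum>b\<in>B'. fun_scale (f b) (\<lambda>i. if i = b then 1 else 0)) i = (if i \<in> B' then f i else 0)" if "finite B'" for B' i
        using that by (induction B' rule: finite_induct) (auto simp: fun_scale_def)
      then have "f = (\<Sum>b\<in>B. fun_scale (f b) (\<lambda>i. if i = b then 1 else 0))" using f B(1) unfolding V_def by (auto simp: fun_eq_iff)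
      also have "\<dots> \<in> fun_space.span ((\<lambda>b i. if i = b then 1 else 0) ` B)"
        by (intro fun_space.span_sum fun_space.span_scale fun_space.span_base) auto
      finally show "f \<in> fun_space.span ((\<lambda>b i. if i = b then 1 else 0) ` B)" .
    qed
    then show "fun_space.findim V" unfolding fun_space.findim_def using B(1) by blast
    show "inj_on \<phi> (carrier A)" using \<psi>\<phi> by (metis inj_onI)
    show "\<phi> ` carrier A = V"
    proof
      show "V \<subseteq> \<phi> ` carrier A"
      proof
        fix f assume "f \<in> V"
        then show "f \<in> \<phi> ` carrier A" using imageI[OF \<psi>A[of f], of \<phi>] \<phi>\<psi>[of f] by simp
      qed
    qed (use \<phi>V in auto)
    have "0 \<in> V" using fun_space.subspace_0[OF V] .
    then show "\<phi> \<zero>\<^bsub>A\<^esub> = 0" using \<phi>\<psi>[of 0] \<psi>_zero by simp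
    fix x assume x: "x \<in> carrier A"
    show "\<phi> (c \<odot>\<^bsub>A\<^esub> x) = fun_scale c (\<phi> x)" for c
      using \<phi>\<psi>[of "fun_scale c (\<phi> x)"] \<psi>_scale \<psi>\<phi>[OF x] fun_space.subspace_scale[OF V \<phi>V[OF x]] by simp
    show "c \<odot>\<^bsub>A\<^esub> x \<in> carrier A" for c using x by simp
    fix y assume y: "y \<in> carrier A"
    show "\<phi> (x \<oplus>\<^bsub>A\<^esub> y) = \<phi> x + \<phi> y"
      using \<phi>\<psi>[of "\<phi> x + \<phi> y"] \<psi>_add \<psi>\<phi>[OF x] \<psi>\<phi>[OF y] fun_space.subspace_add[OF V \<phi>V[OF x] \<phi>V[OF y]] by simp
    show "x \<oplus>\<^bsub>A\<^esub> y \<in> carrier A" using x y by simp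
  qed simp
  then show thesis by (rule that)
qed

context vspace
begin

text \<open>
  Going down from the highest weight, a basis of \<open>F (m + 1)\<close> is extended to one of \<open>F m\<close> by vectors of \<open>C m\<close>. For
  a grading, taking \<open>C m\<close> to be the component of degree \<open>m\<close> gives a homogeneous basis; for a bare filtration
  \<open>C m = F m\<close> will do.
\<close>

lemma adapted_basis:
  fixes F C :: "int \<Rightarrow> 'v set"
  assumes sub: "\<And>m. subspace (F m)" and fin: "\<And>m. findim (F m)" and dec: "\<And>m. F (m + 1) \<subseteq> F m"
    and C: "\<And>m. C m \<subseteq> F m" "\<And>m. F m \<subseteq> span (F (m + 1) \<union> C m)"
    and high: "\<And>m. hi < m \<Longrightarrow> F m = {0}" and lohi: "lo \<le> hi + 1"
  obtains B and \<delta> :: "'v \<Rightarrow> int" where "finite B" "independent B" "\<forall>b\<in>B. lo \<le> \<delta> b \<and> \<delta> b \<le> hi \<and> b \<in> C (\<delta> b)"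
    "\<forall>m\<ge>lo. F m = span {b \<in> B. m \<le> \<delta> b}"
proof -
  have "\<exists>B (\<delta> :: 'v \<Rightarrow> int). finite B \<and> independent B \<and> (\<forall>b\<in>B. i \<le> \<delta> b \<and> \<delta> b \<le> hi \<and> b \<in> C (\<delta> b)) \<and>
      (\<forall>m\<ge>i. F m = span {b \<in> B. m \<le> \<delta> b})" if "i \<le> hi + 1" for i
    using that
  proof (induction i rule: int_le_induct)
    case base
    show ?case by (rule exI[of _ "{}"]) (auto simp: high independent_empty)
  next
    case (step i)
    then obtain B and \<delta> :: "'v \<Rightarrow> int" where B: "finite B" "independent B" "\<forall>b\<in>B. i \<le> \<delta> b \<and> \<delta> b \<le> hi \<and> b \<in> C (\<delta> b)"
      "\<forall>m\<ge>i. F m = span {b \<in> B. m \<le> \<delta> b}" by blast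
    have "{b \<in> B. i \<le> \<delta> b} = B" using B(3) by auto
    then have Fi: "F i = span B" using B(4) by simp
    have BF: "B \<subseteq> F (i - 1)" using Fi span_superset[of B] dec[of "i - 1"] by auto
    have "F (i - 1) \<subseteq> span (F i \<union> C (i - 1))" using C(2)[of "i - 1"] by simp
    also have "\<dots> \<subseteq> span (B \<union> C (i - 1))"
    proof (rule span_minimal[OF _ subspace_span])
      show "F i \<union> C (i - 1) \<subseteq> span (B \<union> C (i - 1))"
        unfolding Fi using span_mono[of B "B \<union> C (i - 1)"] span_superset[of "B \<union> C (i - 1)"] by auto
    qed
    finally have gen: "F (i - 1) \<subseteq> span (B \<union> C (i - 1))" .
    have BC: "B \<union> C (i - 1) \<subseteq> F (i - 1)" using BF C(1) by simp
    obtain B' where B': "finite B'" "independent B'" "B \<subseteq> B'" "B' \<subseteq> B \<union> C (i - 1)" "span B' = F (i - 1)" "card B' = dim (F (i - 1))"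
      by (rule findim_basis_extend[OF fin sub BF B(2) Un_upper1 BC gen])
    define \<delta>' where "\<delta>' b = (if b \<in> B then \<delta> b else i - 1)" for b
    have "F m = span {b \<in> B'. m \<le> \<delta>' b}" if m: "i - 1 \<le> m" for m
    proof (cases "m = i - 1")
      case True
      have "{b \<in> B'. m \<le> \<delta>' b} = B'" using B(3) True unfolding \<delta>'_def by auto
      then show ?thesis using B'(5) True by simp
    next
      case False
      then have "{b \<in> B'. m \<le> \<delta>' b} = {b \<in> B. m \<le> \<delta> b}" using B'(3) m unfolding \<delta>'_def by auto
      then show ?thesis using B(4) False m by simp
    qed
    moreover have "i - 1 \<le> \<delta>' b \<and> \<delta>' b \<le> hi \<and> b \<in> C (\<delta>' b)" if "b \<in> B'" for b
      using B(3) B'(4) that step.hyps unfolding \<delta>'_def by fastforce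
    ultimately show ?case using B'(1,2) by blast
  qed
  from this[OF lohi] show thesis using that by blast
qed

lemma adapted_projections:
  fixes F C :: "int \<Rightarrow> 'v set"
  assumes V: "subspace V" "findim V"
    and sub: "\<And>m. subspace (F m)" and dec: "\<And>m. F (m + 1) \<subseteq> F m"
    and C: "\<And>m. C m \<subseteq> F m" "\<And>m. F m \<subseteq> span (F (m + 1) \<union> C m)" "\<And>m. subspace (C m)"
    and low: "\<And>m. m \<le> lo \<Longrightarrow> F m = V" and high: "\<And>m. hi < m \<Longrightarrow> F m = {0}" and lohi: "lo \<le> hi + 1"
  obtains pr :: "int \<Rightarrow> 'v \<Rightarrow> 'v" where
    "\<And>d. Vector_Spaces.linear scale scale (pr d)" "\<And>d x. pr d x \<in> V" "\<And>d x. pr d x \<in> C d"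
    "\<And>d e x. pr d (pr e x) = (if d = e then pr d x else 0)"
    "\<And>d x. d < lo \<or> hi < d \<Longrightarrow> pr d x = 0"
    "\<And>x. x \<in> V \<Longrightarrow> (\<Sum>d=lo..hi. pr d x) = x"
    "\<And>m. F m = {x \<in> V. \<forall>d<m. pr d x = 0}"
proof -
  have FV: "F m \<subseteq> V" for m
  proof -
    have "F m \<subseteq> F i" if "i \<le> m" for i
      using that by (induction m rule: int_ge_induct) (use dec in auto)
    then show ?thesis using low[of "min m lo"] by (metis min.cobounded1 min.cobounded2)
  qed
  have fin: "findim (F m)" for m by (rule findim_subset[OF V(2) FV])
  obtain B and \<delta> :: "'v \<Rightarrow> int" where B: "finite B" "independent B" "\<forall>b\<in>B. lo \<le> \<delta> b \<and> \<delta> b \<le> hi \<and> b \<in> C (\<delta> b)"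
    "\<forall>m\<ge>lo. F m = span {b \<in> B. m \<le> \<delta> b}"
    by (rule adapted_basis[where F = F and C = C and lo = lo and hi = hi, OF sub fin dec C(1,2) high lohi])
  have "{b \<in> B. lo \<le> \<delta> b} = B" using B(3) by auto
  then have VB: "V = span B" using B(4) low[of lo] by auto
  interpret vp: vector_space_pair scale scale ..
  have "\<exists>g. Vector_Spaces.linear scale scale g \<and> (\<forall>x\<in>B. g x = (if \<delta> x = d then x else 0)) \<and> range g = span ((\<lambda>x. if \<delta> x = d then x else 0) ` B)" for d
    using vp.linear_independent_extend_subspace[OF B(2), of "\<lambda>x. if \<delta> x = d then x else 0"] by blast
  then obtain pr where pr: "\<And>d. Vector_Spaces.linear scale scale (pr d)" "\<And>d x. x \<in> B \<Longrightarrow> pr d x = (if \<delta> x = d then x else 0)"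
    "\<And>d. range (pr d) = span ((\<lambda>x. if \<delta> x = d then x else 0) ` B)"
    by metis
  define D where "D d = {b \<in> B. \<delta> b = d}" for d
  have prD: "pr d x \<in> span (D d)" for d x
  proof -
    have "span ((\<lambda>x. if \<delta> x = d then x else 0) ` B) \<subseteq> span (D d)"
      by (rule span_minimal[OF _ subspace_span]) (auto simp: D_def span_zero intro: span_base)
    then show ?thesis using pr(3)[of d] by blast
  qed
  have onspan: "pr d x = (if d = e then x else 0)" if "x \<in> span (D e)" for d e x
  proof -
    interpret p: Vector_Spaces.linear scale scale "pr d" by (rule pr(1))
    have "subspace {x. pr d x = (if d = e then x else 0)}"
      unfolding subspace_def by (auto simp: p.zero p.add p.scale)
    moreover have "D e \<subseteq> {x. pr d x = (if d = e then x else 0)}" unfolding D_def using pr(2) by auto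
    ultimately show ?thesis using span_minimal that by blast
  qed
  have DV: "span (D d) \<subseteq> V" for d unfolding VB D_def by (rule span_mono) auto
  have DC: "span (D d) \<subseteq> C d" for d by (rule span_minimal[OF _ C(3)]) (use B(3) in \<open>auto simp: D_def\<close>)
  have pp: "pr d (pr e x) = (if d = e then pr d x else 0)" for d e x using onspan[OF prD, of d e x] by simp
  have out: "pr d x = 0" if d: "d < lo \<or> hi < d" for d x
  proof -
    have "D d = {}" using B(3) d unfolding D_def by fastforce
    then show ?thesis using prD[of d x] by simp
  qed
  have psum: "(\<Sum>d=lo..hi. pr d x) = x" if x: "x \<in> V" for x
  proof -
    have lin0: "pr d 0 = 0" "pr d (x + y) = pr d x + pr d y" "pr d (c *s x) = c *s pr d x" for d x y c
    proof -
      interpret p: Vector_Spaces.linear scale scale "pr d" by (rule pr(1))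
      show "pr d 0 = 0" "pr d (x + y) = pr d x + pr d y" "pr d (c *s x) = c *s pr d x" by (simp_all add: p.zero p.add p.scale)
    qed
    have "subspace {x. (\<Sum>d=lo..hi. pr d x) = x}"
      unfolding subspace_def by (auto simp: lin0 sum.distrib scale_sum_right[symmetric])
    moreover have "B \<subseteq> {x. (\<Sum>d=lo..hi. pr d x) = x}"
    proof
      fix b assume b: "b \<in> B"
      have "(\<Sum>d=lo..hi. pr d b) = (\<Sum>d=lo..hi. if \<delta> b = d then b else 0)" using pr(2)[OF b] by simp
      also have "\<dots> = b" using B(3) b by (simp add: sum.delta)
      finally show "b \<in> {x. (\<Sum>d=lo..hi. pr d x) = x}" by simp
    qed
    ultimately have "span B \<subseteq> {x. (\<Sum>d=lo..hi. pr d x) = x}" by (simp add: span_minimal)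
    then show ?thesis using x VB by blast
  qed
  have Feq: "F m = {x \<in> V. \<forall>d<m. pr d x = 0}" for m
  proof (cases "lo \<le> m")
    case True
    have Fm: "F m = span {b \<in> B. m \<le> \<delta> b}" using B(4) True by blast
    show ?thesis
    proof
      have z: "span {b \<in> B. m \<le> \<delta> b} \<subseteq> {x. pr d x = 0}" if "d < m" for d
      proof (rule span_minimal)
        interpret p: Vector_Spaces.linear scale scale "pr d" by (rule pr(1))
        show "subspace {x. pr d x = 0}" unfolding subspace_def by (auto simp: p.zero p.add p.scale)
        show "{b \<in> B. m \<le> \<delta> b} \<subseteq> {x. pr d x = 0}" using pr(2) that by auto
      qed
      then show "F m \<subseteq> {x \<in> V. \<forall>d<m. pr d x = 0}" using FV[of m] unfolding Fm by blast
      show "{x \<in> V. \<forall>d<m. pr d x = 0} \<subseteq> F m"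
      proof
        fix x assume x: "x \<in> {x \<in> V. \<forall>d<m. pr d x = 0}"
        have "pr d x \<in> F m" for d
        proof (cases "d < m")
          case True
          then show ?thesis using x subspace_0[OF sub] by simp
        next
          case False
          then have "D d \<subseteq> {b \<in> B. m \<le> \<delta> b}" unfolding D_def by auto
          then show ?thesis using prD[of d x] span_mono Fm by blast
        qed
        then have "(\<Sum>d=lo..hi. pr d x) \<in> F m" by (intro subspace_sum[OF sub])
        then show "x \<in> F m" using psum x by simp
      qed
    qed
  next
    case False
    then show ?thesis using low[of m] out by auto
  qed
  show thesis
    by (rule that[of pr]) (use pr(1) pp out psum Feq subsetD[OF DV prD] subsetD[OF DC prD] in blast)+
qed

end

text \<open>
  Given a filtration and projections that split it as a filtration of vector spaces, \<open>gmul\<close> below is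
  the multiplication of the associated graded algebra, carried to \<open>V\<close> by the splitting: multiply
  homogeneous parts in \<open>A\<close> and discard the terms of higher degree.
\<close>

locale filtered_coordinates = algebra_coordinates scale A \<phi> V
  for scale :: "'k::field \<Rightarrow> 'v::ab_group_add \<Rightarrow> 'v" (infixr "*s" 75)
    and A :: "('k, 'a) module" (structure) and \<phi> :: "'a \<Rightarrow> 'v" and V :: "'v set" +
  fixes F :: "int \<Rightarrow> 'a set" and pr :: "int \<Rightarrow> 'v \<Rightarrow> 'v" and lo hi :: int
  assumes is_filtration: "filtration A F"
    and proj_linear: "Vector_Spaces.linear scale scale (pr d)"
    and proj_V: "pr d x \<in> V"
    and proj_proj: "pr d (pr e x) = (if d = e then pr d x else 0)"
    and proj_out: "d < lo \<or> hi < d \<Longrightarrow> pr d x = 0"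
    and proj_sum: "x \<in> V \<Longrightarrow> (\<Sum>d=lo..hi. pr d x) = x"
    and F_image: "\<phi> ` F m = {x \<in> V. \<forall>d<m. pr d x = 0}"
begin

lemma proj_add [simp]: "pr d (x + y) = pr d x + pr d y"
  and proj_diff [simp]: "pr d (x - y) = pr d x - pr d y"
  and proj_scale [simp]: "pr d (c *s x) = c *s pr d x"
  and proj_0 [simp]: "pr d 0 = 0"
proof -
  interpret p: Vector_Spaces.linear scale scale "pr d" by (rule proj_linear)
  show "pr d (x + y) = pr d x + pr d y" "pr d (x - y) = pr d x - pr d y"
    "pr d (c *s x) = c *s pr d x" "pr d 0 = 0" by (simp_all add: p.add p.diff p.scale p.zero)
qed

lemma proj_sum_distrib: "pr d (\<Sum>i\<in>I. f i) = (\<Sum>i\<in>I. pr d (f i))"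
  by (induction I rule: infinite_finite_induct) auto

definition low_filt :: "int \<Rightarrow> 'v set" where
  "low_filt m = {x \<in> V. \<forall>d<m. pr d x = 0}"

lemma low_filt_image: "\<phi> ` F m = low_filt m"
  unfolding low_filt_def by (rule F_image)

lemma F_mem: "x \<in> carrier A \<Longrightarrow> x \<in> F m \<longleftrightarrow> \<phi> x \<in> low_filt m"
  using mem_iff[OF filtration_carrier[OF is_filtration], of x m] low_filt_image by simp

lemma low_filt_V: "x \<in> low_filt m \<Longrightarrow> x \<in> V"
  unfolding low_filt_def by simp

lemma proj_low_filt: "pr d x \<in> low_filt d"
  unfolding low_filt_def by (simp add: proj_proj proj_V)

lemma low_filt_rest: "x \<in> low_filt d \<Longrightarrow> x - pr d x \<in> low_filt (d + 1)"
  unfolding low_filt_def by (auto simp: proj_proj proj_V subspace_diff[OF W_subspace] order_le_less)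

lemma mu_low_filt: "v \<in> low_filt m \<Longrightarrow> w \<in> low_filt l \<Longrightarrow> mu v w \<in> low_filt (m + l)"
proof -
  assume v: "v \<in> low_filt m" and w: "w \<in> low_filt l"
  have "lift v \<in> F m" "lift w \<in> F l" using v w F_mem lift low_filt_V by simp_all
  then have "lift v \<otimes> lift w \<in> F (m + l)" using is_filtration unfolding filtration_def by blast
  then show ?thesis unfolding mu_def low_filt_image[symmetric] by (rule imageI)
qed

definition gmul :: "'v \<Rightarrow> 'v \<Rightarrow> 'v" where
  "gmul x y = (\<Sum>d=lo..hi. \<Sum>e=lo..hi. pr (d + e) (mu (pr d x) (pr e y)))"

lemma gmul_hom: "gmul (pr d x) (pr e y) = pr (d + e) (mu (pr d x) (pr e y))"
proof -
  have "pr (d' + e') (mu (pr d' (pr d x)) (pr e' (pr e y)))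
      = (if d' = d then if e' = e then pr (d + e) (mu (pr d x) (pr e y)) else 0 else 0)" for d' e'
    by (simp add: proj_proj mu_0 proj_V V0)
  then have "gmul (pr d x) (pr e y) = (\<Sum>d'=lo..hi. \<Sum>e'=lo..hi.
      if d' = d then if e' = e then pr (d + e) (mu (pr d x) (pr e y)) else 0 else 0)" unfolding gmul_def by simp
  also have "\<dots> = (\<Sum>d'=lo..hi. if d' = d then \<Sum>e'=lo..hi. if e' = e then pr (d + e) (mu (pr d x) (pr e y)) else 0 else 0)"
    by (intro sum.cong) auto
  also have "\<dots> = pr (d + e) (mu (pr d x) (pr e y))"
    using proj_out[of d x] proj_out[of e y] by (auto simp: sum.delta mu_0 proj_V V0 not_le)
  finally show ?thesis .
qed

lemma gmul_add_left: "gmul (x + y) z = gmul x z + gmul y z"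
  unfolding gmul_def by (simp add: mu_add_left proj_V sum.distrib)

lemma gmul_add_right: "gmul z (x + y) = gmul z x + gmul z y"
  unfolding gmul_def by (simp add: mu_add_right proj_V sum.distrib)

lemma gmul_scale_left: "gmul (c *s x) z = c *s gmul x z"
  unfolding gmul_def by (simp add: mu_scale_left proj_V scale_sum_right)

lemma gmul_scale_right: "gmul z (c *s x) = c *s gmul z x"
  unfolding gmul_def by (simp add: mu_scale_right proj_V scale_sum_right)

lemma gmul_0: "gmul 0 x = 0" "gmul x 0 = 0"
  using gmul_scale_left[of 0 0 x] gmul_scale_right[of x 0 0] by simp_all

lemma gmul_sum_left: "gmul (\<Sum>i\<in>I. f i) x = (\<Sum>i\<in>I. gmul (f i) x)"
  by (induction I rule: infinite_finite_induct) (auto simp: gmul_add_left gmul_0)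

lemma gmul_sum_right: "gmul x (\<Sum>i\<in>I. f i) = (\<Sum>i\<in>I. gmul x (f i))"
  by (induction I rule: infinite_finite_induct) (auto simp: gmul_add_right gmul_0)

text \<open>
  What \<open>gmul\<close> discards from one product would end up in too high a degree in the product of three factors, so both
  sides are the lowest part of the product of the three factors in \<open>A\<close>.
\<close>

lemma gmul_assoc_hom: "gmul (gmul (pr d x) (pr e y)) (pr f z) = gmul (pr d x) (gmul (pr e y) (pr f z))"
proof -
  let ?a = "pr d x" and ?b = "pr e y" and ?c = "pr f z"
  have kill: "pr k t = 0" if "t \<in> low_filt m" "k < m" for k t m using that unfolding low_filt_def by simp
  let ?t = "mu ?a ?b"
  have t: "?t \<in> low_filt (d + e)" by (intro mu_low_filt proj_low_filt)
  have tV: "?t - pr (d + e) ?t \<in> V" by (rule low_filt_V[OF low_filt_rest[OF t]])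
  have "mu (?t - pr (d + e) ?t) ?c \<in> low_filt (d + e + 1 + f)" by (intro mu_low_filt low_filt_rest t proj_low_filt)
  then have "pr (d + e + f) (mu (?t - pr (d + e) ?t) ?c) = 0" by (rule kill) simp
  moreover have "mu ?t ?c = mu (pr (d + e) ?t) ?c + mu (?t - pr (d + e) ?t) ?c"
    using mu_add_left[OF proj_V tV proj_V, of "d + e" ?t f z] by simp
  ultimately have L: "pr (d + e + f) (mu ?t ?c) = pr (d + e + f) (mu (pr (d + e) ?t) ?c)" by simp
  let ?s = "mu ?b ?c"
  have s: "?s \<in> low_filt (e + f)" by (intro mu_low_filt proj_low_filt)
  have sV: "?s - pr (e + f) ?s \<in> V" by (rule low_filt_V[OF low_filt_rest[OF s]])
  have "mu ?a (?s - pr (e + f) ?s) \<in> low_filt (d + (e + f + 1))" by (intro mu_low_filt low_filt_rest s proj_low_filt)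
  then have "pr (d + e + f) (mu ?a (?s - pr (e + f) ?s)) = 0" by (rule kill) simp
  moreover have "mu ?a ?s = mu ?a (pr (e + f) ?s) + mu ?a (?s - pr (e + f) ?s)"
    using mu_add_right[OF proj_V proj_V sV, of d x "e + f" ?s] by simp
  ultimately have R: "pr (d + e + f) (mu ?a ?s) = pr (d + e + f) (mu ?a (pr (e + f) ?s))" by simp
  have "mu ?t ?c = mu ?a ?s" by (rule mu_assoc[OF proj_V proj_V proj_V])
  then show ?thesis unfolding gmul_hom using L R by (simp add: add.assoc)
qed

lemma gmul_assoc: "gmul (gmul x y) z = gmul x (gmul y z)"
proof -
  \<comment> \<open>\<open>gmul\<close> only sees \<open>\<sigma> x\<close>, which is \<open>x\<close> for \<open>x \<in> V\<close>; so the general case is a sum of homogeneous ones.\<close>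
  define \<sigma> where "\<sigma> x = (\<Sum>d=lo..hi. pr d x)" for x
  have pr\<sigma>: "pr d (\<sigma> x) = pr d x" for d x
  proof -
    have "pr d (\<sigma> x) = (\<Sum>e=lo..hi. if e = d then pr d x else 0)"
      unfolding \<sigma>_def proj_sum_distrib by (intro sum.cong) (auto simp: proj_proj)
    then show ?thesis using proj_out[of d x] by (auto simp: sum.delta not_le)
  qed
  have dep: "gmul x y = gmul (\<sigma> x) (\<sigma> y)" "gmul x (\<sigma> y) = gmul x y" "gmul (\<sigma> x) y = gmul x y" for x y
    unfolding gmul_def pr\<sigma> by simp_all
  have "gmul (gmul x y) z = gmul (gmul (\<sigma> x) (\<sigma> y)) (\<sigma> z)" by (simp only: dep(2,3))
  also have "\<dots> = gmul (\<sigma> x) (gmul (\<sigma> y) (\<sigma> z))"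
    unfolding \<sigma>_def by (simp only: gmul_sum_left gmul_sum_right gmul_assoc_hom)
  also have "\<dots> = gmul x (gmul y z)" by (simp only: dep(2,3))
  finally show ?thesis .
qed

lemma gmul_V: "gmul x y \<in> V"
  unfolding gmul_def by (intro subspace_sum[OF W_subspace] proj_V)

sublocale graded_alg scale V gmul pr lo hi
proof unfold_locales
  show "pr (d + e) (gmul (pr d x) (pr e y)) = gmul (pr d x) (pr e y)" for d e x y
    unfolding gmul_hom by (simp add: proj_proj)
qed (simp_all add: W_subspace W_findim gmul_V gmul_assoc gmul_add_left gmul_add_right gmul_scale_left gmul_scale_right
    proj_V proj_proj proj_out proj_sum)

lemma lead_low: "lead_filt m = low_filt m"
  unfolding lead_filt_def low_filt_def ..

sublocale graded_model scale V gmul pr lo hi A \<phi> F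
proof unfold_locales
  show "\<phi> ` F m = lead_filt m" for m unfolding lead_low by (rule low_filt_image)
  fix v w d e assume v: "v \<in> comp d" and w: "w \<in> comp e"
  have vw: "pr d v = v" "pr e w = w" using comp_eq v w by auto
  have "mu v w \<in> low_filt (d + e)" using mu_low_filt[OF proj_low_filt proj_low_filt, of d v e w] vw by simp
  then have "mu v w - pr (d + e) (mu v w) \<in> low_filt (d + e + 1)" by (rule low_filt_rest)
  then show "mu v w - gmul v w \<in> lead_filt (d + e + 1)" using gmul_hom[of d v e w] vw unfolding lead_low by simp
qed (rule is_filtration)

end

section \<open>The associated graded algebra\<close>

context graded_model
begin

lemma gr_F_sub: "VectorSpace.subspace class_ring (F m) A"
  by (rule filtration_subspace[OF F_filtration])

lemma F_in_A: "x \<in> F m \<Longrightarrow> x \<in> carrier A"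
  using filtration_carrier[OF F_filtration] by blast

lemma F_lead_mem: "x \<in> F m \<Longrightarrow> \<phi> x \<in> lead_filt m"
  using F_lead[of m] by blast

text \<open>
  The leading form of a coset in \<open>F m / F (m + 1)\<close>; the choice of a representative does not matter by
  \<open>lead_coset\<close>.
\<close>

definition lead :: "int \<Rightarrow> 'a set \<Rightarrow> 'v" where
  "lead m X = pr m (\<phi> (SOME x. x \<in> X))"

lemma coset_self: "x \<in> carrier A \<Longrightarrow> x \<in> F m +>\<^bsub>A\<^esub> x"
  using coset_mem[OF gr_F_sub] F_lead subspace_0[OF lead_filt_subspace] by simp

lemma gr_piece_carrier: "carrier (gr_piece A F m) = (\<lambda>x. F (m + 1) +>\<^bsub>A\<^esub> x) ` F m"
  unfolding gr_piece_def quotient_space_def by simp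

lemma F_kernel: "x \<in> \<phi> ` F m \<Longrightarrow> pr m x = 0 \<longleftrightarrow> x \<in> \<phi> ` F (m + 1)"
  unfolding F_lead lead_filt_Suc by simp

lemma F_Suc: "F (m + 1) \<subseteq> F m"
  by (rule filtration_antimono[OF F_filtration]) simp

lemma lead_coset: "x \<in> F m \<Longrightarrow> lead m (F (m + 1) +>\<^bsub>A\<^esub> x) = pr m (\<phi> x)"
  unfolding lead_def by (rule quotient_value[OF gr_F_sub gr_F_sub F_Suc pr_linear F_kernel])

lemma gr_piece_coordinates: "coordinates scale (gr_piece A F m) (lead m) (comp m)"
  using quotient_coordinates[OF gr_F_sub gr_F_sub F_Suc pr_linear F_kernel, of m]
  unfolding gr_piece_def F_lead lead_filt_image lead_def[abs_def] .

lemma lead_in_comp: "X \<in> carrier (gr_piece A F m) \<Longrightarrow> lead m X \<in> comp m"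
  by (rule coordinates.hom_W[OF gr_piece_coordinates])

lemma gr_piece_trivial:
  "m < lo \<or> hi < m \<Longrightarrow> X \<in> carrier (gr_piece A F m) \<Longrightarrow> X = \<zero>\<^bsub>gr_piece A F m\<^esub>"
  using coordinates.eq_0_iff[OF gr_piece_coordinates, of X m] lead_in_comp[of X m] comp_out[of m] by blast

lemma Gr_carrier: "carrier (Gr A F) = {f. \<forall>m. f m \<in> carrier (gr_piece A F m)}"
proof -
  have "finite {m. f m \<noteq> \<zero>\<^bsub>gr_piece A F m\<^esub>}" if "\<forall>m. f m \<in> carrier (gr_piece A F m)" for f
  proof (rule finite_subset)
    show "{m. f m \<noteq> \<zero>\<^bsub>gr_piece A F m\<^esub>} \<subseteq> {lo..hi}"
    proof
      fix m assume "m \<in> {m. f m \<noteq> \<zero>\<^bsub>gr_piece A F m\<^esub>}"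
      then show "m \<in> {lo..hi}" using gr_piece_trivial[of m "f m"] that by fastforce
    qed
  qed simp
  then show ?thesis unfolding Gr_def by auto
qed

definition Gr_coord :: "(int \<Rightarrow> 'a set) \<Rightarrow> 'v" where
  "Gr_coord f = (\<Sum>d=lo..hi. lead d (f d))"

lemma pr_Gr_coord: "f \<in> carrier (Gr A F) \<Longrightarrow> pr d (Gr_coord f) = lead d (f d)"
proof -
  assume f: "f \<in> carrier (Gr A F)"
  have l: "lead e (f e) \<in> comp e" for e using f lead_in_comp unfolding Gr_carrier by blast
  have "pr d (Gr_coord f) = (\<Sum>e=lo..hi. if e = d then lead d (f d) else 0)"
    unfolding Gr_coord_def pr_sum_distrib by (intro sum.cong) (auto simp: pr_of_comp[OF l])
  moreover have "lead d (f d) = 0" if "d < lo \<or> hi < d" using l[of d] comp_out[OF that] by blast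
  ultimately show ?thesis by (auto simp: not_le)
qed

lemma Gr_coordinates: "coordinates scale (Gr A F) Gr_coord V"
proof unfold_locales
  have VS: "Gr_coord f \<in> V" if "f \<in> carrier (Gr A F)" for f
  proof -
    have "lead d (f d) \<in> V" for d using that lead_in_comp comp_V unfolding Gr_carrier by blast
    then show ?thesis unfolding Gr_coord_def by (rule subspace_sum[OF V_subspace])
  qed
  show "subspace V" "findim V" by (rule V_subspace V_findim)+
  show "inj_on Gr_coord (carrier (Gr A F))"
  proof (rule inj_onI, rule ext)
    fix f g d assume f: "f \<in> carrier (Gr A F)" and g: "g \<in> carrier (Gr A F)" and eq: "Gr_coord f = Gr_coord g"
    have "lead d (f d) = lead d (g d)" using pr_Gr_coord[OF f, of d] pr_Gr_coord[OF g, of d] eq by simp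
    then show "f d = g d" using coordinates.eqI[OF gr_piece_coordinates, of "f d" d "g d"] f g unfolding Gr_carrier by simp
  qed
  show "Gr_coord ` carrier (Gr A F) = V"
  proof
    show "V \<subseteq> Gr_coord ` carrier (Gr A F)"
    proof
      fix v assume v: "v \<in> V"
      have "\<exists>X. X \<in> carrier (gr_piece A F d) \<and> lead d X = pr d v" for d
        using coordinates.image[OF gr_piece_coordinates, of d] pr_comp[of d v] by (metis imageE)
      then obtain f where f: "\<And>d. f d \<in> carrier (gr_piece A F d) \<and> lead d (f d) = pr d v" by metis
      then have fG: "f \<in> carrier (Gr A F)" unfolding Gr_carrier by simp
      have "Gr_coord f = v" unfolding Gr_coord_def using f pr_sum[OF v] by simp
      then show "v \<in> Gr_coord ` carrier (Gr A F)" using fG by blast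
    qed
  qed (use VS in auto)
  have zero: "\<zero>\<^bsub>Gr A F\<^esub> = (\<lambda>m. \<zero>\<^bsub>gr_piece A F m\<^esub>)"
    and add: "f \<oplus>\<^bsub>Gr A F\<^esub> g = (\<lambda>m. f m \<oplus>\<^bsub>gr_piece A F m\<^esub> g m)"
    and smult: "c \<odot>\<^bsub>Gr A F\<^esub> f = (\<lambda>m. c \<odot>\<^bsub>gr_piece A F m\<^esub> f m)" for f g c
    unfolding Gr_def by simp_all
  show "\<zero>\<^bsub>Gr A F\<^esub> \<in> carrier (Gr A F)"
    unfolding Gr_carrier zero using coordinates.M_zero[OF gr_piece_coordinates] by simp
  show "Gr_coord \<zero>\<^bsub>Gr A F\<^esub> = 0"
    unfolding Gr_coord_def zero using coordinates.hom_zero[OF gr_piece_coordinates] by simp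
  fix f assume "f \<in> carrier (Gr A F)"
  then have f: "\<And>m. f m \<in> carrier (gr_piece A F m)" unfolding Gr_carrier by blast
  show "c \<odot>\<^bsub>Gr A F\<^esub> f \<in> carrier (Gr A F)" for c
    unfolding Gr_carrier smult using coordinates.M_smult[OF gr_piece_coordinates f] by simp
  show "Gr_coord (c \<odot>\<^bsub>Gr A F\<^esub> f) = c *s Gr_coord f" for c
    unfolding Gr_coord_def smult using coordinates.hom_smult[OF gr_piece_coordinates f] by (simp add: scale_sum_right)
  fix g assume "g \<in> carrier (Gr A F)"
  then have g: "\<And>m. g m \<in> carrier (gr_piece A F m)" unfolding Gr_carrier by blast
  show "f \<oplus>\<^bsub>Gr A F\<^esub> g \<in> carrier (Gr A F)"
    unfolding Gr_carrier add using coordinates.M_add[OF gr_piece_coordinates f g] by simp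
  show "Gr_coord (f \<oplus>\<^bsub>Gr A F\<^esub> g) = Gr_coord f + Gr_coord g"
    unfolding Gr_coord_def add using coordinates.hom_add[OF gr_piece_coordinates f g] by (simp add: sum.distrib)
qed

lemma mu_lead_filt: "v \<in> lead_filt i \<Longrightarrow> w \<in> lead_filt j \<Longrightarrow> mu v w \<in> lead_filt (i + j)"
proof -
  assume "v \<in> lead_filt i" "w \<in> lead_filt j"
  then obtain x y where xy: "x \<in> F i" "v = \<phi> x" "y \<in> F j" "w = \<phi> y" unfolding F_lead[symmetric] by blast
  then have "x \<otimes> y \<in> F (i + j)" using F_filtration unfolding filtration_def by blast
  then show ?thesis using xy F_lead_mem mu_hom[OF F_in_A F_in_A] by metis
qed

text \<open>
  Products of representatives are determined up to the next step of the filtration.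
\<close>

lemma mu_diff_lead_filt:
  assumes v: "v \<in> lead_filt i" "v' \<in> lead_filt i" "v - v' \<in> lead_filt (i + 1)"
    and w: "w \<in> lead_filt j" "w' \<in> lead_filt j" "w - w' \<in> lead_filt (j + 1)"
  shows "mu v w - mu v' w' \<in> lead_filt (i + j + 1)"
proof -
  have V: "v' \<in> V" "w' \<in> V" "w \<in> V" "v - v' \<in> V" "w - w' \<in> V" using v w lead_filt_V by blast+
  have "mu v w - mu v' w' = mu (v - v') w + mu v' (w - w')"
    using mu_add_left[OF V(4,1,3)] mu_add_right[OF V(1,5,2)] by simp
  moreover have "mu (v - v') w \<in> lead_filt (i + j + 1)" using mu_lead_filt[OF v(3) w(1)] by (simp add: algebra_simps)
  moreover have "mu v' (w - w') \<in> lead_filt (i + j + 1)" using mu_lead_filt[OF v(2) w(3)] by (simp add: algebra_simps)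
  ultimately show ?thesis by (simp add: subspace_add[OF lead_filt_subspace])
qed

lemma rcoset_mult_coset:
  assumes x: "x \<in> F i" and y: "y \<in> F j"
  shows "rcoset_mult A (F (i + j + 1)) (F (i + 1) +>\<^bsub>A\<^esub> x) (F (j + 1) +>\<^bsub>A\<^esub> y) = F (i + j + 1) +>\<^bsub>A\<^esub> (x \<otimes> y)"
proof -
  have xA: "x \<in> carrier A" and yA: "y \<in> carrier A" using x y F_in_A by auto
  have eq: "F (i + j + 1) +>\<^bsub>A\<^esub> (a \<otimes> b) = F (i + j + 1) +>\<^bsub>A\<^esub> (x \<otimes> y)"
    if a: "a \<in> F (i + 1) +>\<^bsub>A\<^esub> x" and b: "b \<in> F (j + 1) +>\<^bsub>A\<^esub> y" for a b
  proof -
    have a': "a \<in> carrier A" "\<phi> a - \<phi> x \<in> lead_filt (i + 1)" using a coset_mem[OF gr_F_sub xA] F_lead by auto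
    have b': "b \<in> carrier A" "\<phi> b - \<phi> y \<in> lead_filt (j + 1)" using b coset_mem[OF gr_F_sub yA] F_lead by auto
    have mem: "\<phi> c \<in> lead_filt k" if "\<phi> c - \<phi> z \<in> lead_filt (k + 1)" "z \<in> F k" for c z k
    proof -
      have "\<phi> c - \<phi> z \<in> lead_filt k" using that(1) unfolding lead_filt_Suc by simp
      then have "(\<phi> c - \<phi> z) + \<phi> z \<in> lead_filt k" using F_lead_mem[OF that(2)] by (rule subspace_add[OF lead_filt_subspace])
      then show ?thesis by simp
    qed
    have "mu (\<phi> a) (\<phi> b) - mu (\<phi> x) (\<phi> y) \<in> lead_filt (i + j + 1)"
      by (rule mu_diff_lead_filt[OF mem[OF a'(2) x] F_lead_mem[OF x] a'(2) mem[OF b'(2) y] F_lead_mem[OF y] b'(2)])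
    then have "\<phi> (a \<otimes> b) - \<phi> (x \<otimes> y) \<in> lead_filt (i + j + 1)" by (simp add: mu_hom a'(1) b'(1) xA yA)
    then show ?thesis
      using coset_eq_iff[OF gr_F_sub alg.mult_closed[OF a'(1) b'(1)] alg.mult_closed[OF xA yA]] F_lead by simp
  qed
  have "rcoset_mult A (F (i + j + 1)) (F (i + 1) +>\<^bsub>A\<^esub> x) (F (j + 1) +>\<^bsub>A\<^esub> y)
    = (\<Union>a\<in>F (i + 1) +>\<^bsub>A\<^esub> x. \<Union>b\<in>F (j + 1) +>\<^bsub>A\<^esub> y. F (i + j + 1) +>\<^bsub>A\<^esub> (x \<otimes> y))"
    unfolding rcoset_mult_def using eq by (intro SUP_cong refl) auto
  also have "\<dots> = F (i + j + 1) +>\<^bsub>A\<^esub> (x \<otimes> y)" using coset_self[OF xA] coset_self[OF yA] by blast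
  finally show ?thesis .
qed

text \<open>
  The product of cosets that enters the definition of \<open>Gr A F\<close> is the multiplication \<open>\<star>\<close> of leading forms.
\<close>

lemma gr_product:
  assumes X: "X \<in> carrier (gr_piece A F i)" and Y: "Y \<in> carrier (gr_piece A F (n - i))"
  shows "rcoset_mult A (F (n + 1)) X Y \<in> carrier (gr_piece A F n)"
    and "lead n (rcoset_mult A (F (n + 1)) X Y) = lead i X \<star> lead (n - i) Y"
proof -
  obtain x where x: "x \<in> F i" "X = F (i + 1) +>\<^bsub>A\<^esub> x" using X unfolding gr_piece_carrier by blast
  obtain y where y: "y \<in> F (n - i)" "Y = F (n - i + 1) +>\<^bsub>A\<^esub> y" using Y unfolding gr_piece_carrier by blast
  have R: "rcoset_mult A (F (n + 1)) X Y = F (n + 1) +>\<^bsub>A\<^esub> (x \<otimes> y)"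
    using rcoset_mult_coset[OF x(1) y(1)] unfolding x(2) y(2) by simp
  have xy: "x \<otimes> y \<in> F n" using F_filtration x(1) y(1) unfolding filtration_def by (metis add_diff_cancel_left' diff_add_cancel add.commute)
  show "rcoset_mult A (F (n + 1)) X Y \<in> carrier (gr_piece A F n)" unfolding R gr_piece_carrier using xy by blast
  let ?v = "pr i (\<phi> x)" and ?w = "pr (n - i) (\<phi> y)"
  have rest: "v - pr k v \<in> lead_filt (k + 1)" if "v \<in> lead_filt k" for v k
    unfolding lead_filt_Suc
    using subspace_diff[OF lead_filt_subspace that comp_lead_filt[OF pr_comp order_refl]] by (simp add: pr_pr)
  have "mu (\<phi> x) (\<phi> y) - mu ?v ?w \<in> lead_filt (i + (n - i) + 1)"
    by (intro mu_diff_lead_filt rest F_lead_mem x(1) y(1) comp_lead_filt[OF pr_comp]) simp_all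
  moreover have "mu ?v ?w - ?v \<star> ?w \<in> lead_filt (i + (n - i) + 1)" by (rule gr_mul[OF pr_comp pr_comp])
  ultimately have "pr n (mu (\<phi> x) (\<phi> y)) = pr n (?v \<star> ?w)" unfolding lead_filt_def by simp
  also have "\<dots> = ?v \<star> ?w" using comp_mul[OF pr_comp[of i "\<phi> x"] pr_comp[of "n - i" "\<phi> y"]] comp_eq by simp
  finally show "lead n (rcoset_mult A (F (n + 1)) X Y) = lead i X \<star> lead (n - i) Y"
    unfolding R lead_coset[OF xy] unfolding x(2) y(2) lead_coset[OF x(1)] lead_coset[OF y(1)]
    by (simp add: mu_hom F_in_A[OF x(1)] F_in_A[OF y(1)])
qed

lemma Gr_mult:
  assumes f: "f \<in> carrier (Gr A F)" and g: "g \<in> carrier (Gr A F)"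
  shows "f \<otimes>\<^bsub>Gr A F\<^esub> g \<in> carrier (Gr A F) \<and> Gr_coord (f \<otimes>\<^bsub>Gr A F\<^esub> g) = Gr_coord f \<star> Gr_coord g"
proof -
  let ?S = "{i. f i \<noteq> \<zero>\<^bsub>gr_piece A F i\<^esub>}"
  let ?p = "\<lambda>n i. rcoset_mult A (F (n + 1)) (f i) (g (n - i))"
  have m: "(f \<otimes>\<^bsub>Gr A F\<^esub> g) n = (\<Oplus>\<^bsub>gr_piece A F n\<^esub> i \<in> ?S. ?p n i)" for n unfolding Gr_def by simp
  have fm: "f i \<in> carrier (gr_piece A F i)" and gm: "g i \<in> carrier (gr_piece A F i)" for i
    using f g unfolding Gr_carrier by auto
  have fz: "lead i (f i) = 0" if "i \<notin> ?S" for i using that coordinates.hom_zero[OF gr_piece_coordinates, of i] by simp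
  have S: "?S \<subseteq> {lo..hi}"
  proof
    fix i assume "i \<in> ?S"
    then show "i \<in> {lo..hi}" using gr_piece_trivial[OF _ fm, of i] by fastforce
  qed
  have car: "(f \<otimes>\<^bsub>Gr A F\<^esub> g) n \<in> carrier (gr_piece A F n)" for n
    unfolding m by (rule coordinates.finsum_in_carrier[OF gr_piece_coordinates]) (rule gr_product(1)[OF fm gm])
  then have G: "f \<otimes>\<^bsub>Gr A F\<^esub> g \<in> carrier (Gr A F)" unfolding Gr_carrier by simp
  have "pr n (Gr_coord (f \<otimes>\<^bsub>Gr A F\<^esub> g)) = pr n (Gr_coord f \<star> Gr_coord g)" for n
  proof -
    have "pr n (Gr_coord (f \<otimes>\<^bsub>Gr A F\<^esub> g)) = (\<Sum>i\<in>?S. lead n (?p n i))"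
      unfolding pr_Gr_coord[OF G] m
      by (rule coordinates.hom_finsum[OF gr_piece_coordinates]) (rule gr_product(1)[OF fm gm])
    also have "\<dots> = (\<Sum>i\<in>?S. lead i (f i) \<star> lead (n - i) (g (n - i)))" by (simp only: gr_product(2)[OF fm gm])
    also have "\<dots> = (\<Sum>i=lo..hi. lead i (f i) \<star> lead (n - i) (g (n - i)))"
      by (rule sum.mono_neutral_left) (use S fz in auto)
    also have "\<dots> = pr n (Gr_coord f \<star> Gr_coord g)"
      using pr_mul_sum[OF coordinates.hom_W[OF Gr_coordinates f] coordinates.hom_W[OF Gr_coordinates g], of n]
      by (simp add: pr_Gr_coord f g)
    finally show ?thesis .
  qed
  then have "Gr_coord (f \<otimes>\<^bsub>Gr A F\<^esub> g) = Gr_coord f \<star> Gr_coord g"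
    by (rule eq_by_components[OF coordinates.hom_W[OF Gr_coordinates G] mul_closed])
  then show ?thesis using G by simp
qed

lemma Gr_component_eq: "Gr_component A F d = {f \<in> carrier (Gr A F). Gr_coord f \<in> comp d}"
proof -
  have "(\<forall>i. i \<noteq> d \<longrightarrow> f i = \<zero>\<^bsub>gr_piece A F i\<^esub>) \<longleftrightarrow> Gr_coord f \<in> comp d" if f: "f \<in> carrier (Gr A F)" for f
  proof -
    have z: "f i = \<zero>\<^bsub>gr_piece A F i\<^esub> \<longleftrightarrow> pr i (Gr_coord f) = 0" for i
      using coordinates.eq_0_iff[OF gr_piece_coordinates, of "f i" i] f pr_Gr_coord[OF f, of i] unfolding Gr_carrier by simp
    have fV: "Gr_coord f \<in> V" by (rule coordinates.hom_W[OF Gr_coordinates f])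
    show ?thesis unfolding z
    proof
      assume "\<forall>i. i \<noteq> d \<longrightarrow> pr i (Gr_coord f) = 0"
      then have "pr d (Gr_coord f) = Gr_coord f"
        by (intro eq_by_components[OF pr_closed fV]) (auto simp: pr_pr)
      then show "Gr_coord f \<in> comp d" unfolding comp_def by simp
    qed (auto simp: pr_of_comp)
  qed
  then show ?thesis unfolding Gr_component_def by blast
qed

end

section \<open>Graded-semistable algebras and canonical filtrations\<close>

context vspace
begin

lemma exists_splitting:
  fixes A :: "('k, 'a) module" and C :: "int \<Rightarrow> 'v set"
  assumes co: "coordinates scale A \<phi> V" and alg: "fin_dim_algebra A" and F: "filtration A F"
    and C: "\<And>m. subspace (C m)" "\<And>m. C m \<subseteq> \<phi> ` F m" "\<And>m. \<phi> ` F m \<subseteq> span (\<phi> ` F (m + 1) \<union> C m)"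
  obtains pr lo hi where "filtered_coordinates scale A \<phi> V F pr lo hi" "\<And>d x. pr d x \<in> C d"
proof -
  interpret co: coordinates scale A \<phi> V by (rule co)
  obtain n n' where n: "\<forall>i\<le>n. F i = carrier A" "\<forall>i\<ge>n'. F i = {\<zero>\<^bsub>A\<^esub>}" using F unfolding filtration_def by blast
  have sub: "subspace (\<phi> ` F m)" for m using co.filtration_subspace[OF F] co.subspace_iff by blast
  have dec: "\<phi> ` F (m + 1) \<subseteq> \<phi> ` F m" for m by (intro image_mono co.filtration_antimono[OF F]) simp
  have low: "\<phi> ` F m = V" if "m \<le> min n n'" for m using n(1) that co.image by simp
  have high: "\<phi> ` F m = {0}" if "n' < m" for m using n(2) that co.hom_zero by simp
  have lohi: "min n n' \<le> n' + 1" by simp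
  obtain pr where pr: "\<And>d. Vector_Spaces.linear scale scale (pr d)" "\<And>d x. pr d x \<in> V" "\<And>d x. pr d x \<in> C d"
    "\<And>d e x. pr d (pr e x) = (if d = e then pr d x else 0)"
    "\<And>d x. d < min n n' \<or> n' < d \<Longrightarrow> pr d x = 0"
    "\<And>x. x \<in> V \<Longrightarrow> (\<Sum>d=min n n'..n'. pr d x) = x"
    "\<And>m. \<phi> ` F m = {x \<in> V. \<forall>d<m. pr d x = 0}"
    using adapted_projections[where F = "\<lambda>m. \<phi> ` F m" and C = C and lo = "min n n'" and hi = n',
      OF co.W_subspace co.W_findim sub dec C(2,3,1) low high lohi] by blast
  have "filtered_coordinates scale A \<phi> V F pr (min n n') n'"
    by (intro filtered_coordinates.intro algebra_coordinates.intro co filtered_coordinates_axioms.intro alg F pr)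
  then show thesis using that pr(3) by blast
qed

end

context filtered_coordinates
begin

text \<open>
  If \<open>x\<close> lies in \<open>G d\<close>, the components of \<open>x\<close>, with \<open>x\<close> subtracted from the one of degree \<open>d\<close>, are elements of the
  components of \<open>G\<close> with sum 0; so they all vanish.
\<close>

lemma comp_of_grading:
  assumes G: "graded_algebra A G" and prG: "\<And>d x. pr d x \<in> \<phi> ` G d"
  shows "comp d = \<phi> ` G d"
proof
  interpret G: graded_algebra A G by (rule G)
  have GA: "G i \<subseteq> carrier A" and GS: "subspace (\<phi> ` G i)" for i using G.component_subspace subspace_iff by auto
  show "comp d \<subseteq> \<phi> ` G d"
  proof
    fix x assume "x \<in> comp d"
    then show "x \<in> \<phi> ` G d" using prG[of d x] comp_eq by simp
  qed
  show "\<phi> ` G d \<subseteq> comp d"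
  proof
    fix x assume x: "x \<in> \<phi> ` G d"
    have GV: "\<phi> ` G i \<subseteq> V" for i using image_mono[OF GA[of i], of \<phi>] unfolding image .
    have xV: "x \<in> V" by (rule subsetD[OF GV x])
    define I where "I = insert d {lo..hi}"
    define h where "h e = (if e = d then pr d x - x else pr e x)" for e
    have hG: "h e \<in> \<phi> ` G e" for e using prG x subspace_diff[OF GS] unfolding h_def by auto
    have hV: "h e \<in> V" for e by (rule subsetD[OF GV hG])
    have lG: "lift (h e) \<in> G e" for e
    proof -
      obtain a where a: "a \<in> G e" "h e = \<phi> a" using hG[of e] by auto
      then show ?thesis using lift_hom[OF subsetD[OF GA a(1)]] by simp
    qed
    have "(\<Sum>e\<in>I. h e) = (\<Sum>e\<in>I. pr e x) - x"
    proof -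
      have "(\<Sum>e\<in>I. h e) = (\<Sum>e\<in>I. pr e x - (if e = d then x else 0))" unfolding h_def by (intro sum.cong) auto
      then show ?thesis unfolding I_def by (simp add: sum_subtractf)
    qed
    also have "(\<Sum>e\<in>I. pr e x) = (\<Sum>e=lo..hi. pr e x)"
      unfolding I_def by (rule sum.mono_neutral_right) (auto intro: proj_out)
    also have "\<dots> = x" by (rule proj_sum[OF xV])
    finally have "(\<Sum>e\<in>I. h e) = 0" by simp
    then have "\<phi> (\<Oplus>e\<in>I. lift (h e)) = 0"
      using hom_finsum[of I "\<lambda>e. lift (h e)"] lift[OF hV] by simp
    then have "(\<Oplus>e\<in>I. lift (h e)) = \<zero>"
      using eq_0_iff[OF finsum_in_carrier[of I "\<lambda>e. lift (h e)"]] lift[OF hV] by simp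
    then have "lift (h d) = \<zero>"
      by (intro G.component_independent[of I "\<lambda>e. lift (h e)" d] lG) (auto simp: I_def)
    then have "h d = 0" using lift(2)[OF hV, of d] by simp
    then show "x \<in> comp d" unfolding h_def comp_def by simp
  qed
qed

text \<open>
  In a graded algebra the product of homogeneous elements has no terms of higher degree to discard.
\<close>

lemma gmul_of_grading:
  assumes G: "graded_algebra A G" and prG: "\<And>d x. pr d x \<in> \<phi> ` G d"
    and x: "x \<in> carrier A" and y: "y \<in> carrier A"
  shows "\<phi> (x \<otimes> y) = gmul (\<phi> x) (\<phi> y)"
proof -
  interpret G: graded_algebra A G by (rule G)
  note cG = comp_of_grading[OF G prG]
  have "pr (d + e) (mu (pr d v) (pr e w)) = mu (pr d v) (pr e w)" for d e v w
  proof -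
    obtain a where a: "a \<in> G d" "pr d v = \<phi> a" using prG[of d v] by auto
    obtain b where b: "b \<in> G e" "pr e w = \<phi> b" using prG[of e w] by auto
    note ab = a b
    have "G i \<subseteq> carrier A" for i using G.component_subspace[of i] subspace_iff by simp
    then have "a \<in> carrier A" "b \<in> carrier A" using ab by auto
    then have "mu (pr d v) (pr e w) = \<phi> (a \<otimes> b)" unfolding ab by (rule mu_hom)
    also have "\<dots> \<in> comp (d + e)" unfolding cG by (rule imageI[OF G.component_mult[OF ab(1,3)]])
    finally show ?thesis by (rule comp_eq)
  qed
  then have "gmul (\<phi> x) (\<phi> y) = (\<Sum>d=lo..hi. \<Sum>e=lo..hi. mu (pr d (\<phi> x)) (pr e (\<phi> y)))" unfolding gmul_def by simp
  also have "\<dots> = mu (\<Sum>d=lo..hi. pr d (\<phi> x)) (\<Sum>e=lo..hi. pr e (\<phi> y))" by (rule mu_sum[symmetric]) (rule proj_V)+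
  also have "\<dots> = mu (\<phi> x) (\<phi> y)" using proj_sum hom_W x y by simp
  finally show ?thesis using mu_hom[OF x y] by simp
qed

end

lemma canonical_minimal:
  assumes "canonical_filtration A F" "unstable A"
  shows "filtration A F" and "filtration A F' \<Longrightarrow> F' \<noteq> trivial_filtration A \<Longrightarrow> nu A F \<le> nu A F'"
  using assms unfolding canonical_filtration_def by auto

lemma (in graded_algebra) component_in_carrier: "x \<in> G i \<Longrightarrow> x \<in> carrier A"
  using component_subspace[of i] unfolding VectorSpace.subspace_def submodule_def by blast

lemma (in graded_algebra) component_in_split:
  assumes "x \<in> G i" "m \<le> i"
  shows "x \<in> split_filtration A G m"
proof -
  have "(\<Oplus>\<^bsub>A\<^esub>j\<in>{i}. x) = x" using component_in_carrier[OF assms(1)] by (subst M.finsum_insert) auto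
  then show ?thesis unfolding split_filtration_def graded_sum_def using assms by (auto intro!: exI[of _ "\<lambda>_. x"] exI[of _ "{i}"])
qed

text \<open>
  The trivial filtration is 0 in positive weights, which kills the components of positive degree. It is
  everything in weight 0, so an element of negative degree is a sum of elements of nonnegative degree, hence 0.
\<close>

lemma (in graded_algebra) trivial_split:
  assumes "split_filtration A G = trivial_filtration A"
  shows "trivial_grading A G"
  unfolding trivial_grading_def
proof (intro allI impI)
  fix i :: int assume i: "i \<noteq> 0"
  have z: "\<zero>\<^bsub>A\<^esub> \<in> G i" using component_subspace[of i] unfolding VectorSpace.subspace_def submodule_def by blast
  have "x = \<zero>\<^bsub>A\<^esub>" if x: "x \<in> G i" for x
  proof (cases "i > 0")
    case True
    then show ?thesis using component_in_split[OF x order_refl] unfolding assms trivial_filtration_def by simp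
  next
    case False
    have xA: "x \<in> carrier A" by (rule component_in_carrier[OF x])
    then have "x \<in> split_filtration A G 0" unfolding assms trivial_filtration_def by simp
    then obtain I f where I: "finite I" "I \<subseteq> {0..}" "\<forall>j\<in>I. f j \<in> G j" "x = (\<Oplus>\<^bsub>A\<^esub>j\<in>I. f j)"
      unfolding split_filtration_def by (rule graded_sumE)
    have iI: "i \<notin> I" using I(2) i False by auto
    define h where "h j = (if j = i then (- 1) \<odot>\<^bsub>A\<^esub> x else f j)" for j
    have sub: "submodule class_ring (G i) A" using component_subspace[of i] unfolding VectorSpace.subspace_def by simp
    have mx: "(- 1) \<odot>\<^bsub>A\<^esub> x \<in> G i" using submodule.smult_closed[OF sub _ x, of "- 1"] by simp
    have hG: "h j \<in> G j" if "j \<in> insert i I" for j using that I(3) mx unfolding h_def by auto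
    have hA: "h j \<in> carrier A" if "j \<in> insert i I" for j by (rule component_in_carrier[OF hG[OF that]])
    have "(\<Oplus>\<^bsub>A\<^esub>j\<in>insert i I. h j) = h i \<oplus>\<^bsub>A\<^esub> (\<Oplus>\<^bsub>A\<^esub>j\<in>I. h j)"
      using I(1) iI hA by (intro M.finsum_insert) auto
    also have "(\<Oplus>\<^bsub>A\<^esub>j\<in>I. h j) = x"
      unfolding I(4) using iI component_in_carrier I(3) by (intro M.finsum_cong') (auto simp: h_def)
    also have "h i \<oplus>\<^bsub>A\<^esub> x = \<zero>\<^bsub>A\<^esub>"
      using smult_l_distr[of "- 1" 1 x] smult_one[OF xA] smult_l_null[OF xA] xA unfolding h_def by simp
    finally have "h i = \<zero>\<^bsub>A\<^esub>" using component_independent[of "insert i I" h i] hG I(1) by auto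
    then have "(- 1) \<odot>\<^bsub>A\<^esub> ((- 1) \<odot>\<^bsub>A\<^esub> x) = \<zero>\<^bsub>A\<^esub>" unfolding h_def by simp
    then show ?thesis using smult_assoc1[of "- 1" "- 1" x] smult_one[OF xA] xA by simp
  qed
  then show "G i = {\<zero>\<^bsub>A\<^esub>}" using z by blast
qed

theorem proposition7p5:
  assumes "perfect_field TYPE('k::field)"
  shows "(\<forall>(A :: ('k, 'a) module) G.
            graded_algebra A G \<and> \<not> trivial_grading A G \<and> graded_semistable A G \<longrightarrow>
              graded_sum A G {..<0} \<subseteq> jacobson_radical A \<inter> center A \<and>
              graded_sum A G {0<..} \<subseteq> jacobson_radical A \<and>
              (\<forall>n<0. annihilator A \<inter> G n = {\<zero>\<^bsub>A\<^esub>}))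
       \<and> (\<forall>(A :: ('k, 'b) module) F.
            fin_dim_algebra A \<and> unstable A \<and> canonical_filtration A F \<longrightarrow>
              graded_sum (Gr A F) (Gr_component A F) {..<0}
                \<subseteq> jacobson_radical (Gr A F) \<inter> center (Gr A F) \<and>
              graded_sum (Gr A F) (Gr_component A F) {0<..} \<subseteq> jacobson_radical (Gr A F) \<and>
              (\<forall>n<0. annihilator (Gr A F) \<inter> Gr_component A F n = {\<zero>\<^bsub>Gr A F\<^esub>}))"
proof (intro conjI[OF allI[OF allI[OF impI]] allI[OF allI[OF impI]]])
  fix A :: "('k, 'a) module" and G
  assume "graded_algebra A G \<and> \<not> trivial_grading A G \<and> graded_semistable A G"
  then have G: "graded_algebra A G" and nt: "\<not> trivial_grading A G" and ss: "graded_semistable A G" by auto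
  interpret G: graded_algebra A G by (rule G)
  let ?F = "split_filtration A G"
  have can: "canonical_filtration A ?F" using ss unfolding graded_semistable_def .
  have unst: "unstable A"
  proof
    assume "semistable A"
    then have "?F = trivial_filtration A" using can unfolding canonical_filtration_def by simp
    then show False using G.trivial_split nt by blast
  qed
  note min = canonical_minimal[OF can unst]
  obtain \<phi> :: "'a \<Rightarrow> 'a \<Rightarrow> 'k" and V where co: "coordinates fun_scale A \<phi> V" by (rule G.exists_coordinates)
  interpret co: coordinates fun_scale A \<phi> V by (rule co)
  have C1: "fun_space.subspace (\<phi> ` G m)" for m using G.component_subspace co.subspace_iff by blast
  have C2: "\<phi> ` G m \<subseteq> \<phi> ` ?F m" for m using G.component_in_split by (intro image_mono) auto
  have C3: "\<phi> ` ?F m \<subseteq> fun_space.span (\<phi> ` ?F (m + 1) \<union> \<phi> ` G m)" for m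
  proof
    fix v assume "v \<in> \<phi> ` ?F m"
    then obtain x where x: "x \<in> graded_sum A G {m..}" "v = \<phi> x" unfolding split_filtration_def by blast
    obtain I f where I: "finite I" "I \<subseteq> {m..}" "\<forall>i\<in>I. f i \<in> G i" "x = (\<Oplus>\<^bsub>A\<^esub>i\<in>I. f i)"
      by (rule graded_sumE[OF x(1)])
    have "v = (\<Sum>i\<in>I. \<phi> (f i))" unfolding x(2) I(4) using I(3) G.component_in_carrier by (intro co.hom_finsum) auto
    also have "\<dots> \<in> fun_space.span (\<phi> ` ?F (m + 1) \<union> \<phi> ` G m)"
    proof (rule fun_space.span_sum)
      fix i assume i: "i \<in> I"
      have fG: "f i \<in> G i" using I(3) i by blast
      have "\<phi> (f i) \<in> \<phi> ` ?F (m + 1) \<union> \<phi> ` G m"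
      proof (cases "i = m")
        case True
        then show ?thesis using fG by blast
      next
        case False
        then have "m + 1 \<le> i" using I(2) i by fastforce
        then show ?thesis using G.component_in_split[OF fG, of "m + 1"] by blast
      qed
      then show "\<phi> (f i) \<in> fun_space.span (\<phi> ` ?F (m + 1) \<union> \<phi> ` G m)" by (rule fun_space.span_base)
    qed
    finally show "v \<in> fun_space.span (\<phi> ` ?F (m + 1) \<union> \<phi> ` G m)" .
  qed
  obtain pr lo hi where fc: "filtered_coordinates fun_scale A \<phi> V ?F pr lo hi" and prG: "\<And>d x. pr d x \<in> \<phi> ` G d"
    by (rule fun_space.exists_splitting[where C = "\<lambda>m. \<phi> ` G m", OF co G.fin_dim_algebra_axioms min(1) C1 C2 C3]) blast
  interpret fc: filtered_coordinates fun_scale A \<phi> V ?F pr lo hi by (rule fc)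
  interpret opt: optimal_alg fun_scale V fc.gmul pr lo hi by (rule fc.optimal_of_minimal[OF unst min(2)])
  have mult: "x \<otimes>\<^bsub>A\<^esub> y \<in> carrier A \<and> \<phi> (x \<otimes>\<^bsub>A\<^esub> y) = fc.gmul (\<phi> x) (\<phi> y)"
    if "x \<in> carrier A" "y \<in> carrier A" for x y
    using G.mult_closed[OF that] fc.gmul_of_grading[OF G prG that] by simp
  have C: "G d = {x \<in> carrier A. \<phi> x \<in> fc.comp d}" for d
    using co.mem_iff[of "G d"] G.component_in_carrier unfolding fc.comp_of_grading[OF G prG] by blast
  show "graded_sum A G {..<0} \<subseteq> jacobson_radical A \<inter> center A \<and>
        graded_sum A G {0<..} \<subseteq> jacobson_radical A \<and>
        (\<forall>n<0. annihilator A \<inter> G n = {\<zero>\<^bsub>A\<^esub>})"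
    using opt.radical_center_annihilator[OF co mult C] by blast
next
  fix A :: "('k, 'b) module" and F
  assume "fin_dim_algebra A \<and> unstable A \<and> canonical_filtration A F"
  then have alg: "fin_dim_algebra A" and unst: "unstable A" and can: "canonical_filtration A F" by auto
  interpret alg: fin_dim_algebra A by (rule alg)
  note min = canonical_minimal[OF can unst]
  obtain \<phi> :: "'b \<Rightarrow> 'b \<Rightarrow> 'k" and V where co: "coordinates fun_scale A \<phi> V" by (rule alg.exists_coordinates)
  interpret co: coordinates fun_scale A \<phi> V by (rule co)
  have C1: "fun_space.subspace (\<phi> ` F m)" for m using co.filtration_subspace[OF min(1)] co.subspace_iff by blast
  have C3: "\<phi> ` F m \<subseteq> fun_space.span (\<phi> ` F (m + 1) \<union> \<phi> ` F m)" for m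
    by (rule subset_trans[OF Un_upper2 fun_space.span_superset])
  obtain pr lo hi where fc: "filtered_coordinates fun_scale A \<phi> V F pr lo hi"
    by (rule fun_space.exists_splitting[where C = "\<lambda>m. \<phi> ` F m", OF co alg min(1) C1 order_refl C3]) blast
  interpret fc: filtered_coordinates fun_scale A \<phi> V F pr lo hi by (rule fc)
  interpret opt: optimal_alg fun_scale V fc.gmul pr lo hi by (rule fc.optimal_of_minimal[OF unst min(2)])
  show "graded_sum (Gr A F) (Gr_component A F) {..<0} \<subseteq> jacobson_radical (Gr A F) \<inter> center (Gr A F) \<and>
        graded_sum (Gr A F) (Gr_component A F) {0<..} \<subseteq> jacobson_radical (Gr A F) \<and>
        (\<forall>n<0. annihilator (Gr A F) \<inter> Gr_component A F n = {\<zero>\<^bsub>Gr A F\<^esub>})"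
    using opt.radical_center_annihilator[OF fc.Gr_coordinates fc.Gr_mult fc.Gr_component_eq] by blast
qed

end
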